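(* Let $\mathbb{F}_q$ be a finite field with $q$ elements, $\Omega=\varinjlim_n\mathbb{F}_q^n$ the countably infinite dimensional $\mathbb{F}_q$-vector space, $G=\mathrm{GL}(\Omega)$ the group of all $\mathbb{F}_q$-linear automorphisms of $\Omega$, and $\mathscr{E}=\mathrm{End}_{\mathbb{F}_q}(\Omega)$ the monoid of all $\mathbb{F}_q$-linear endomorphisms of $\Omega$. Let $k$ be a commutative ring, and let $\mathscr{E}_s$ (resp. $\mathscr{E}_i$) be the submonoid of surjective (resp. injective) elements of $\mathscr{E}$. There are equivalences of categories $$\mathrm{VA}_q\text{-}\mathrm{Mod}\;\simeq\;k\mathscr{E}\text{-}\mathrm{Mod}^{\mathrm{uc}}\;\simeq\;k\mathscr{E}_s\text{-}\mathrm{Mod}^{\mathrm{uc}},$$ $$k\mathscr{E}_i\text{-}\mathrm{Mod}^{\mathrm{uc}}\;\simeq\;kG\text{-}\mathrm{Mod}^{\mathrm{uc}}\;\simeq\;\mathrm{Sh}(\mathrm{VI}_q^{\mathrm{op}},J_{at},\underline{k}),$$ where $\mathrm{VI}_q$ is the wide subcategory of $\mathrm{VA}_q$ with injective morphisms.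
   Context: $\mathrm{VA}_q$ is the category of finite dimensional $\mathbb{F}_q$-vector spaces and $\mathbb{F}_q$-linear maps. A $\mathrm{VA}_q$-module is a covariant functor $\mathrm{VA}_q\to k\text{-}\mathrm{Mod}$. For a monoid $\mathscr{M}\leqslant\Omega^\Omega$, a $k\mathscr{M}$-module $V$ is uniformly continuous if for every $v\in V$ there is a finite subset $A_v\subseteq\Omega$ such that for all $h,h'\in\mathscr{M}$, $h|_{A_v}=h'|_{A_v}$ implies $h\cdot v=h'\cdot v$; $k\mathscr{M}\text{-}\mathrm{Mod}^{\mathrm{uc}}$ denotes the category of such modules. $J_{at}$ is the atomic topology on $\mathrm{VI}_q^{\mathrm{op}}$ (every nonempty sieve is covering), and $\mathrm{Sh}(-,J_{at},\underline{k})$ is the category of sheaves of modules over the constant structure sheaf $\underline{k}$, i.e. sheaves of $k$-modules. *)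

theory Defs
  imports "Jordan_Normal_Form.Missing_VectorSpace" "HOL-Algebra.Bij" "HOL-Library.FuncSet"
begin

section \<open>Categories, functors and equivalences\<close>

text \<open>Hom-sets are indexed by pairs of objects and need not be disjoint, so composition takes the
  three objects involved: for \<open>f \<in> Hom C X Y\<close> and \<open>g \<in> Hom C Y Z\<close> the composite ``\<open>g\<close> after \<open>f\<close>''
  is \<open>Cmp C X Y Z g f\<close>.\<close>

record ('o, 'm) cat =
  Ob :: "'o set"
  Hom :: "'o \<Rightarrow> 'o \<Rightarrow> 'm set"
  Idt :: "'o \<Rightarrow> 'm"
  Cmp :: "'o \<Rightarrow> 'o \<Rightarrow> 'o \<Rightarrow> 'm \<Rightarrow> 'm \<Rightarrow> 'm"

definition category :: "('o, 'm) cat \<Rightarrow> bool" where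
  "category C \<longleftrightarrow>
    (\<forall>X\<in>Ob C. Idt C X \<in> Hom C X X) \<and>
    (\<forall>X\<in>Ob C. \<forall>Y\<in>Ob C. \<forall>Z\<in>Ob C. \<forall>f\<in>Hom C X Y. \<forall>g\<in>Hom C Y Z. Cmp C X Y Z g f \<in> Hom C X Z) \<and>
    (\<forall>X\<in>Ob C. \<forall>Y\<in>Ob C. \<forall>f\<in>Hom C X Y.
      Cmp C X X Y f (Idt C X) = f \<and> Cmp C X Y Y (Idt C Y) f = f) \<and>
    (\<forall>W\<in>Ob C. \<forall>X\<in>Ob C. \<forall>Y\<in>Ob C. \<forall>Z\<in>Ob C. \<forall>f\<in>Hom C W X. \<forall>g\<in>Hom C X Y. \<forall>h\<in>Hom C Y Z.
      Cmp C W X Z (Cmp C X Y Z h g) f = Cmp C W Y Z h (Cmp C W X Y g f))"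

definition is_iso :: "('o, 'm) cat \<Rightarrow> 'o \<Rightarrow> 'o \<Rightarrow> 'm \<Rightarrow> bool" where
  "is_iso C X Y f \<longleftrightarrow> f \<in> Hom C X Y \<and>
    (\<exists>g\<in>Hom C Y X. Cmp C X Y X g f = Idt C X \<and> Cmp C Y X Y f g = Idt C Y)"

definition opposite :: "('o, 'm) cat \<Rightarrow> ('o, 'm) cat" where
  "opposite C = \<lparr>Ob = Ob C, Hom = (\<lambda>X Y. Hom C Y X), Idt = Idt C,
    Cmp = (\<lambda>X Y Z g f. Cmp C Z Y X f g)\<rparr>"

definition full_subcat :: "('o, 'm) cat \<Rightarrow> ('o \<Rightarrow> bool) \<Rightarrow> ('o, 'm) cat" where
  "full_subcat C P = C\<lparr>Ob := {X \<in> Ob C. P X}\<rparr>"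

definition wide_subcat :: "('o, 'm) cat \<Rightarrow> ('o \<Rightarrow> 'o \<Rightarrow> 'm \<Rightarrow> bool) \<Rightarrow> ('o, 'm) cat" where
  "wide_subcat C P = C\<lparr>Hom := (\<lambda>X Y. {f \<in> Hom C X Y. P X Y f})\<rparr>"

record ('o, 'm, 'p, 'n) func =
  on_ob :: "'o \<Rightarrow> 'p"
  on_hom :: "'o \<Rightarrow> 'o \<Rightarrow> 'm \<Rightarrow> 'n"

definition is_functor :: "('o, 'm) cat \<Rightarrow> ('p, 'n) cat \<Rightarrow> ('o, 'm, 'p, 'n) func \<Rightarrow> bool" where
  "is_functor C D \<Phi> \<longleftrightarrow>
    (\<forall>X\<in>Ob C. on_ob \<Phi> X \<in> Ob D) \<and>
    (\<forall>X\<in>Ob C. \<forall>Y\<in>Ob C. \<forall>f\<in>Hom C X Y. on_hom \<Phi> X Y f \<in> Hom D (on_ob \<Phi> X) (on_ob \<Phi> Y)) \<and>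
    (\<forall>X\<in>Ob C. on_hom \<Phi> X X (Idt C X) = Idt D (on_ob \<Phi> X)) \<and>
    (\<forall>X\<in>Ob C. \<forall>Y\<in>Ob C. \<forall>Z\<in>Ob C. \<forall>f\<in>Hom C X Y. \<forall>g\<in>Hom C Y Z.
      on_hom \<Phi> X Z (Cmp C X Y Z g f) =
        Cmp D (on_ob \<Phi> X) (on_ob \<Phi> Y) (on_ob \<Phi> Z) (on_hom \<Phi> Y Z g) (on_hom \<Phi> X Y f))"

definition id_func :: "('o, 'm, 'o, 'm) func" where
  "id_func = \<lparr>on_ob = (\<lambda>X. X), on_hom = (\<lambda>X Y f. f)\<rparr>"

definition comp_func ::
    "('p, 'n, 'r, 's) func \<Rightarrow> ('o, 'm, 'p, 'n) func \<Rightarrow> ('o, 'm, 'r, 's) func" where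
  "comp_func \<Psi> \<Phi> = \<lparr>on_ob = (\<lambda>X. on_ob \<Psi> (on_ob \<Phi> X)),
    on_hom = (\<lambda>X Y f. on_hom \<Psi> (on_ob \<Phi> X) (on_ob \<Phi> Y) (on_hom \<Phi> X Y f))\<rparr>"

definition nat_trans :: "('o, 'm) cat \<Rightarrow> ('p, 'n) cat \<Rightarrow>
    ('o, 'm, 'p, 'n) func \<Rightarrow> ('o, 'm, 'p, 'n) func \<Rightarrow> ('o \<Rightarrow> 'n) \<Rightarrow> bool" where
  "nat_trans C D \<Phi> \<Psi> \<eta> \<longleftrightarrow>
    (\<forall>X\<in>Ob C. \<eta> X \<in> Hom D (on_ob \<Phi> X) (on_ob \<Psi> X)) \<and>
    (\<forall>X\<in>Ob C. \<forall>Y\<in>Ob C. \<forall>f\<in>Hom C X Y.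
      Cmp D (on_ob \<Phi> X) (on_ob \<Phi> Y) (on_ob \<Psi> Y) (\<eta> Y) (on_hom \<Phi> X Y f) =
      Cmp D (on_ob \<Phi> X) (on_ob \<Psi> X) (on_ob \<Psi> Y) (on_hom \<Psi> X Y f) (\<eta> X))"

definition nat_iso :: "('o, 'm) cat \<Rightarrow> ('p, 'n) cat \<Rightarrow>
    ('o, 'm, 'p, 'n) func \<Rightarrow> ('o, 'm, 'p, 'n) func \<Rightarrow> ('o \<Rightarrow> 'n) \<Rightarrow> bool" where
  "nat_iso C D \<Phi> \<Psi> \<eta> \<longleftrightarrow> nat_trans C D \<Phi> \<Psi> \<eta> \<and>
    (\<forall>X\<in>Ob C. is_iso D (on_ob \<Phi> X) (on_ob \<Psi> X) (\<eta> X))"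

definition equivalent_cats :: "('o, 'm) cat \<Rightarrow> ('p, 'n) cat \<Rightarrow> bool" (infix \<open>\<simeq>\<^sub>c\<^sub>a\<^sub>t\<close> 50) where
  "C \<simeq>\<^sub>c\<^sub>a\<^sub>t D \<longleftrightarrow> category C \<and> category D \<and>
    (\<exists>\<Phi> \<Psi> \<eta> \<epsilon>. is_functor C D \<Phi> \<and> is_functor D C \<Psi> \<and>
      nat_iso C C id_func (comp_func \<Psi> \<Phi>) \<eta> \<and> nat_iso D D (comp_func \<Phi> \<Psi>) id_func \<epsilon>)"

text \<open>Natural transformations are normalised (\<open>extensional\<close>) off the objects of the source, so that
  equality of morphisms in the functor category is componentwise equality. The functors themselves
  are not normalised: functors agreeing on the source category are isomorphic via identities.\<close>

definition functor_cat ::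
    "('o, 'm) cat \<Rightarrow> ('p, 'n) cat \<Rightarrow> (('o, 'm, 'p, 'n) func, 'o \<Rightarrow> 'n) cat" where
  "functor_cat C D = \<lparr>
    Ob = {\<Phi>. is_functor C D \<Phi>},
    Hom = (\<lambda>\<Phi> \<Psi>. {\<eta> \<in> extensional (Ob C). nat_trans C D \<Phi> \<Psi> \<eta>}),
    Idt = (\<lambda>\<Phi>. \<lambda>X\<in>Ob C. Idt D (on_ob \<Phi> X)),
    Cmp = (\<lambda>\<Phi> \<Psi> \<Theta> \<theta> \<eta>. \<lambda>X\<in>Ob C. Cmp D (on_ob \<Phi> X) (on_ob \<Psi> X) (on_ob \<Theta> X) (\<theta> X) (\<eta> X))\<rparr>"


section \<open>Modules\<close>

text \<open>The library's locale \<open>module\<close> requires a commutative ring of scalars; monoid algebras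
  need the same axioms over an arbitrary ring.\<close>

locale left_module = R?: ring R + M?: abelian_group M
    for R :: "('r, 'x) ring_scheme" (structure) and M :: "('r, 'a) module" (structure) +
  assumes smult_closed: "\<lbrakk>a \<in> carrier R; x \<in> carrier M\<rbrakk> \<Longrightarrow> a \<odot>\<^bsub>M\<^esub> x \<in> carrier M"
    and smult_l_distr: "\<lbrakk>a \<in> carrier R; b \<in> carrier R; x \<in> carrier M\<rbrakk> \<Longrightarrow>
      (a \<oplus>\<^bsub>R\<^esub> b) \<odot>\<^bsub>M\<^esub> x = a \<odot>\<^bsub>M\<^esub> x \<oplus>\<^bsub>M\<^esub> b \<odot>\<^bsub>M\<^esub> x"
    and smult_r_distr: "\<lbrakk>a \<in> carrier R; x \<in> carrier M; y \<in> carrier M\<rbrakk> \<Longrightarrow>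
      a \<odot>\<^bsub>M\<^esub> (x \<oplus>\<^bsub>M\<^esub> y) = a \<odot>\<^bsub>M\<^esub> x \<oplus>\<^bsub>M\<^esub> a \<odot>\<^bsub>M\<^esub> y"
    and smult_assoc1: "\<lbrakk>a \<in> carrier R; b \<in> carrier R; x \<in> carrier M\<rbrakk> \<Longrightarrow>
      (a \<otimes>\<^bsub>R\<^esub> b) \<odot>\<^bsub>M\<^esub> x = a \<odot>\<^bsub>M\<^esub> (b \<odot>\<^bsub>M\<^esub> x)"
    and smult_one: "x \<in> carrier M \<Longrightarrow> \<one>\<^bsub>R\<^esub> \<odot>\<^bsub>M\<^esub> x = x"

lemma left_module_iff_module:
  assumes "cring R"
  shows "left_module R M \<longleftrightarrow> module R M"
proof
  assume "left_module R M"
  then interpret left_module R M .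
  show "module R M"
    by (rule moduleI)
      (use assms smult_closed smult_l_distr smult_r_distr smult_assoc1 smult_one
        M.abelian_group_axioms in auto)
next
  assume "module R M"
  then interpret module R M .
  show "left_module R M"
    by unfold_locales (simp_all add: smult_l_distr smult_r_distr smult_assoc1)
qed

text \<open>The category of left \<open>R\<close>-modules whose underlying set is a subset of the type \<open>'a\<close>, with
  \<open>R\<close>-linear maps, normalised off the carrier of the source. The multiplicative fields that a
  \<open>module\<close> record inherits from \<open>ring\<close> are ignored; records differing only there are
  isomorphic objects. The type \<open>'a\<close> plays the role of a universe: it bounds the cardinality of the
  modules. If \<open>'a\<close> is infinite, it contains copies of all finite dimensional vector spaces over a
  finite field, and modules on \<open>'a\<close> are closed up to isomorphism under submodules, quotients and
  countable colimits.\<close>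

type_synonym ('r, 'a) mod_category = "(('r, 'a) module, 'a \<Rightarrow> 'a) cat"

definition lin_maps :: "('r, 'x) ring_scheme \<Rightarrow> ('r, 'a) module \<Rightarrow> ('r, 'b) module \<Rightarrow> ('a \<Rightarrow> 'b) set"
  where "lin_maps R M N = module_hom R M N \<inter> extensional (carrier M)"

definition ModCat :: "('r, 'x) ring_scheme \<Rightarrow> ('r, 'a) mod_category" where
  "ModCat R = \<lparr>
    Ob = {M. left_module R M},
    Hom = lin_maps R,
    Idt = (\<lambda>M. \<lambda>x\<in>carrier M. x),
    Cmp = (\<lambda>L M N g f. compose (carrier L) g f)\<rparr>"


section \<open>Uniformly continuous modules over a monoid of self-maps\<close>

definition monoid_algebra ::
    "('k, 'x) ring_scheme \<Rightarrow> ('m, 'y) monoid_scheme \<Rightarrow> ('m \<Rightarrow> 'k) ring" where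
  "monoid_algebra K M = \<lparr>
    carrier = {a. range a \<subseteq> carrier K \<and> finite {h. a h \<noteq> \<zero>\<^bsub>K\<^esub>} \<and> {h. a h \<noteq> \<zero>\<^bsub>K\<^esub>} \<subseteq> carrier M},
    mult = (\<lambda>a b h. finsum K (\<lambda>(x, y). a x \<otimes>\<^bsub>K\<^esub> b y)
      {(x, y). a x \<noteq> \<zero>\<^bsub>K\<^esub> \<and> b y \<noteq> \<zero>\<^bsub>K\<^esub> \<and> x \<otimes>\<^bsub>M\<^esub> y = h}),
    one = (\<lambda>h. if h = \<one>\<^bsub>M\<^esub> then \<one>\<^bsub>K\<^esub> else \<zero>\<^bsub>K\<^esub>),
    zero = (\<lambda>h. \<zero>\<^bsub>K\<^esub>),
    add = (\<lambda>a b h. a h \<oplus>\<^bsub>K\<^esub> b h)\<rparr>"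

definition of_monoid :: "('k, 'x) ring_scheme \<Rightarrow> 'm \<Rightarrow> 'm \<Rightarrow> 'k" where
  "of_monoid K h = (\<lambda>x. if x = h then \<one>\<^bsub>K\<^esub> else \<zero>\<^bsub>K\<^esub>)"

text \<open>Here and below \<open>H\<close> is a set of (extensional) self-maps of \<open>S\<close> closed under composition and
  containing the identity.\<close>

definition map_monoid :: "'s set \<Rightarrow> ('s \<Rightarrow> 's) set \<Rightarrow> ('s \<Rightarrow> 's) monoid" where
  "map_monoid S H = \<lparr>carrier = H, mult = compose S, one = (\<lambda>x\<in>S. x)\<rparr>"

definition uniformly_continuous ::
    "('k, 'x) ring_scheme \<Rightarrow> 's set \<Rightarrow> ('s \<Rightarrow> 's) set \<Rightarrow> (('s \<Rightarrow> 's) \<Rightarrow> 'k, 'a) module \<Rightarrow> bool" where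
  "uniformly_continuous K S H V \<longleftrightarrow>
    (\<forall>v\<in>carrier V. \<exists>A. finite A \<and> A \<subseteq> S \<and>
      (\<forall>h\<in>H. \<forall>h'\<in>H. (\<forall>x\<in>A. h x = h' x) \<longrightarrow> of_monoid K h \<odot>\<^bsub>V\<^esub> v = of_monoid K h' \<odot>\<^bsub>V\<^esub> v))"

definition UCMod ::
    "('k, 'x) ring_scheme \<Rightarrow> 's set \<Rightarrow> ('s \<Rightarrow> 's) set \<Rightarrow> (('s \<Rightarrow> 's) \<Rightarrow> 'k, 'a) mod_category" where
  "UCMod K S H =
    full_subcat (ModCat (monoid_algebra K (map_monoid S H))) (uniformly_continuous K S H)"


section \<open>Vector spaces over a finite field\<close>

definition VA :: "('f, 'x) ring_scheme \<Rightarrow> ('f, 'a) mod_category" where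
  "VA F = full_subcat (ModCat F) (\<lambda>V. vectorspace F V \<and> vectorspace.fin_dim F V)"

definition VI :: "('f, 'x) ring_scheme \<Rightarrow> ('f, 'a) mod_category" where
  "VI F = wide_subcat (VA F) (\<lambda>V W f. inj_on f (carrier V))"

text \<open>The union of the spaces \<open>F\<^sup>n\<close> along the inclusions appending zeros: finitely supported
  sequences. The fields \<open>mult\<close> and \<open>one\<close> play no role.\<close>

definition \<Omega> :: "('f, 'x) ring_scheme \<Rightarrow> ('f, nat \<Rightarrow> 'f) module" where
  "\<Omega> F = \<lparr>
    carrier = {x. range x \<subseteq> carrier F \<and> finite {n. x n \<noteq> \<zero>\<^bsub>F\<^esub>}},
    mult = undefined,
    one = undefined,
    zero = (\<lambda>n. \<zero>\<^bsub>F\<^esub>),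
    add = (\<lambda>x y n. x n \<oplus>\<^bsub>F\<^esub> y n),
    smult = (\<lambda>c x n. c \<otimes>\<^bsub>F\<^esub> x n)\<rparr>"

type_synonym 'f self_map = "(nat \<Rightarrow> 'f) \<Rightarrow> (nat \<Rightarrow> 'f)"

definition End_all :: "('f, 'x) ring_scheme \<Rightarrow> 'f self_map set" (\<open>\<E>\<close>) where
  "\<E> F = lin_maps F (\<Omega> F) (\<Omega> F)"

definition End_surj :: "('f, 'x) ring_scheme \<Rightarrow> 'f self_map set" (\<open>\<E>\<^sub>s\<close>) where
  "\<E>\<^sub>s F = {h \<in> \<E> F. h ` carrier (\<Omega> F) = carrier (\<Omega> F)}"

definition End_inj :: "('f, 'x) ring_scheme \<Rightarrow> 'f self_map set" (\<open>\<E>\<^sub>i\<close>) where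
  "\<E>\<^sub>i F = {h \<in> \<E> F. inj_on h (carrier (\<Omega> F))}"

definition GL :: "('f, 'x) ring_scheme \<Rightarrow> 'f self_map set" where
  "GL F = \<E> F \<inter> Bij (carrier (\<Omega> F))"


section \<open>Sheaves of modules\<close>

definition sieve :: "('o, 'm) cat \<Rightarrow> 'o \<Rightarrow> ('o \<times> 'm) set \<Rightarrow> bool" where
  "sieve C X S \<longleftrightarrow> X \<in> Ob C \<and>
    (\<forall>(Y, f)\<in>S. Y \<in> Ob C \<and> f \<in> Hom C Y X \<and> (\<forall>Z\<in>Ob C. \<forall>g\<in>Hom C Z Y. (Z, Cmp C Z Y X f g) \<in> S))"

definition atomic_topology :: "('o, 'm) cat \<Rightarrow> 'o \<Rightarrow> ('o \<times> 'm) set set" where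
  "atomic_topology C X = {S. sieve C X S \<and> S \<noteq> {}}"

text \<open>For a presheaf \<open>P\<close>, i.e. a functor on \<open>opposite C\<close>, the restriction along \<open>g \<in> Hom C Z Y\<close> is
  \<open>on_hom P Y Z g\<close>.\<close>

definition matching_family :: "('o, 'm) cat \<Rightarrow> ('o, 'm, ('k, 'a) module, 'a \<Rightarrow> 'a) func \<Rightarrow>
    'o \<Rightarrow> ('o \<times> 'm) set \<Rightarrow> ('o \<Rightarrow> 'm \<Rightarrow> 'a) \<Rightarrow> bool" where
  "matching_family C P X S x \<longleftrightarrow>
    (\<forall>(Y, f)\<in>S. x Y f \<in> carrier (on_ob P Y) \<and>
      (\<forall>Z\<in>Ob C. \<forall>g\<in>Hom C Z Y. on_hom P Y Z g (x Y f) = x Z (Cmp C Z Y X f g)))"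

definition is_sheaf :: "('o, 'm) cat \<Rightarrow> ('o \<Rightarrow> ('o \<times> 'm) set set) \<Rightarrow>
    ('o, 'm, ('k, 'a) module, 'a \<Rightarrow> 'a) func \<Rightarrow> bool" where
  "is_sheaf C J P \<longleftrightarrow> (\<forall>X\<in>Ob C. \<forall>S\<in>J X. \<forall>x. matching_family C P X S x \<longrightarrow>
    (\<exists>!s. s \<in> carrier (on_ob P X) \<and> (\<forall>(Y, f)\<in>S. on_hom P X Y f s = x Y f)))"

text \<open>Modules over the constant structure sheaf \<open>K\<close> are sheaves with values in \<open>ModCat K\<close>.\<close>

definition Sh :: "('o, 'm) cat \<Rightarrow> ('o \<Rightarrow> ('o \<times> 'm) set set) \<Rightarrow> ('k, 'a) mod_category \<Rightarrow>
    (('o, 'm, ('k, 'a) module, 'a \<Rightarrow> 'a) func, 'o \<Rightarrow> 'a \<Rightarrow> 'a) cat" where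
  "Sh C J M = full_subcat (functor_cat (opposite C) M) (is_sheaf C J)"

end

(*
  A left module over the monoid algebra is a K-module with a linear action of the monoid.  Uniform
  continuity makes the action determined by, and extendable from, any submonoid that is dense for
  pointwise convergence on finite sets; surjective endomorphisms are dense in all endomorphisms, and
  automorphisms in injective endomorphisms.

  For the other two equivalences, identify every finite dimensional space with some F^n inside Omega.
  A module V over End(Omega) or GL(Omega) gives the functor sending a finite subspace X to the vectors on
  which h acts through its restriction to X.  This functor is fully faithful.  A functor Phi is in the
  essential image, the preimage being its colimit along F^0 <= F^1 <= ..., iff inclusions act
  injectively and every element of Phi(Y) that is equalised by all pairs of maps agreeing on X <= Y
  comes from Phi(X).  On VA both conditions hold because inclusions split; on VI they are the sheaf
  condition for the atomic topology.
*)
theory Submission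
  imports Defs
begin

section \<open>Categories\<close>

text \<open>Two obstacles shape the argument. First, objects live on fixed types. The colimit of a
  functor with values on \<open>'u\<close> has to be rebuilt on \<open>'u\<close> itself, which
  works because countably many copies of an infinite type inject into it; and each F^n needs a copy
  on \<open>'w\<close>, which exists because an infinite type contains finite sets of every size.
  Second, objects of \<open>VA F\<close> are abstract modules, not subspaces of \<Omega>; a chosen
  embedding turns each of them into a finite subset of \<Omega>. The locale
  \<open>finite_subset_category\<close> keeps what both cases share: morphisms are precisely the
  maps between these finite sets that extend to an element of \<open>H\<close>. For endomorphisms
  this holds because coordinates can be truncated; for automorphisms it is the homogeneity of
  \<Omega>: an injective linear map on some F^n extends to an automorphism. The two conditions on a
  functor answer the two ways in which passing to the colimit and back could change it: injectivity
  keeps its elements apart, and descent prevents extra vectors over an object from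
  appearing.\<close>

lemma categoryI:
  assumes "\<And>X. X \<in> Ob C \<Longrightarrow> Idt C X \<in> Hom C X X"
    and "\<And>X Y Z f g. \<lbrakk>X \<in> Ob C; Y \<in> Ob C; Z \<in> Ob C; f \<in> Hom C X Y; g \<in> Hom C Y Z\<rbrakk> \<Longrightarrow>
      Cmp C X Y Z g f \<in> Hom C X Z"
    and "\<And>X Y f. \<lbrakk>X \<in> Ob C; Y \<in> Ob C; f \<in> Hom C X Y\<rbrakk> \<Longrightarrow> Cmp C X X Y f (Idt C X) = f"
    and "\<And>X Y f. \<lbrakk>X \<in> Ob C; Y \<in> Ob C; f \<in> Hom C X Y\<rbrakk> \<Longrightarrow> Cmp C X Y Y (Idt C Y) f = f"
    and "\<And>W X Y Z f g h. \<lbrakk>W \<in> Ob C; X \<in> Ob C; Y \<in> Ob C; Z \<in> Ob C;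
        f \<in> Hom C W X; g \<in> Hom C X Y; h \<in> Hom C Y Z\<rbrakk> \<Longrightarrow>
      Cmp C W X Z (Cmp C X Y Z h g) f = Cmp C W Y Z h (Cmp C W X Y g f)"
  shows "category C"
  unfolding category_def by (intro conjI ballI) (rule assms; assumption)+

lemma
  assumes "category C"
  shows Idt_in_Hom: "X \<in> Ob C \<Longrightarrow> Idt C X \<in> Hom C X X"
    and Cmp_in_Hom: "\<lbrakk>X \<in> Ob C; Y \<in> Ob C; Z \<in> Ob C; f \<in> Hom C X Y; g \<in> Hom C Y Z\<rbrakk> \<Longrightarrow>
      Cmp C X Y Z g f \<in> Hom C X Z"
    and Cmp_Idt_right: "\<lbrakk>X \<in> Ob C; Y \<in> Ob C; f \<in> Hom C X Y\<rbrakk> \<Longrightarrow> Cmp C X X Y f (Idt C X) = f"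
    and Cmp_Idt_left: "\<lbrakk>X \<in> Ob C; Y \<in> Ob C; f \<in> Hom C X Y\<rbrakk> \<Longrightarrow> Cmp C X Y Y (Idt C Y) f = f"
    and Cmp_assoc: "\<lbrakk>W \<in> Ob C; X \<in> Ob C; Y \<in> Ob C; Z \<in> Ob C;
        f \<in> Hom C W X; g \<in> Hom C X Y; h \<in> Hom C Y Z\<rbrakk> \<Longrightarrow>
      Cmp C W X Z (Cmp C X Y Z h g) f = Cmp C W Y Z h (Cmp C W X Y g f)"
  using assms unfolding category_def by blast+

lemma is_functorI:
  assumes "\<And>X. X \<in> Ob C \<Longrightarrow> on_ob \<Phi> X \<in> Ob D"
    and "\<And>X Y f. \<lbrakk>X \<in> Ob C; Y \<in> Ob C; f \<in> Hom C X Y\<rbrakk> \<Longrightarrow>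
      on_hom \<Phi> X Y f \<in> Hom D (on_ob \<Phi> X) (on_ob \<Phi> Y)"
    and "\<And>X. X \<in> Ob C \<Longrightarrow> on_hom \<Phi> X X (Idt C X) = Idt D (on_ob \<Phi> X)"
    and "\<And>X Y Z f g. \<lbrakk>X \<in> Ob C; Y \<in> Ob C; Z \<in> Ob C; f \<in> Hom C X Y; g \<in> Hom C Y Z\<rbrakk> \<Longrightarrow>
      on_hom \<Phi> X Z (Cmp C X Y Z g f) =
        Cmp D (on_ob \<Phi> X) (on_ob \<Phi> Y) (on_ob \<Phi> Z) (on_hom \<Phi> Y Z g) (on_hom \<Phi> X Y f)"
  shows "is_functor C D \<Phi>"
  unfolding is_functor_def by (intro conjI ballI) (rule assms; assumption)+

lemma
  assumes "is_functor C D \<Phi>"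
  shows functor_on_ob: "X \<in> Ob C \<Longrightarrow> on_ob \<Phi> X \<in> Ob D"
    and functor_on_hom: "\<lbrakk>X \<in> Ob C; Y \<in> Ob C; f \<in> Hom C X Y\<rbrakk> \<Longrightarrow>
      on_hom \<Phi> X Y f \<in> Hom D (on_ob \<Phi> X) (on_ob \<Phi> Y)"
    and functor_Idt: "X \<in> Ob C \<Longrightarrow> on_hom \<Phi> X X (Idt C X) = Idt D (on_ob \<Phi> X)"
    and functor_Cmp: "\<lbrakk>X \<in> Ob C; Y \<in> Ob C; Z \<in> Ob C; f \<in> Hom C X Y; g \<in> Hom C Y Z\<rbrakk> \<Longrightarrow>
      on_hom \<Phi> X Z (Cmp C X Y Z g f) =
        Cmp D (on_ob \<Phi> X) (on_ob \<Phi> Y) (on_ob \<Phi> Z) (on_hom \<Phi> Y Z g) (on_hom \<Phi> X Y f)"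
  using assms unfolding is_functor_def by blast+

lemma category_full_subcat:
  assumes "category C"
  shows "category (full_subcat C P)"
  by (rule categoryI)
    (simp_all add: full_subcat_def Idt_in_Hom[OF assms] Cmp_in_Hom[OF assms]
      Cmp_Idt_left[OF assms] Cmp_Idt_right[OF assms] Cmp_assoc[OF assms])

lemma category_wide_subcat:
  assumes "category C"
    and "\<And>X. X \<in> Ob C \<Longrightarrow> P X X (Idt C X)"
    and "\<And>X Y Z f g. \<lbrakk>X \<in> Ob C; Y \<in> Ob C; Z \<in> Ob C; f \<in> Hom C X Y; g \<in> Hom C Y Z; P X Y f; P Y Z g\<rbrakk>
      \<Longrightarrow> P X Z (Cmp C X Y Z g f)"
  shows "category (wide_subcat C P)"
  by (rule categoryI)
    (simp_all add: wide_subcat_def assms(2,3) Idt_in_Hom[OF assms(1)] Cmp_in_Hom[OF assms(1)]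
      Cmp_Idt_left[OF assms(1)] Cmp_Idt_right[OF assms(1)] Cmp_assoc[OF assms(1)])

lemma category_functor_cat:
  assumes C: "category C" and D: "category D"
  shows "category (functor_cat C D)"
proof (rule categoryI, goal_cases)
  case (1 \<Phi>)
  then have F: "is_functor C D \<Phi>" by (simp add: functor_cat_def)
  show ?case
    by (auto simp: functor_cat_def nat_trans_def Idt_in_Hom[OF D] functor_on_ob[OF F]
        functor_on_hom[OF F] Cmp_Idt_left[OF D] Cmp_Idt_right[OF D])
next
  case (2 \<Phi> \<Psi> \<Theta> \<eta> \<theta>)
  then have F: "is_functor C D \<Phi>" "is_functor C D \<Psi>" "is_functor C D \<Theta>"
    and n: "nat_trans C D \<Phi> \<Psi> \<eta>" "nat_trans C D \<Psi> \<Theta> \<theta>"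
    by (auto simp: functor_cat_def)
  note ob = functor_on_ob[OF F(1)] functor_on_ob[OF F(2)] functor_on_ob[OF F(3)]
  have m: "\<eta> X \<in> Hom D (on_ob \<Phi> X) (on_ob \<Psi> X)" "\<theta> X \<in> Hom D (on_ob \<Psi> X) (on_ob \<Theta> X)"
    if "X \<in> Ob C" for X
    using n that by (auto simp: nat_trans_def)
  \<comment> \<open>Naturality of the composite: the squares of \<eta> and \<theta> are pasted along
    their common edge \<open>on_hom \<Psi> X Y f\<close>.\<close>
  have "Cmp D (on_ob \<Phi> X) (on_ob \<Phi> Y) (on_ob \<Theta> Y)
      (Cmp D (on_ob \<Phi> Y) (on_ob \<Psi> Y) (on_ob \<Theta> Y) (\<theta> Y) (\<eta> Y)) (on_hom \<Phi> X Y f) =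
    Cmp D (on_ob \<Phi> X) (on_ob \<Theta> X) (on_ob \<Theta> Y) (on_hom \<Theta> X Y f)
      (Cmp D (on_ob \<Phi> X) (on_ob \<Psi> X) (on_ob \<Theta> X) (\<theta> X) (\<eta> X))"
    if X: "X \<in> Ob C" and Y: "Y \<in> Ob C" and f: "f \<in> Hom C X Y" for X Y f
  proof -
    note h = functor_on_hom[OF F(1) X Y f] functor_on_hom[OF F(2) X Y f] functor_on_hom[OF F(3) X Y f]
    have "Cmp D (on_ob \<Phi> X) (on_ob \<Phi> Y) (on_ob \<Theta> Y)
        (Cmp D (on_ob \<Phi> Y) (on_ob \<Psi> Y) (on_ob \<Theta> Y) (\<theta> Y) (\<eta> Y)) (on_hom \<Phi> X Y f) =
      Cmp D (on_ob \<Phi> X) (on_ob \<Psi> Y) (on_ob \<Theta> Y) (\<theta> Y)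
        (Cmp D (on_ob \<Phi> X) (on_ob \<Phi> Y) (on_ob \<Psi> Y) (\<eta> Y) (on_hom \<Phi> X Y f))"
      by (rule Cmp_assoc[OF D]) (use X Y ob h m in auto)
    also have "Cmp D (on_ob \<Phi> X) (on_ob \<Phi> Y) (on_ob \<Psi> Y) (\<eta> Y) (on_hom \<Phi> X Y f) =
        Cmp D (on_ob \<Phi> X) (on_ob \<Psi> X) (on_ob \<Psi> Y) (on_hom \<Psi> X Y f) (\<eta> X)"
      using n(1) X Y f by (auto simp: nat_trans_def)
    also have "Cmp D (on_ob \<Phi> X) (on_ob \<Psi> Y) (on_ob \<Theta> Y) (\<theta> Y) \<dots> =
        Cmp D (on_ob \<Phi> X) (on_ob \<Psi> X) (on_ob \<Theta> Y)
          (Cmp D (on_ob \<Psi> X) (on_ob \<Psi> Y) (on_ob \<Theta> Y) (\<theta> Y) (on_hom \<Psi> X Y f)) (\<eta> X)"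
      by (rule Cmp_assoc[OF D, symmetric]) (use X Y ob h m in auto)
    also have "Cmp D (on_ob \<Psi> X) (on_ob \<Psi> Y) (on_ob \<Theta> Y) (\<theta> Y) (on_hom \<Psi> X Y f) =
        Cmp D (on_ob \<Psi> X) (on_ob \<Theta> X) (on_ob \<Theta> Y) (on_hom \<Theta> X Y f) (\<theta> X)"
      using n(2) X Y f by (auto simp: nat_trans_def)
    also have "Cmp D (on_ob \<Phi> X) (on_ob \<Psi> X) (on_ob \<Theta> Y) \<dots> (\<eta> X) =
        Cmp D (on_ob \<Phi> X) (on_ob \<Theta> X) (on_ob \<Theta> Y) (on_hom \<Theta> X Y f)
          (Cmp D (on_ob \<Phi> X) (on_ob \<Psi> X) (on_ob \<Theta> X) (\<theta> X) (\<eta> X))"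
      by (rule Cmp_assoc[OF D]) (use X Y ob h m in auto)
    finally show ?thesis .
  qed
  moreover have "Cmp D (on_ob \<Phi> X) (on_ob \<Psi> X) (on_ob \<Theta> X) (\<theta> X) (\<eta> X)
      \<in> Hom D (on_ob \<Phi> X) (on_ob \<Theta> X)" if "X \<in> Ob C" for X
    by (rule Cmp_in_Hom[OF D]) (use that ob m in auto)
  ultimately show ?case
    by (auto simp: functor_cat_def nat_trans_def)
next
  case (3 \<Phi> \<Psi> \<eta>)
  then have "is_functor C D \<Phi>" "is_functor C D \<Psi>" "\<eta> \<in> extensional (Ob C)" "nat_trans C D \<Phi> \<Psi> \<eta>"
    by (auto simp: functor_cat_def)
  then show ?case
    by (auto simp: functor_cat_def nat_trans_def fun_eq_iff functor_on_ob Cmp_Idt_right[OF D]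
        extensional_def)
next
  case (4 \<Phi> \<Psi> \<eta>)
  then have "is_functor C D \<Phi>" "is_functor C D \<Psi>" "\<eta> \<in> extensional (Ob C)" "nat_trans C D \<Phi> \<Psi> \<eta>"
    by (auto simp: functor_cat_def)
  then show ?case
    by (auto simp: functor_cat_def nat_trans_def fun_eq_iff functor_on_ob Cmp_Idt_left[OF D]
        extensional_def)
next
  case (5 \<Phi>1 \<Phi>2 \<Phi>3 \<Phi>4 f g h)
  then have F: "is_functor C D \<Phi>1" "is_functor C D \<Phi>2" "is_functor C D \<Phi>3" "is_functor C D \<Phi>4"
    and n: "nat_trans C D \<Phi>1 \<Phi>2 f" "nat_trans C D \<Phi>2 \<Phi>3 g" "nat_trans C D \<Phi>3 \<Phi>4 h"
    by (auto simp: functor_cat_def)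
  show ?case
    by (rule ext) (use F n in \<open>auto simp: functor_cat_def nat_trans_def
      intro!: Cmp_assoc[OF D] functor_on_ob[OF F(1)] functor_on_ob[OF F(2)] functor_on_ob[OF F(3)]
        functor_on_ob[OF F(4)]\<close>)
qed

section \<open>Equivalences from fully faithful, essentially surjective functors\<close>

definition fully_faithful :: "('o, 'm) cat \<Rightarrow> ('p, 'n) cat \<Rightarrow> ('o, 'm, 'p, 'n) func \<Rightarrow> bool" where
  "fully_faithful C D \<Phi> \<longleftrightarrow> (\<forall>X\<in>Ob C. \<forall>Y\<in>Ob C.
    bij_betw (on_hom \<Phi> X Y) (Hom C X Y) (Hom D (on_ob \<Phi> X) (on_ob \<Phi> Y)))"

definition essentially_surjective :: "('o, 'm) cat \<Rightarrow> ('p, 'n) cat \<Rightarrow> ('o, 'm, 'p, 'n) func \<Rightarrow> bool" where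
  "essentially_surjective C D \<Phi> \<longleftrightarrow> (\<forall>Y\<in>Ob D. \<exists>X\<in>Ob C. \<exists>e. is_iso D (on_ob \<Phi> X) Y e)"

lemma is_iso_in_Hom: "is_iso C X Y f \<Longrightarrow> f \<in> Hom C X Y"
  by (simp add: is_iso_def)

definition inverse_of :: "('o, 'm) cat \<Rightarrow> 'o \<Rightarrow> 'o \<Rightarrow> 'm \<Rightarrow> 'm" where
  "inverse_of C X Y f = (SOME g. g \<in> Hom C Y X \<and> Cmp C X Y X g f = Idt C X \<and> Cmp C Y X Y f g = Idt C Y)"

lemma
  assumes "is_iso C X Y f"
  shows inverse_in_Hom: "inverse_of C X Y f \<in> Hom C Y X"
    and inverse_left: "Cmp C X Y X (inverse_of C X Y f) f = Idt C X"
    and inverse_right: "Cmp C Y X Y f (inverse_of C X Y f) = Idt C Y"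
proof -
  have "\<exists>g. g \<in> Hom C Y X \<and> Cmp C X Y X g f = Idt C X \<and> Cmp C Y X Y f g = Idt C Y"
    using assms by (auto simp: is_iso_def)
  from someI_ex[OF this, folded inverse_of_def]
  show "inverse_of C X Y f \<in> Hom C Y X"
    "Cmp C X Y X (inverse_of C X Y f) f = Idt C X" "Cmp C Y X Y f (inverse_of C X Y f) = Idt C Y"
    by auto
qed

lemma is_iso_inverse: "is_iso C X Y f \<Longrightarrow> is_iso C Y X (inverse_of C X Y f)"
  unfolding is_iso_def[of C Y X]
  using inverse_in_Hom inverse_left inverse_right is_iso_in_Hom by fast

text \<open>Serves as the naturality square of a componentwise inverse: insert \<open>e\<close>
  after its inverse on the right, apply \<open>sq\<close>, then cancel \<open>e'\<close> on the
  left.\<close>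

lemma square_inverse:
  assumes C: "category C" and ob: "X \<in> Ob C" "X' \<in> Ob C" "Y \<in> Ob C" "Y' \<in> Ob C"
    and e: "is_iso C X X' e" and e': "is_iso C Y Y' e'" and f: "f \<in> Hom C X Y" "f' \<in> Hom C X' Y'"
    and sq: "Cmp C X Y Y' e' f = Cmp C X X' Y' f' e"
  shows "Cmp C X' Y' Y (inverse_of C Y Y' e') f' = Cmp C X' X Y f (inverse_of C X X' e)"
proof -
  note i = inverse_in_Hom[OF e] inverse_in_Hom[OF e'] is_iso_in_Hom[OF e] is_iso_in_Hom[OF e']
  note [simp] = ob f i Cmp_in_Hom[OF C] Cmp_Idt_left[OF C] Cmp_Idt_right[OF C]
  let ?i = "inverse_of C X X' e" and ?j = "inverse_of C Y Y' e'"
  have "Cmp C X' Y' Y ?j f' = Cmp C X' Y' Y ?j (Cmp C X' X' Y' f' (Cmp C X' X X' e ?i))"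
    by (simp add: inverse_right[OF e])
  also have "\<dots> = Cmp C X' Y' Y ?j (Cmp C X' X Y' (Cmp C X X' Y' f' e) ?i)"
    by (subst Cmp_assoc[OF C]) simp_all
  also have "\<dots> = Cmp C X' Y' Y ?j (Cmp C X' Y Y' e' (Cmp C X' X Y f ?i))"
    by (subst Cmp_assoc[OF C, of X' X Y Y', symmetric]) (simp_all add: sq)
  also have "\<dots> = Cmp C X' Y Y (Cmp C Y Y' Y ?j e') (Cmp C X' X Y f ?i)"
    by (subst Cmp_assoc[OF C]) simp_all
  also have "\<dots> = Cmp C X' X Y f ?i"
    by (simp add: inverse_left[OF e'])
  finally show ?thesis .
qed

lemma nat_iso_inverse:
  assumes D: "category D" and F: "is_functor C D \<Phi>" "is_functor C D \<Psi>" and n: "nat_iso C D \<Phi> \<Psi> \<eta>"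
  shows "nat_iso C D \<Psi> \<Phi> (\<lambda>X. inverse_of D (on_ob \<Phi> X) (on_ob \<Psi> X) (\<eta> X))"
proof -
  have i: "is_iso D (on_ob \<Phi> X) (on_ob \<Psi> X) (\<eta> X)" if "X \<in> Ob C" for X
    using n that by (simp add: nat_iso_def)
  have "Cmp D (on_ob \<Psi> X) (on_ob \<Psi> Y) (on_ob \<Phi> Y)
      (inverse_of D (on_ob \<Phi> Y) (on_ob \<Psi> Y) (\<eta> Y)) (on_hom \<Psi> X Y f) =
    Cmp D (on_ob \<Psi> X) (on_ob \<Phi> X) (on_ob \<Phi> Y) (on_hom \<Phi> X Y f)
      (inverse_of D (on_ob \<Phi> X) (on_ob \<Psi> X) (\<eta> X))"
    if "X \<in> Ob C" "Y \<in> Ob C" "f \<in> Hom C X Y" for X Y f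
    by (rule square_inverse[OF D])
      (use n that i F in \<open>auto simp: nat_iso_def nat_trans_def functor_on_ob functor_on_hom\<close>)
  then show ?thesis
    unfolding nat_iso_def nat_trans_def by (auto simp: inverse_in_Hom[OF i] is_iso_inverse[OF i])
qed

lemma is_functor_id_func: "is_functor C C id_func"
  by (simp add: is_functor_def id_func_def)

lemma is_functor_comp_func:
  "\<lbrakk>is_functor C D \<Phi>; is_functor D E \<Psi>\<rbrakk> \<Longrightarrow> is_functor C E (comp_func \<Psi> \<Phi>)"
  by (rule is_functorI) (simp_all add: comp_func_def functor_on_ob functor_on_hom functor_Idt functor_Cmp)

lemma equivalent_cats_sym:
  assumes "C \<simeq>\<^sub>c\<^sub>a\<^sub>t D" shows "D \<simeq>\<^sub>c\<^sub>a\<^sub>t C"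
proof -
  obtain \<Phi> \<Psi> \<eta> \<epsilon> where cat: "category C" "category D"
    and F: "is_functor C D \<Phi>" "is_functor D C \<Psi>"
    and n: "nat_iso C C id_func (comp_func \<Psi> \<Phi>) \<eta>" "nat_iso D D (comp_func \<Phi> \<Psi>) id_func \<epsilon>"
    using assms unfolding equivalent_cats_def by blast
  note nat_iso_inverse[OF cat(1) is_functor_id_func is_functor_comp_func[OF F] n(1)]
    nat_iso_inverse[OF cat(2) is_functor_comp_func[OF F(2,1)] is_functor_id_func n(2)]
  then show ?thesis
    unfolding equivalent_cats_def using cat F by blast
qed

text \<open>The quasi-inverse sends \<open>Y\<close> to a chosen \<open>S Y\<close> with an
  isomorphism \<open>e Y\<close> onto \<open>Y\<close>, and a morphism to the unique lift of its
  conjugate by these isomorphisms. Identities between lifts hold because they hold after applying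
  \<Phi>, which is faithful, and there they can be tested after composing with \<open>e\<close>,
  which is monic.\<close>

theorem equivalence_if_fully_faithful_essentially_surjective:
  assumes C: "category C" and D: "category D" and F: "is_functor C D \<Phi>"
    and ff: "fully_faithful C D \<Phi>" and es: "essentially_surjective C D \<Phi>"
  shows "C \<simeq>\<^sub>c\<^sub>a\<^sub>t D"
proof -
  obtain S e where Se: "\<And>Y. Y \<in> Ob D \<Longrightarrow> S Y \<in> Ob C \<and> is_iso D (on_ob \<Phi> (S Y)) Y (e Y)"
    using es unfolding essentially_surjective_def by metis
  note S = conjunct1[OF Se] and e = conjunct2[OF Se]
  note eH = is_iso_in_Hom[OF e] inverse_in_Hom[OF e]
  define r where "r Y = inverse_of D (on_ob \<Phi> (S Y)) Y (e Y)" for Y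
  note rH = inverse_in_Hom[OF e, folded r_def]
  note re = inverse_left[OF e, folded r_def] and er = inverse_right[OF e, folded r_def]
  note FS = functor_on_ob[OF F S]
  note FO = functor_on_ob[OF F] and FH = functor_on_hom[OF F]
  have inj: "f = g" if "X \<in> Ob C" "Y \<in> Ob C" "f \<in> Hom C X Y" "g \<in> Hom C X Y"
    "on_hom \<Phi> X Y f = on_hom \<Phi> X Y g" for X Y f g
    using ff that unfolding fully_faithful_def bij_betw_def inj_on_def by blast
  have surj: "\<exists>f\<in>Hom C X Y. on_hom \<Phi> X Y f = g"
    if "X \<in> Ob C" "Y \<in> Ob C" "g \<in> Hom D (on_ob \<Phi> X) (on_ob \<Phi> Y)" for X Y g
  proof -
    have "on_hom \<Phi> X Y ` Hom C X Y = Hom D (on_ob \<Phi> X) (on_ob \<Phi> Y)"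
      using ff that(1,2) by (simp add: fully_faithful_def bij_betw_def)
    then show ?thesis using that(3) by (metis imageE)
  qed
  define L where "L X Y g = (SOME f. f \<in> Hom C X Y \<and> on_hom \<Phi> X Y f = g)" for X Y g
  have L: "L X Y g \<in> Hom C X Y" "on_hom \<Phi> X Y (L X Y g) = g"
    if "X \<in> Ob C" "Y \<in> Ob C" "g \<in> Hom D (on_ob \<Phi> X) (on_ob \<Phi> Y)" for X Y g
    using someI_ex[of "\<lambda>f. f \<in> Hom C X Y \<and> on_hom \<Phi> X Y f = g"] surj[OF that]
    unfolding L_def by auto
  define c where "c Y Z g = Cmp D (on_ob \<Phi> (S Y)) Z (on_ob \<Phi> (S Z)) (r Z)
    (Cmp D (on_ob \<Phi> (S Y)) Y Z g (e Y))" for Y Z g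
  have cH: "c Y Z g \<in> Hom D (on_ob \<Phi> (S Y)) (on_ob \<Phi> (S Z))"
    if "Y \<in> Ob D" "Z \<in> Ob D" "g \<in> Hom D Y Z" for Y Z g
    unfolding c_def using that FS eH rH by (simp add: Cmp_in_Hom[OF D])
  have ec: "Cmp D (on_ob \<Phi> (S Y)) (on_ob \<Phi> (S Z)) Z (e Z) (c Y Z g) =
      Cmp D (on_ob \<Phi> (S Y)) Y Z g (e Y)"
    if "Y \<in> Ob D" "Z \<in> Ob D" "g \<in> Hom D Y Z" for Y Z g
    unfolding c_def
    by (subst Cmp_assoc[OF D, symmetric])
      (use that FS eH rH in \<open>simp_all add: Cmp_in_Hom[OF D] er Cmp_Idt_left[OF D]\<close>)
  have e_cancel: "a = b"
    if Y: "Y \<in> Ob D" and W: "W \<in> Ob D" and a: "a \<in> Hom D W (on_ob \<Phi> (S Y))"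
      and b: "b \<in> Hom D W (on_ob \<Phi> (S Y))"
      and eq: "Cmp D W (on_ob \<Phi> (S Y)) Y (e Y) a = Cmp D W (on_ob \<Phi> (S Y)) Y (e Y) b" for W Y a b
  proof -
    have x: "Cmp D W Y (on_ob \<Phi> (S Y)) (r Y) (Cmp D W (on_ob \<Phi> (S Y)) Y (e Y) x) = x"
      if "x \<in> Hom D W (on_ob \<Phi> (S Y))" for x
      by (subst Cmp_assoc[OF D, symmetric])
        (use that Y W FS eH rH in \<open>simp_all add: re Cmp_Idt_left[OF D]\<close>)
    show ?thesis using x[OF a] x[OF b] eq by metis
  qed
  define \<Psi> where "\<Psi> = \<lparr>on_ob = S, on_hom = (\<lambda>Y Z g. L (S Y) (S Z) (c Y Z g))\<rparr>"
  have \<Psi>: "is_functor D C \<Psi>"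
  proof (rule is_functorI, goal_cases)
    case (1 Y) then show ?case by (simp add: \<Psi>_def S)
  next
    case (2 X Y f) then show ?case by (simp add: \<Psi>_def L(1)[OF S S cH])
  next
    case (3 X)
    have "Idt D X \<in> Hom D X X" using Idt_in_Hom[OF D 3] .
    then have "on_hom \<Phi> (S X) (S X) (L (S X) (S X) (c X X (Idt D X))) = Idt D (on_ob \<Phi> (S X))"
      by (simp add: L(2)[OF S S cH] 3)
        (simp add: c_def 3 FS eH Cmp_Idt_left[OF D] re)
    also have "\<dots> = on_hom \<Phi> (S X) (S X) (Idt C (S X))"
      by (simp add: functor_Idt[OF F S] 3)
    finally have "L (S X) (S X) (c X X (Idt D X)) = Idt C (S X)"
      by (rule inj[rotated 4])
        (simp_all add: S 3 L(1)[OF S S cH] Idt_in_Hom[OF D] Idt_in_Hom[OF C])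
    then show ?case by (simp add: \<Psi>_def)
  next
    case (4 X Y Z f g)
    have gf: "Cmp D X Y Z g f \<in> Hom D X Z" using 4 Cmp_in_Hom[OF D] by simp
    let ?p = "on_ob \<Phi> (S X)" and ?q = "on_ob \<Phi> (S Y)" and ?s = "on_ob \<Phi> (S Z)"
    have "c X Z (Cmp D X Y Z g f) = Cmp D ?p ?q ?s (c Y Z g) (c X Y f)"
    proof (rule e_cancel)
      have "Cmp D ?p ?s Z (e Z) (Cmp D ?p ?q ?s (c Y Z g) (c X Y f)) =
        Cmp D ?p ?q Z (Cmp D ?q ?s Z (e Z) (c Y Z g)) (c X Y f)"
        by (rule Cmp_assoc[OF D, symmetric]) (use 4 FS eH cH in auto)
      also have "\<dots> = Cmp D ?p ?q Z (Cmp D ?q Y Z g (e Y)) (c X Y f)"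
        using 4 by (simp add: ec)
      also have "\<dots> = Cmp D ?p Y Z g (Cmp D ?p ?q Y (e Y) (c X Y f))"
        by (rule Cmp_assoc[OF D]) (use 4 FS eH cH in auto)
      also have "\<dots> = Cmp D ?p Y Z g (Cmp D ?p X Y f (e X))"
        using 4 by (simp add: ec)
      also have "\<dots> = Cmp D ?p X Z (Cmp D X Y Z g f) (e X)"
        by (rule Cmp_assoc[OF D, symmetric]) (use 4 FS eH cH in auto)
      also have "\<dots> = Cmp D ?p ?s Z (e Z) (c X Z (Cmp D X Y Z g f))"
        by (rule ec[symmetric]) (use 4 gf in auto)
      finally show "Cmp D ?p ?s Z (e Z) (c X Z (Cmp D X Y Z g f)) =
        Cmp D ?p ?s Z (e Z) (Cmp D ?p ?q ?s (c Y Z g) (c X Y f))" ..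
    qed (use 4 FS cH gf in \<open>auto simp: Cmp_in_Hom[OF D]\<close>)
    then have "on_hom \<Phi> (S X) (S Z) (L (S X) (S Z) (c X Z (Cmp D X Y Z g f))) =
       on_hom \<Phi> (S X) (S Z) (Cmp C (S X) (S Y) (S Z) (L (S Y) (S Z) (c Y Z g)) (L (S X) (S Y) (c X Y f)))"
      using 4 L(2)[OF S S cH[OF _ _ gf]] by (simp add: L[OF S S cH] functor_Cmp[OF F] S)
    then have "L (S X) (S Z) (c X Z (Cmp D X Y Z g f)) =
       Cmp C (S X) (S Y) (S Z) (L (S Y) (S Z) (c Y Z g)) (L (S X) (S Y) (c X Y f))"
      by (rule inj[rotated 4]) (use 4 gf in \<open>simp_all add: S L(1)[OF S S cH] Cmp_in_Hom[OF C]\<close>)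
    then show ?case by (simp add: \<Psi>_def)
  qed
  have eps: "nat_iso D D (comp_func \<Phi> \<Psi>) id_func e"
    unfolding nat_iso_def nat_trans_def comp_func_def id_func_def \<Psi>_def
    by (auto simp: eH e L(2)[OF S S cH] ec)
  \<comment> \<open>The unit is the lift of \<open>r\<close>, the inverse of the counit
    \<open>e\<close>; its own inverse is the lift of \<open>e\<close>.\<close>
  define \<eta> where "\<eta> X = L X (S (on_ob \<Phi> X)) (r (on_ob \<Phi> X))" for X
  have \<eta>H: "\<eta> X \<in> Hom C X (S (on_ob \<Phi> X))" "on_hom \<Phi> X (S (on_ob \<Phi> X)) (\<eta> X) = r (on_ob \<Phi> X)"
    if "X \<in> Ob C" for X
    unfolding \<eta>_def using that by (auto intro!: L rH FO S)
  have "is_iso C X (S (on_ob \<Phi> X)) (\<eta> X)" if X: "X \<in> Ob C" for X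
  proof -
    let ?Y = "on_ob \<Phi> X" let ?t = "L (S ?Y) X (e ?Y)"
    note Y = FO[OF X]
    have t: "?t \<in> Hom C (S ?Y) X" "on_hom \<Phi> (S ?Y) X ?t = e ?Y"
      by (auto intro!: L S X eH Y)
    have "on_hom \<Phi> X X (Cmp C X (S ?Y) X ?t (\<eta> X)) = on_hom \<Phi> X X (Idt C X)"
      using X Y t by (simp add: functor_Cmp[OF F] S \<eta>H er functor_Idt[OF F])
    then have "Cmp C X (S ?Y) X ?t (\<eta> X) = Idt C X"
      by (rule inj[rotated 4]) (use X Y t in \<open>simp_all add: S \<eta>H Cmp_in_Hom[OF C] Idt_in_Hom[OF C]\<close>)
    moreover have "on_hom \<Phi> (S ?Y) (S ?Y) (Cmp C (S ?Y) X (S ?Y) (\<eta> X) ?t) =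
        on_hom \<Phi> (S ?Y) (S ?Y) (Idt C (S ?Y))"
      using X Y t by (simp add: functor_Cmp[OF F] S \<eta>H re functor_Idt[OF F])
    then have "Cmp C (S ?Y) X (S ?Y) (\<eta> X) ?t = Idt C (S ?Y)"
      by (rule inj[rotated 4]) (use X Y t in \<open>simp_all add: S \<eta>H Cmp_in_Hom[OF C] Idt_in_Hom[OF C]\<close>)
    ultimately show ?thesis
      using t \<eta>H[OF X] by (auto simp: is_iso_def)
  qed
  moreover have "Cmp C X Y (S (on_ob \<Phi> Y)) (\<eta> Y) f =
      Cmp C X (S (on_ob \<Phi> X)) (S (on_ob \<Phi> Y))
        (L (S (on_ob \<Phi> X)) (S (on_ob \<Phi> Y)) (c (on_ob \<Phi> X) (on_ob \<Phi> Y) (on_hom \<Phi> X Y f))) (\<eta> X)"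
    if X: "X \<in> Ob C" and Y: "Y \<in> Ob C" and f: "f \<in> Hom C X Y" for X Y f
  proof -
    let ?X = "on_ob \<Phi> X" and ?Y = "on_ob \<Phi> Y" let ?f = "on_hom \<Phi> X Y f"
    note ob = FO[OF X] FO[OF Y] FS[OF FO[OF X]] FS[OF FO[OF Y]] S[OF FO[OF X]] S[OF FO[OF Y]]
    note h = FH[OF X Y f] cH[OF FO[OF X] FO[OF Y] FH[OF X Y f]] eH[OF FO[OF X]] eH[OF FO[OF Y]]
      rH[OF FO[OF X]] rH[OF FO[OF Y]]
    note l = L[OF S[OF FO[OF X]] S[OF FO[OF Y]] cH[OF FO[OF X] FO[OF Y] FH[OF X Y f]]]
    let ?SX = "on_ob \<Phi> (S ?X)" and ?SY = "on_ob \<Phi> (S ?Y)"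
    have "Cmp D ?X ?Y ?SY (r ?Y) ?f = Cmp D ?X ?SX ?SY (c ?X ?Y ?f) (r ?X)"
    proof (rule e_cancel[OF FO[OF Y]])
      have "Cmp D ?X ?SY ?Y (e ?Y) (Cmp D ?X ?SX ?SY (c ?X ?Y ?f) (r ?X)) =
          Cmp D ?X ?SX ?Y (Cmp D ?SX ?X ?Y ?f (e ?X)) (r ?X)"
        by (subst Cmp_assoc[OF D, symmetric]) (use ob h in \<open>simp_all add: ec\<close>)
      also have "\<dots> = ?f"
        by (subst Cmp_assoc[OF D]) (use ob h in \<open>simp_all add: er Cmp_Idt_right[OF D]\<close>)
      also have "\<dots> = Cmp D ?X ?SY ?Y (e ?Y) (Cmp D ?X ?Y ?SY (r ?Y) ?f)"
        by (subst Cmp_assoc[OF D, symmetric]) (use ob h in \<open>simp_all add: er Cmp_Idt_left[OF D]\<close>)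
      finally show "Cmp D ?X ?SY ?Y (e ?Y) (Cmp D ?X ?Y ?SY (r ?Y) ?f) =
        Cmp D ?X ?SY ?Y (e ?Y) (Cmp D ?X ?SX ?SY (c ?X ?Y ?f) (r ?X))" ..
    qed (use ob h in \<open>simp_all add: Cmp_in_Hom[OF D]\<close>)
    then show ?thesis
      by (intro inj[of X "S ?Y"])
        (use X Y f ob h l in \<open>simp_all add: functor_Cmp[OF F] \<eta>H Cmp_in_Hom[OF C]\<close>)
  qed
  ultimately have "nat_iso C C id_func (comp_func \<Psi> \<Phi>) \<eta>"
    unfolding nat_iso_def nat_trans_def comp_func_def id_func_def \<Psi>_def
    using \<eta>H by auto
  with C D F \<Psi> eps show ?thesis
    unfolding equivalent_cats_def by blast
qed

section \<open>Monoid algebras and their modules\<close>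

lemma abelian_group_cong:
  assumes "abelian_group V" "carrier W = carrier V" "add W = add V" "zero W = zero V"
  shows "abelian_group W"
  using abelian_groupE[OF assms(1)] by (intro abelian_groupI) (simp_all add: assms(2-4))

text \<open>The monomial \<open>c h\<close>. Elements of the monoid algebra are finite sums of
  monomials, and most identities below are proved by reduction to them.\<close>

definition single :: "('k, 'x) ring_scheme \<Rightarrow> 'k \<Rightarrow> 'm \<Rightarrow> 'm \<Rightarrow> 'k" where
  "single K c h = (\<lambda>x. if x = h then c else \<zero>\<^bsub>K\<^esub>)"

lemma of_monoid_eq_single: "of_monoid K h = single K \<one>\<^bsub>K\<^esub> h"
  by (simp add: of_monoid_def single_def)

locale cring_monoid = K?: cring K + M?: monoid M
  for K :: "('k, 'x) ring_scheme" (structure) and M :: "('m, 'y) monoid_scheme" (structure)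
begin

abbreviation KM where "KM \<equiv> monoid_algebra K M"

abbreviation supp :: "('m \<Rightarrow> 'k) \<Rightarrow> 'm set" where "supp a \<equiv> {h. a h \<noteq> \<zero>\<^bsub>K\<^esub>}"

lemma carrier_iff:
  "a \<in> carrier KM \<longleftrightarrow> (\<forall>h. a h \<in> carrier K) \<and> finite (supp a) \<and> supp a \<subseteq> carrier M"
  by (auto simp: monoid_algebra_def)

lemma carrierD:
  assumes "a \<in> carrier KM"
  shows "a h \<in> carrier K" "finite (supp a)" "supp a \<subseteq> carrier M"
  using assms by (auto simp: carrier_iff)

lemma add_apply: "(a \<oplus>\<^bsub>KM\<^esub> b) h = a h \<oplus>\<^bsub>K\<^esub> b h"
  by (simp add: monoid_algebra_def)

lemma zero_eq: "\<zero>\<^bsub>KM\<^esub> = (\<lambda>h. \<zero>\<^bsub>K\<^esub>)"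
  by (simp add: monoid_algebra_def)

lemma one_eq: "\<one>\<^bsub>KM\<^esub> = single K \<one>\<^bsub>K\<^esub> \<one>\<^bsub>M\<^esub>"
  by (simp add: monoid_algebra_def single_def)

lemma supp_single: "supp (single K c h) \<subseteq> {h}"
  by (auto simp: single_def)

lemma single_closed: "c \<in> carrier K \<Longrightarrow> h \<in> carrier M \<Longrightarrow> single K c h \<in> carrier KM"
  unfolding carrier_iff by (auto simp: single_def)

lemma add_closed:
  assumes "a \<in> carrier KM" "b \<in> carrier KM" shows "a \<oplus>\<^bsub>KM\<^esub> b \<in> carrier KM"
proof -
  note a = carrierD[OF assms(1)] and b = carrierD[OF assms(2)]
  have s: "supp (a \<oplus>\<^bsub>KM\<^esub> b) \<subseteq> supp a \<union> supp b" by (auto simp: add_apply)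
  moreover from s have "finite (supp (a \<oplus>\<^bsub>KM\<^esub> b))"
    by (rule finite_subset) (use a b in simp)
  ultimately show ?thesis unfolding carrier_iff using a b by (auto simp: add_apply)
qed

text \<open>The defining sum runs over the supports of the factors, which change under addition.
  Over fixed larger finite sets the extra terms vanish, so distributivity becomes a termwise
  statement.\<close>

lemma mult_superset:
  assumes a: "a \<in> carrier KM" and b: "b \<in> carrier KM"
    and A: "finite A" "supp a \<subseteq> A" and B: "finite B" "supp b \<subseteq> B"
  shows "(a \<otimes>\<^bsub>KM\<^esub> b) h = finsum K (\<lambda>(x, y). a x \<otimes>\<^bsub>K\<^esub> b y) {(x, y) \<in> A \<times> B. x \<otimes>\<^bsub>M\<^esub> y = h}"
proof -
  have "finite {(x, y) \<in> A \<times> B. x \<otimes>\<^bsub>M\<^esub> y = h}"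
    by (rule finite_subset[of _ "A \<times> B"]) (use A B in auto)
  then have "finsum K (\<lambda>(x, y). a x \<otimes>\<^bsub>K\<^esub> b y) {(x, y). a x \<noteq> \<zero>\<^bsub>K\<^esub> \<and> b y \<noteq> \<zero>\<^bsub>K\<^esub> \<and> x \<otimes>\<^bsub>M\<^esub> y = h}
    = finsum K (\<lambda>(x, y). a x \<otimes>\<^bsub>K\<^esub> b y) {(x, y) \<in> A \<times> B. x \<otimes>\<^bsub>M\<^esub> y = h}"
    by (rule K.add.finprod_mono_neutral_cong_left)
      (use A B carrierD(1)[OF a] carrierD(1)[OF b] in auto)
  then show ?thesis by (simp add: monoid_algebra_def)
qed

lemma mult_apply_closed:
  assumes "a \<in> carrier KM" "b \<in> carrier KM"
  shows "(a \<otimes>\<^bsub>KM\<^esub> b) h \<in> carrier K"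
  unfolding mult_superset[OF assms carrierD(2)[OF assms(1)] order_refl carrierD(2)[OF assms(2)] order_refl]
  by (rule K.finsum_closed) (use carrierD(1)[OF assms(1)] carrierD(1)[OF assms(2)] in auto)

lemma mult_closed:
  assumes "a \<in> carrier KM" "b \<in> carrier KM"
  shows "a \<otimes>\<^bsub>KM\<^esub> b \<in> carrier KM"
proof -
  note a = carrierD[OF assms(1)] and b = carrierD[OF assms(2)]
  let ?P = "(\<lambda>(x, y). x \<otimes>\<^bsub>M\<^esub> y) ` (supp a \<times> supp b)"
  have "(a \<otimes>\<^bsub>KM\<^esub> b) h = \<zero>\<^bsub>K\<^esub>" if "h \<notin> ?P" for h
  proof -
    have e: "{(x, y) \<in> supp a \<times> supp b. x \<otimes>\<^bsub>M\<^esub> y = h} = {}" using that by auto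
    show ?thesis unfolding mult_superset[OF assms a(2) order_refl b(2) order_refl] e by simp
  qed
  then have s: "supp (a \<otimes>\<^bsub>KM\<^esub> b) \<subseteq> ?P" by blast
  moreover from s have "finite (supp (a \<otimes>\<^bsub>KM\<^esub> b))"
    by (rule finite_subset) (use a b in simp)
  moreover have "?P \<subseteq> carrier M" using a(3) b(3) by auto
  ultimately show ?thesis unfolding carrier_iff using mult_apply_closed[OF assms] by blast
qed

lemma l_distr:
  assumes "a \<in> carrier KM" "b \<in> carrier KM" "c \<in> carrier KM"
  shows "(a \<oplus>\<^bsub>KM\<^esub> b) \<otimes>\<^bsub>KM\<^esub> c = a \<otimes>\<^bsub>KM\<^esub> c \<oplus>\<^bsub>KM\<^esub> b \<otimes>\<^bsub>KM\<^esub> c"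
proof
  fix h
  note a = carrierD[OF assms(1)] and b = carrierD[OF assms(2)] and c = carrierD[OF assms(3)]
  let ?A = "supp a \<union> supp b"
  have "supp (a \<oplus>\<^bsub>KM\<^esub> b) \<subseteq> ?A" by (auto simp: add_apply)
  then have "((a \<oplus>\<^bsub>KM\<^esub> b) \<otimes>\<^bsub>KM\<^esub> c) h =
    finsum K (\<lambda>(x, y). (a \<oplus>\<^bsub>KM\<^esub> b) x \<otimes>\<^bsub>K\<^esub> c y) {(x, y) \<in> ?A \<times> supp c. x \<otimes>\<^bsub>M\<^esub> y = h}"
    using a b c assms by (intro mult_superset add_closed) auto
  also have "\<dots> = finsum K (\<lambda>p. (\<lambda>(x, y). a x \<otimes>\<^bsub>K\<^esub> c y) p \<oplus>\<^bsub>K\<^esub> (\<lambda>(x, y). b x \<otimes>\<^bsub>K\<^esub> c y) p)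
      {(x, y) \<in> ?A \<times> supp c. x \<otimes>\<^bsub>M\<^esub> y = h}"
    by (rule K.finsum_cong') (use a(1) b(1) c(1) in \<open>auto simp: add_apply K.l_distr\<close>)
  also have "\<dots> = (a \<otimes>\<^bsub>KM\<^esub> c) h \<oplus>\<^bsub>K\<^esub> (b \<otimes>\<^bsub>KM\<^esub> c) h"
    by (subst K.finsum_addf)
      (use a b c assms mult_superset[of a c ?A "supp c" h] mult_superset[of b c ?A "supp c" h] in auto)
  finally show "((a \<oplus>\<^bsub>KM\<^esub> b) \<otimes>\<^bsub>KM\<^esub> c) h = (a \<otimes>\<^bsub>KM\<^esub> c \<oplus>\<^bsub>KM\<^esub> b \<otimes>\<^bsub>KM\<^esub> c) h"
    by (simp add: add_apply)
qed

lemma r_distr: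
  assumes "a \<in> carrier KM" "b \<in> carrier KM" "c \<in> carrier KM"
  shows "c \<otimes>\<^bsub>KM\<^esub> (a \<oplus>\<^bsub>KM\<^esub> b) = c \<otimes>\<^bsub>KM\<^esub> a \<oplus>\<^bsub>KM\<^esub> c \<otimes>\<^bsub>KM\<^esub> b"
proof
  fix h
  note a = carrierD[OF assms(1)] and b = carrierD[OF assms(2)] and c = carrierD[OF assms(3)]
  let ?A = "supp a \<union> supp b"
  have "supp (a \<oplus>\<^bsub>KM\<^esub> b) \<subseteq> ?A" by (auto simp: add_apply)
  then have "(c \<otimes>\<^bsub>KM\<^esub> (a \<oplus>\<^bsub>KM\<^esub> b)) h =
    finsum K (\<lambda>(x, y). c x \<otimes>\<^bsub>K\<^esub> (a \<oplus>\<^bsub>KM\<^esub> b) y) {(x, y) \<in> supp c \<times> ?A. x \<otimes>\<^bsub>M\<^esub> y = h}"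
    using a b c assms by (intro mult_superset add_closed) auto
  also have "\<dots> = finsum K (\<lambda>p. (\<lambda>(x, y). c x \<otimes>\<^bsub>K\<^esub> a y) p \<oplus>\<^bsub>K\<^esub> (\<lambda>(x, y). c x \<otimes>\<^bsub>K\<^esub> b y) p)
      {(x, y) \<in> supp c \<times> ?A. x \<otimes>\<^bsub>M\<^esub> y = h}"
    by (rule K.finsum_cong') (use a(1) b(1) c(1) in \<open>auto simp: add_apply K.r_distr\<close>)
  also have "\<dots> = (c \<otimes>\<^bsub>KM\<^esub> a) h \<oplus>\<^bsub>K\<^esub> (c \<otimes>\<^bsub>KM\<^esub> b) h"
    by (subst K.finsum_addf)
      (use a b c assms mult_superset[of c a "supp c" ?A h] mult_superset[of c b "supp c" ?A h] in auto)
  finally show "(c \<otimes>\<^bsub>KM\<^esub> (a \<oplus>\<^bsub>KM\<^esub> b)) h = (c \<otimes>\<^bsub>KM\<^esub> a \<oplus>\<^bsub>KM\<^esub> c \<otimes>\<^bsub>KM\<^esub> b) h"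
    by (simp add: add_apply)
qed

lemma single_mult:
  assumes "c \<in> carrier K" "d \<in> carrier K" "g \<in> carrier M" "h \<in> carrier M"
  shows "single K c g \<otimes>\<^bsub>KM\<^esub> single K d h = single K (c \<otimes>\<^bsub>K\<^esub> d) (g \<otimes>\<^bsub>M\<^esub> h)"
proof
  fix x
  have "(single K c g \<otimes>\<^bsub>KM\<^esub> single K d h) x =
    finsum K (\<lambda>(x, y). single K c g x \<otimes>\<^bsub>K\<^esub> single K d h y) {(y, z) \<in> {g} \<times> {h}. y \<otimes>\<^bsub>M\<^esub> z = x}"
    by (rule mult_superset) (use assms supp_single in \<open>auto intro: single_closed\<close>)
  also have "{(y, z) \<in> {g} \<times> {h}. y \<otimes>\<^bsub>M\<^esub> z = x} = (if x = g \<otimes>\<^bsub>M\<^esub> h then {(g, h)} else {})"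
    by auto
  also have "finsum K (\<lambda>(x, y). single K c g x \<otimes>\<^bsub>K\<^esub> single K d h y) \<dots> =
      single K (c \<otimes>\<^bsub>K\<^esub> d) (g \<otimes>\<^bsub>M\<^esub> h) x"
    using assms by (simp add: single_def)
  finally show "(single K c g \<otimes>\<^bsub>KM\<^esub> single K d h) x = single K (c \<otimes>\<^bsub>K\<^esub> d) (g \<otimes>\<^bsub>M\<^esub> h) x" .
qed

lemma zero_closed: "\<zero>\<^bsub>KM\<^esub> \<in> carrier KM"
  by (simp add: carrier_iff zero_eq)

lemma mult_zero: "a \<in> carrier KM \<Longrightarrow> a \<otimes>\<^bsub>KM\<^esub> \<zero>\<^bsub>KM\<^esub> = \<zero>\<^bsub>KM\<^esub>"
  by (simp add: monoid_algebra_def)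

lemma zero_mult: "a \<in> carrier KM \<Longrightarrow> \<zero>\<^bsub>KM\<^esub> \<otimes>\<^bsub>KM\<^esub> a = \<zero>\<^bsub>KM\<^esub>"
  by (simp add: monoid_algebra_def)

lemma abelian_group_KM: "abelian_group KM"
proof (rule abelian_groupI)
  fix a assume a: "a \<in> carrier KM"
  let ?b = "\<lambda>h. \<ominus>\<^bsub>K\<^esub> a h"
  have "supp ?b \<subseteq> supp a" by auto
  then have "?b \<in> carrier KM"
    unfolding carrier_iff using carrierD[OF a] finite_subset by auto
  moreover have "?b \<oplus>\<^bsub>KM\<^esub> a = \<zero>\<^bsub>KM\<^esub>"
    by (rule ext) (simp add: add_apply zero_eq carrierD[OF a] K.l_neg)
  ultimately show "\<exists>b\<in>carrier KM. b \<oplus>\<^bsub>KM\<^esub> a = \<zero>\<^bsub>KM\<^esub>" by blast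
qed (auto simp: fun_eq_iff add_apply zero_eq carrierD K.a_ac add_closed zero_closed[unfolded zero_eq])

text \<open>Induction on the support: setting one non-zero coefficient to zero removes one point,
  and the missing monomial is added back.\<close>

lemma KM_induct [consumes 1, case_names zero add_single]:
  assumes "a \<in> carrier KM" and "P \<zero>\<^bsub>KM\<^esub>"
    and step: "\<And>a c h. \<lbrakk>a \<in> carrier KM; c \<in> carrier K; h \<in> carrier M; P a\<rbrakk> \<Longrightarrow> P (a \<oplus>\<^bsub>KM\<^esub> single K c h)"
  shows "P a"
proof -
  have "\<forall>a\<in>carrier KM. supp a = A \<longrightarrow> P a" if "finite A" for A
    using that
  proof (induction A rule: finite_induct)
    case empty
    have "a = \<zero>\<^bsub>KM\<^esub>" if "supp a = {}" for a using that by (auto simp: zero_eq)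
    then show ?case using assms(2) by auto
  next
    case (insert h A)
    show ?case
    proof (intro ballI impI)
      fix a assume a: "a \<in> carrier KM" and s: "supp a = insert h A"
      let ?b = "a(h := \<zero>\<^bsub>K\<^esub>)"
      have b: "supp ?b = A" using s insert.hyps by auto
      moreover have "?b \<in> carrier KM"
        unfolding carrier_iff b using carrierD[OF a] s insert.hyps by auto
      moreover have "a = ?b \<oplus>\<^bsub>KM\<^esub> single K (a h) h"
        by (rule ext) (use carrierD[OF a] in \<open>auto simp: add_apply single_def\<close>)
      moreover have "h \<in> carrier M" using carrierD(3)[OF a] s by auto
      ultimately show "P a" using insert.IH step carrierD(1)[OF a] by metis
    qed
  qed
  then show ?thesis using assms(1) carrierD(2) by blast
qed

text \<open>Both sides are additive in each factor, so nested inductions reduce the claim to three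
  monomials, where it is associativity in \<open>K\<close> and in \<open>M\<close>.\<close>

lemma m_assoc:
  assumes "a \<in> carrier KM" "b \<in> carrier KM" "c \<in> carrier KM"
  shows "(a \<otimes>\<^bsub>KM\<^esub> b) \<otimes>\<^bsub>KM\<^esub> c = a \<otimes>\<^bsub>KM\<^esub> (b \<otimes>\<^bsub>KM\<^esub> c)"
  using assms(1)
proof (induction a rule: KM_induct)
  case zero then show ?case using assms by (simp add: zero_mult mult_closed)
next
  case (add_single a x g)
  note a = add_single
  have "(single K x g \<otimes>\<^bsub>KM\<^esub> b) \<otimes>\<^bsub>KM\<^esub> c = single K x g \<otimes>\<^bsub>KM\<^esub> (b \<otimes>\<^bsub>KM\<^esub> c)"
    using assms(2)
  proof (induction b rule: KM_induct)
    case zero then show ?case using assms(3) a by (simp add: zero_mult mult_zero single_closed)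
  next
    case (add_single b y h)
    note b = add_single
    have "(single K x g \<otimes>\<^bsub>KM\<^esub> single K y h) \<otimes>\<^bsub>KM\<^esub> c = single K x g \<otimes>\<^bsub>KM\<^esub> (single K y h \<otimes>\<^bsub>KM\<^esub> c)"
      using assms(3)
    proof (induction c rule: KM_induct)
      case zero then show ?case using a b by (simp add: mult_zero mult_closed single_closed)
    next
      case (add_single c z f)
      then show ?case using a b
        by (simp add: r_distr mult_closed single_closed add_closed single_mult K.m_assoc M.m_assoc)
    qed
    then show ?case using a b assms(3)
      by (simp add: l_distr r_distr mult_closed single_closed add_closed)
  qed
  then show ?case using a assms by (simp add: l_distr mult_closed single_closed)
qed

lemma ring_KM: "ring KM"
proof (rule ringI[OF abelian_group_KM _ l_distr r_distr])
  have "\<one>\<^bsub>KM\<^esub> \<otimes>\<^bsub>KM\<^esub> a = a \<and> a \<otimes>\<^bsub>KM\<^esub> \<one>\<^bsub>KM\<^esub> = a" if "a \<in> carrier KM" for a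
    using that
    by (induction a rule: KM_induct)
      (simp_all add: mult_zero zero_mult r_distr l_distr one_eq single_closed single_mult)
  then show "Group.monoid KM"
    by (intro monoidI) (auto simp: mult_closed m_assoc one_eq single_closed)
qed

section \<open>Modules over a monoid algebra as \<open>K\<close>-linear representations of the
  monoid\<close>

definition restrict_scalars :: "('m \<Rightarrow> 'k, 'a) module \<Rightarrow> ('k, 'a) module" where
  "restrict_scalars V = \<lparr>carrier = carrier V, mult = mult V, one = one V, zero = zero V, add = add V,
    smult = (\<lambda>c v. single K c \<one>\<^bsub>M\<^esub> \<odot>\<^bsub>V\<^esub> v)\<rparr>"

definition act :: "('m \<Rightarrow> 'k, 'a) module \<Rightarrow> 'm \<Rightarrow> 'a \<Rightarrow> 'a" where
  "act V h v = of_monoid K h \<odot>\<^bsub>V\<^esub> v"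

lemma restrict_scalars_simps [simp]:
  "carrier (restrict_scalars V) = carrier V" "zero (restrict_scalars V) = zero V"
  "add (restrict_scalars V) = add V" "smult (restrict_scalars V) c v = single K c \<one>\<^bsub>M\<^esub> \<odot>\<^bsub>V\<^esub> v"
  by (simp_all add: restrict_scalars_def)

lemma single_add: "single K (c \<oplus>\<^bsub>K\<^esub> d) h = single K c h \<oplus>\<^bsub>KM\<^esub> single K d h" if "c \<in> carrier K" "d \<in> carrier K"
  by (rule ext) (use that in \<open>simp add: add_apply single_def\<close>)

lemma left_module_restrict_scalars:
  assumes "left_module KM V" shows "left_module K (restrict_scalars V)"
proof -
  interpret V: left_module KM V by fact
  have "abelian_group (restrict_scalars V)"
    by (rule abelian_group_cong[OF V.M.abelian_group_axioms]) simp_all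
  then show ?thesis
    by (intro left_module.intro left_module_axioms.intro K.ring_axioms)
      (auto simp: V.smult_closed V.smult_l_distr V.smult_r_distr single_closed single_add
        V.smult_assoc1[symmetric] single_mult V.smult_one[unfolded one_eq])
qed

lemma
  assumes "left_module KM V"
  shows act_closed: "\<lbrakk>h \<in> carrier M; v \<in> carrier V\<rbrakk> \<Longrightarrow> act V h v \<in> carrier V"
    and act_add: "\<lbrakk>h \<in> carrier M; v \<in> carrier V; w \<in> carrier V\<rbrakk> \<Longrightarrow>
      act V h (v \<oplus>\<^bsub>V\<^esub> w) = act V h v \<oplus>\<^bsub>V\<^esub> act V h w"
    and act_smult: "\<lbrakk>h \<in> carrier M; c \<in> carrier K; v \<in> carrier V\<rbrakk> \<Longrightarrow>
      act V h (single K c \<one>\<^bsub>M\<^esub> \<odot>\<^bsub>V\<^esub> v) = single K c \<one>\<^bsub>M\<^esub> \<odot>\<^bsub>V\<^esub> act V h v"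
    and act_one: "v \<in> carrier V \<Longrightarrow> act V \<one>\<^bsub>M\<^esub> v = v"
    and act_mult: "\<lbrakk>g \<in> carrier M; h \<in> carrier M; v \<in> carrier V\<rbrakk> \<Longrightarrow>
      act V (g \<otimes>\<^bsub>M\<^esub> h) v = act V g (act V h v)"
    and single_smult: "\<lbrakk>h \<in> carrier M; c \<in> carrier K; v \<in> carrier V\<rbrakk> \<Longrightarrow>
      single K c h \<odot>\<^bsub>V\<^esub> v = single K c \<one>\<^bsub>M\<^esub> \<odot>\<^bsub>V\<^esub> act V h v"
proof -
  interpret V: left_module KM V by fact
  show "\<lbrakk>h \<in> carrier M; v \<in> carrier V\<rbrakk> \<Longrightarrow> act V h v \<in> carrier V"
    and "\<lbrakk>h \<in> carrier M; v \<in> carrier V; w \<in> carrier V\<rbrakk> \<Longrightarrow>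
      act V h (v \<oplus>\<^bsub>V\<^esub> w) = act V h v \<oplus>\<^bsub>V\<^esub> act V h w"
    and "\<lbrakk>h \<in> carrier M; c \<in> carrier K; v \<in> carrier V\<rbrakk> \<Longrightarrow>
      act V h (single K c \<one>\<^bsub>M\<^esub> \<odot>\<^bsub>V\<^esub> v) = single K c \<one>\<^bsub>M\<^esub> \<odot>\<^bsub>V\<^esub> act V h v"
    and "v \<in> carrier V \<Longrightarrow> act V \<one>\<^bsub>M\<^esub> v = v"
    and "\<lbrakk>g \<in> carrier M; h \<in> carrier M; v \<in> carrier V\<rbrakk> \<Longrightarrow>
      act V (g \<otimes>\<^bsub>M\<^esub> h) v = act V g (act V h v)"
    and "\<lbrakk>h \<in> carrier M; c \<in> carrier K; v \<in> carrier V\<rbrakk> \<Longrightarrow>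
      single K c h \<odot>\<^bsub>V\<^esub> v = single K c \<one>\<^bsub>M\<^esub> \<odot>\<^bsub>V\<^esub> act V h v"
    by (simp_all add: act_def of_monoid_eq_single V.smult_closed V.smult_r_distr single_closed
        V.smult_assoc1[symmetric] single_mult V.smult_one[unfolded one_eq])
qed

text \<open>By \<open>single_smult\<close> a monomial acts as a monoid element followed by a scalar.
  So \<open>K\<close>-linearity and equivariance give linearity for monomials, and induction over
  sums of monomials gives it for the whole algebra.\<close>

lemma module_hom_KM_iff:
  assumes V: "left_module KM V" and W: "left_module KM W"
  shows "f \<in> module_hom KM V W \<longleftrightarrow>
    f \<in> module_hom K (restrict_scalars V) (restrict_scalars W) \<and>
    (\<forall>h\<in>carrier M. \<forall>v\<in>carrier V. f (act V h v) = act W h (f v))"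
proof
  assume f: "f \<in> module_hom KM V W"
  then show "f \<in> module_hom K (restrict_scalars V) (restrict_scalars W) \<and>
    (\<forall>h\<in>carrier M. \<forall>v\<in>carrier V. f (act V h v) = act W h (f v))"
    by (auto simp: module_hom_def act_def of_monoid_eq_single single_closed)
next
  assume f: "f \<in> module_hom K (restrict_scalars V) (restrict_scalars W) \<and>
    (\<forall>h\<in>carrier M. \<forall>v\<in>carrier V. f (act V h v) = act W h (f v))"
  interpret V: left_module KM V by fact
  interpret W: left_module KM W by fact
  have fc: "f v \<in> carrier W" if "v \<in> carrier V" for v using f that by (auto simp: module_hom_def)
  have fa: "f (v \<oplus>\<^bsub>V\<^esub> w) = f v \<oplus>\<^bsub>W\<^esub> f w" if "v \<in> carrier V" "w \<in> carrier V" for v w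
    using f that by (auto simp: module_hom_def)
  have fs: "f (single K c h \<odot>\<^bsub>V\<^esub> v) = single K c h \<odot>\<^bsub>W\<^esub> f v"
    if "c \<in> carrier K" "h \<in> carrier M" "v \<in> carrier V" for c h v
    unfolding single_smult[OF V that(2,1,3)] single_smult[OF W that(2,1) fc[OF that(3)]]
    using f that act_closed[OF V] by (simp add: module_hom_def)
  \<comment> \<open>Zero is itself a monomial, so \<open>fs\<close> also settles the base case of
    the induction.\<close>
  have zero: "\<zero>\<^bsub>KM\<^esub> = single K \<zero>\<^bsub>K\<^esub> \<one>\<^bsub>M\<^esub>" by (simp add: zero_eq single_def fun_eq_iff)
  have "f (a \<odot>\<^bsub>V\<^esub> v) = a \<odot>\<^bsub>W\<^esub> f v" if "a \<in> carrier KM" "v \<in> carrier V" for a v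
    using that(1)
  proof (induction a rule: KM_induct)
    case zero then show ?case using that(2) by (simp add: fs \<open>\<zero>\<^bsub>KM\<^esub> = _\<close>)
  next
    case (add_single a c h)
    then show ?case using that(2)
      by (simp add: V.smult_l_distr W.smult_l_distr single_closed fc fa fs V.smult_closed)
  qed
  then show "f \<in> module_hom KM V W" using fc fa by (auto simp: module_hom_def)
qed

text \<open>The linear extension of an action to the monoid algebra, converse to passing from a
  module to \<open>restrict_scalars\<close> and \<open>act\<close>.\<close>

definition action_module :: "('k, 'a) module \<Rightarrow> ('m \<Rightarrow> 'a \<Rightarrow> 'a) \<Rightarrow> ('m \<Rightarrow> 'k, 'a) module" where
  "action_module V \<rho> = \<lparr>carrier = carrier V, mult = mult V, one = one V, zero = zero V, add = add V,
    smult = (\<lambda>a v. finsum V (\<lambda>h. a h \<odot>\<^bsub>V\<^esub> \<rho> h v) (supp a))\<rparr>"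

lemma action_module_simps [simp]:
  "carrier (action_module V \<rho>) = carrier V" "zero (action_module V \<rho>) = zero V"
  "add (action_module V \<rho>) = add V"
  by (simp_all add: action_module_def)

definition is_action :: "('k, 'a) module \<Rightarrow> ('m \<Rightarrow> 'a \<Rightarrow> 'a) \<Rightarrow> bool" where
  "is_action V \<rho> \<longleftrightarrow>
    (\<forall>h\<in>carrier M. \<rho> h \<in> module_hom K V V) \<and>
    (\<forall>v\<in>carrier V. \<rho> \<one>\<^bsub>M\<^esub> v = v) \<and>
    (\<forall>g\<in>carrier M. \<forall>h\<in>carrier M. \<forall>v\<in>carrier V. \<rho> (g \<otimes>\<^bsub>M\<^esub> h) v = \<rho> g (\<rho> h v))"

lemma
  assumes V: "left_module K V" and \<rho>: "is_action V \<rho>"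
  shows left_module_action_module: "left_module KM (action_module V \<rho>)"
    and action_module_single: "\<lbrakk>c \<in> carrier K; h \<in> carrier M; v \<in> carrier V\<rbrakk> \<Longrightarrow>
      single K c h \<odot>\<^bsub>action_module V \<rho>\<^esub> v = c \<odot>\<^bsub>V\<^esub> \<rho> h v"
proof -
  interpret V: module K V using V left_module_iff_module[OF K.cring_axioms] by blast
  let ?N = "action_module V \<rho>"
  have \<rho>c: "\<rho> h v \<in> carrier V" if "h \<in> carrier M" "v \<in> carrier V" for h v
    using \<rho> that by (auto simp: is_action_def module_hom_def)
  have \<rho>a: "\<rho> h (v \<oplus>\<^bsub>V\<^esub> w) = \<rho> h v \<oplus>\<^bsub>V\<^esub> \<rho> h w" if "h \<in> carrier M" "v \<in> carrier V" "w \<in> carrier V" for h v w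
    using \<rho> that by (auto simp: is_action_def module_hom_def)
  have \<rho>s: "\<rho> h (c \<odot>\<^bsub>V\<^esub> v) = c \<odot>\<^bsub>V\<^esub> \<rho> h v" if "h \<in> carrier M" "c \<in> carrier K" "v \<in> carrier V" for h c v
    using \<rho> that by (auto simp: is_action_def module_hom_def)
  have \<rho>1: "\<rho> \<one>\<^bsub>M\<^esub> v = v" if "v \<in> carrier V" for v using \<rho> that by (auto simp: is_action_def)
  have \<rho>m: "\<rho> (g \<otimes>\<^bsub>M\<^esub> h) v = \<rho> g (\<rho> h v)" if "g \<in> carrier M" "h \<in> carrier M" "v \<in> carrier V" for g h v
    using \<rho> that by (auto simp: is_action_def)
  \<comment> \<open>As for products, the sum may run over any finite superset of the support, which
    makes additivity in \<open>a\<close> a termwise statement.\<close>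
  have sm: "a \<odot>\<^bsub>?N\<^esub> v = finsum V (\<lambda>h. a h \<odot>\<^bsub>V\<^esub> \<rho> h v) A"
    if "a \<in> carrier KM" "v \<in> carrier V" "finite A" "supp a \<subseteq> A" "A \<subseteq> carrier M" for a v A
    unfolding action_module_def
    by simp (rule V.add.finprod_mono_neutral_cong_left,
      use that \<rho>c carrierD(1)[OF that(1)] in auto)
  have smc: "a \<odot>\<^bsub>?N\<^esub> v \<in> carrier V" if "a \<in> carrier KM" "v \<in> carrier V" for a v
    using sm[OF that carrierD(2)[OF that(1)] order_refl carrierD(3)[OF that(1)]] that
      carrierD[OF that(1)] \<rho>c by (auto intro!: V.finsum_closed)
  show single: "single K c h \<odot>\<^bsub>?N\<^esub> v = c \<odot>\<^bsub>V\<^esub> \<rho> h v"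
    if "c \<in> carrier K" "h \<in> carrier M" "v \<in> carrier V" for c h v
    by (subst sm[of _ _ "{h}"]) (use that \<rho>c single_closed[of c h] in \<open>auto simp: single_def\<close>)
  have ld: "(a \<oplus>\<^bsub>KM\<^esub> b) \<odot>\<^bsub>?N\<^esub> v = a \<odot>\<^bsub>?N\<^esub> v \<oplus>\<^bsub>V\<^esub> b \<odot>\<^bsub>?N\<^esub> v"
    if a: "a \<in> carrier KM" and b: "b \<in> carrier KM" and v: "v \<in> carrier V" for a b v
  proof -
    let ?A = "supp a \<union> supp b"
    have A: "finite ?A" "?A \<subseteq> carrier M" using carrierD[OF a] carrierD[OF b] by auto
    have "supp (a \<oplus>\<^bsub>KM\<^esub> b) \<subseteq> ?A" by (auto simp: add_apply)
    then have "(a \<oplus>\<^bsub>KM\<^esub> b) \<odot>\<^bsub>?N\<^esub> v = finsum V (\<lambda>h. (a \<oplus>\<^bsub>KM\<^esub> b) h \<odot>\<^bsub>V\<^esub> \<rho> h v) ?A"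
      by (intro sm add_closed a b v A)
    also have "\<dots> = finsum V (\<lambda>h. a h \<odot>\<^bsub>V\<^esub> \<rho> h v \<oplus>\<^bsub>V\<^esub> b h \<odot>\<^bsub>V\<^esub> \<rho> h v) ?A"
      by (rule V.M.finsum_cong') (use A \<rho>c v carrierD(1)[OF a] carrierD(1)[OF b] in
          \<open>auto simp: add_apply V.smult_l_distr subset_iff\<close>)
    also have "\<dots> = a \<odot>\<^bsub>?N\<^esub> v \<oplus>\<^bsub>V\<^esub> b \<odot>\<^bsub>?N\<^esub> v"
      using A \<rho>c v carrierD(1)[OF a] carrierD(1)[OF b]
      by (subst V.finsum_addf) (auto simp: sm[OF a v A(1) _ A(2)] sm[OF b v A(1) _ A(2)] subset_iff)
    finally show ?thesis .
  qed
  have zero: "\<zero>\<^bsub>KM\<^esub> = single K \<zero>\<^bsub>K\<^esub> \<one>\<^bsub>M\<^esub>" by (simp add: zero_eq single_def fun_eq_iff)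
  have rd: "a \<odot>\<^bsub>?N\<^esub> (v \<oplus>\<^bsub>V\<^esub> w) = a \<odot>\<^bsub>?N\<^esub> v \<oplus>\<^bsub>V\<^esub> a \<odot>\<^bsub>?N\<^esub> w"
    if a: "a \<in> carrier KM" and v: "v \<in> carrier V" "w \<in> carrier V" for a v w
    using a
  proof (induction a rule: KM_induct)
    case zero then show ?case using v by (simp add: \<open>\<zero>\<^bsub>KM\<^esub> = _\<close> single \<rho>c)
  next
    case (add_single a c h)
    then show ?case using v
      by (simp add: ld single_closed single \<rho>c \<rho>a V.smult_r_distr smc V.M.a_ac)
  qed
  have as: "(a \<otimes>\<^bsub>KM\<^esub> b) \<odot>\<^bsub>?N\<^esub> v = a \<odot>\<^bsub>?N\<^esub> (b \<odot>\<^bsub>?N\<^esub> v)"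
    if a: "a \<in> carrier KM" and b: "b \<in> carrier KM" and v: "v \<in> carrier V" for a b v
    using a
  proof (induction a rule: KM_induct)
    case zero
    then show ?case using b v by (simp add: zero_mult) (simp add: \<open>\<zero>\<^bsub>KM\<^esub> = _\<close> single \<rho>c smc)
  next
    case (add_single a c g)
    note a = add_single
    have "(single K c g \<otimes>\<^bsub>KM\<^esub> b) \<odot>\<^bsub>?N\<^esub> v = single K c g \<odot>\<^bsub>?N\<^esub> (b \<odot>\<^bsub>?N\<^esub> v)"
      using b
    proof (induction b rule: KM_induct)
      case zero
      have "c \<odot>\<^bsub>V\<^esub> \<rho> g (\<zero>\<^bsub>K\<^esub> \<odot>\<^bsub>V\<^esub> \<rho> \<one>\<^bsub>M\<^esub> v) = \<zero>\<^bsub>V\<^esub>"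
        by (subst \<rho>s) (use a v \<rho>c in auto)
      then show ?case using a v
        by (simp add: mult_zero single_closed) (simp add: \<open>\<zero>\<^bsub>KM\<^esub> = _\<close> single \<rho>c smc)
    next
      case (add_single b d h)
      then show ?case using a v
        by (simp add: ld rd r_distr mult_closed single_closed single_mult single smc \<rho>c \<rho>s \<rho>m V.smult_assoc1)
    qed
    then show ?case using a b v by (simp add: l_distr ld mult_closed single_closed smc)
  qed
  have "abelian_group ?N"
    by (rule abelian_group_cong[OF V.M.abelian_group_axioms]) simp_all
  then show "left_module KM ?N"
    by (intro left_module.intro left_module_axioms.intro ring_KM)
      (auto simp: smc ld rd as one_eq single \<rho>1)
qed

lemma act_action_module:
  assumes "left_module K V" "is_action V \<rho>" "h \<in> carrier M" "v \<in> carrier V"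
  shows "act (action_module V \<rho>) h v = \<rho> h v"
proof -
  interpret V: module K V using assms(1) left_module_iff_module[OF K.cring_axioms] by blast
  show ?thesis
    using assms(2-4)
    by (simp add: act_def of_monoid_eq_single action_module_single[OF assms(1,2)] is_action_def module_hom_def Pi_iff)
qed

end

section \<open>Categories of modules\<close>

lemma ModCat_simps [simp]:
  "Ob (ModCat R) = {M. left_module R M}" "Hom (ModCat R) = lin_maps R"
  "Idt (ModCat R) M = (\<lambda>x\<in>carrier M. x)" "Cmp (ModCat R) L M N g f = compose (carrier L) g f"
  by (simp_all add: ModCat_def)

lemma full_subcat_simps [simp]:
  "Ob (full_subcat C P) = {X \<in> Ob C. P X}" "Hom (full_subcat C P) = Hom C"
  "Idt (full_subcat C P) = Idt C" "Cmp (full_subcat C P) = Cmp C"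
  by (simp_all add: full_subcat_def)

lemma wide_subcat_simps [simp]:
  "Ob (wide_subcat C P) = Ob C" "Hom (wide_subcat C P) X Y = {f \<in> Hom C X Y. P X Y f}"
  "Idt (wide_subcat C P) = Idt C" "Cmp (wide_subcat C P) = Cmp C"
  by (simp_all add: wide_subcat_def)

lemma functor_cat_simps [simp]:
  "Ob (functor_cat C D) = {\<Phi>. is_functor C D \<Phi>}"
  "Hom (functor_cat C D) \<Phi> \<Psi> = {\<eta> \<in> extensional (Ob C). nat_trans C D \<Phi> \<Psi> \<eta>}"
  "Idt (functor_cat C D) \<Phi> = (\<lambda>X\<in>Ob C. Idt D (on_ob \<Phi> X))"
  "Cmp (functor_cat C D) \<Phi> \<Psi> \<Theta> \<theta> \<eta> =
    (\<lambda>X\<in>Ob C. Cmp D (on_ob \<Phi> X) (on_ob \<Psi> X) (on_ob \<Theta> X) (\<theta> X) (\<eta> X))"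
  by (simp_all add: functor_cat_def)

lemma lin_mapsI:
  assumes "f \<in> extensional (carrier M)" "\<And>x. x \<in> carrier M \<Longrightarrow> f x \<in> carrier N"
    and "\<And>x y. \<lbrakk>x \<in> carrier M; y \<in> carrier M\<rbrakk> \<Longrightarrow> f (x \<oplus>\<^bsub>M\<^esub> y) = f x \<oplus>\<^bsub>N\<^esub> f y"
    and "\<And>c x. \<lbrakk>c \<in> carrier R; x \<in> carrier M\<rbrakk> \<Longrightarrow> f (c \<odot>\<^bsub>M\<^esub> x) = c \<odot>\<^bsub>N\<^esub> f x"
  shows "f \<in> lin_maps R M N"
  using assms by (simp add: lin_maps_def module_hom_def)

lemma
  assumes "f \<in> lin_maps R M N"
  shows lin_maps_extensional: "f \<in> extensional (carrier M)"
    and lin_maps_closed: "x \<in> carrier M \<Longrightarrow> f x \<in> carrier N"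
    and lin_maps_add: "\<lbrakk>x \<in> carrier M; y \<in> carrier M\<rbrakk> \<Longrightarrow> f (x \<oplus>\<^bsub>M\<^esub> y) = f x \<oplus>\<^bsub>N\<^esub> f y"
    and lin_maps_smult: "\<lbrakk>c \<in> carrier R; x \<in> carrier M\<rbrakk> \<Longrightarrow> f (c \<odot>\<^bsub>M\<^esub> x) = c \<odot>\<^bsub>N\<^esub> f x"
  using assms by (auto simp: lin_maps_def module_hom_def)

lemma lin_maps_eqI:
  "\<lbrakk>f \<in> lin_maps R M N; g \<in> lin_maps R M N'; \<And>x. x \<in> carrier M \<Longrightarrow> f x = g x\<rbrakk> \<Longrightarrow> f = g"
  by (rule extensionalityI[of _ "carrier M"]) (auto intro: lin_maps_extensional)

lemma compose_in_lin_maps: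
  assumes L: "left_module R L" and f: "f \<in> lin_maps R L M" and g: "g \<in> lin_maps R M N"
  shows "compose (carrier L) g f \<in> lin_maps R L N"
proof -
  interpret L: left_module R L by fact
  show ?thesis
    using lin_maps_closed[OF f] lin_maps_closed[OF g] lin_maps_add[OF f] lin_maps_add[OF g]
      lin_maps_smult[OF f] lin_maps_smult[OF g]
    by (intro lin_mapsI) (auto simp: compose_eq L.smult_closed)
qed

lemma id_in_lin_maps:
  assumes "left_module R M"
  shows "(\<lambda>x\<in>carrier M. x) \<in> lin_maps R M M"
proof -
  interpret left_module R M by fact
  show ?thesis by (intro lin_mapsI) (auto simp: smult_closed)
qed

lemma category_ModCat: "category (ModCat R)"
proof (rule categoryI, goal_cases)
  case (1 X) then show ?case by (simp add: id_in_lin_maps)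
next
  case (2 X Y Z f g) then show ?case by (simp add: compose_in_lin_maps)
next
  case (3 X Y f)
  then show ?case
    by (intro extensionalityI[of _ "carrier X"])
      (auto simp: compose_def lin_maps_extensional)
next
  case (4 X Y f)
  then show ?case
    by (intro extensionalityI[of _ "carrier X"])
      (auto simp: compose_def lin_maps_extensional lin_maps_closed)
next
  case (5 W X Y Z f g h)
  then show ?case
    by (intro extensionalityI[of _ "carrier W"]) (auto simp: compose_def lin_maps_closed)
qed

lemma inverse_in_lin_maps:
  assumes M: "left_module R M" and N: "left_module R N" and f: "f \<in> lin_maps R M N"
    and b: "bij_betw f (carrier M) (carrier N)"
  shows "(\<lambda>y\<in>carrier N. inv_into (carrier M) f y) \<in> lin_maps R N M"
proof -
  interpret M: left_module R M by fact
  interpret N: left_module R N by fact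
  let ?g = "inv_into (carrier M) f"
  have g: "?g y \<in> carrier M" "f (?g y) = y" if "y \<in> carrier N" for y
    using b that bij_betw_inv_into_right bij_betwE[OF bij_betw_inv_into[OF b]] by fastforce+
  have gf: "?g (f x) = x" if "x \<in> carrier M" for x using b that by (simp add: bij_betw_inv_into_left)
  show ?thesis
  proof (rule lin_mapsI)
    fix x y assume xy: "x \<in> carrier N" "y \<in> carrier N"
    then have "f (?g x \<oplus>\<^bsub>M\<^esub> ?g y) = x \<oplus>\<^bsub>N\<^esub> y" using g by (simp add: lin_maps_add[OF f])
    then show "(\<lambda>y\<in>carrier N. ?g y) (x \<oplus>\<^bsub>N\<^esub> y) = (\<lambda>y\<in>carrier N. ?g y) x \<oplus>\<^bsub>M\<^esub> (\<lambda>y\<in>carrier N. ?g y) y"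
      using xy g gf[of "?g x \<oplus>\<^bsub>M\<^esub> ?g y"] by simp
  next
    fix c x assume cx: "c \<in> carrier R" "x \<in> carrier N"
    then have "f (c \<odot>\<^bsub>M\<^esub> ?g x) = c \<odot>\<^bsub>N\<^esub> x" using g by (simp add: lin_maps_smult[OF f])
    then show "(\<lambda>y\<in>carrier N. ?g y) (c \<odot>\<^bsub>N\<^esub> x) = c \<odot>\<^bsub>M\<^esub> (\<lambda>y\<in>carrier N. ?g y) x"
      using cx g gf[of "c \<odot>\<^bsub>M\<^esub> ?g x"] by (simp add: M.smult_closed N.smult_closed)
  qed (use g in auto)
qed

lemma is_iso_ModCatI:
  assumes M: "left_module R M" and N: "left_module R N" and f: "f \<in> lin_maps R M N"
    and b: "bij_betw f (carrier M) (carrier N)"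
  shows "is_iso (ModCat R) M N f"
  unfolding is_iso_def
proof (intro conjI bexI[of _ "\<lambda>y\<in>carrier N. inv_into (carrier M) f y"])
  show "Cmp (ModCat R) M N M (\<lambda>y\<in>carrier N. inv_into (carrier M) f y) f = Idt (ModCat R) M"
    using b by (auto simp: fun_eq_iff compose_def bij_betw_inv_into_left lin_maps_closed[OF f])
  show "Cmp (ModCat R) N M N f (\<lambda>y\<in>carrier N. inv_into (carrier M) f y) = Idt (ModCat R) N"
    using b by (auto simp: fun_eq_iff compose_def bij_betw_inv_into_right)
qed (use f inverse_in_lin_maps[OF assms] in auto)

lemma is_iso_full_subcat [simp]: "is_iso (full_subcat C P) X Y f \<longleftrightarrow> is_iso C X Y f"
  by (simp add: is_iso_def)

lemma abelian_group_zero_unique: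
  assumes "abelian_group V" "x \<in> carrier V" "x \<oplus>\<^bsub>V\<^esub> x = x" shows "x = \<zero>\<^bsub>V\<^esub>"
proof -
  interpret abelian_group V by fact
  show ?thesis using assms(2,3) by (metis add.l_cancel_one)
qed


section \<open>Uniformly continuous modules and dense submonoids\<close>

definition self_map_monoid :: "'s set \<Rightarrow> ('s \<Rightarrow> 's) set \<Rightarrow> bool" where
  "self_map_monoid S H \<longleftrightarrow> H \<subseteq> (S \<rightarrow>\<^sub>E S) \<and> (\<lambda>x\<in>S. x) \<in> H \<and> (\<forall>g\<in>H. \<forall>h\<in>H. compose S g h \<in> H)"

lemma map_monoid_simps [simp]:
  "carrier (map_monoid S H) = H" "x \<otimes>\<^bsub>map_monoid S H\<^esub> y = compose S x y"
  "\<one>\<^bsub>map_monoid S H\<^esub> = (\<lambda>x\<in>S. x)"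
  by (simp_all add: map_monoid_def)

lemma monoid_map_monoid:
  assumes "self_map_monoid S H" shows "Group.monoid (map_monoid S H)"
proof (rule monoidI)
  fix f g h assume "f \<in> carrier (map_monoid S H)" "g \<in> carrier (map_monoid S H)" "h \<in> carrier (map_monoid S H)"
  then show "f \<otimes>\<^bsub>map_monoid S H\<^esub> g \<otimes>\<^bsub>map_monoid S H\<^esub> h = f \<otimes>\<^bsub>map_monoid S H\<^esub> (g \<otimes>\<^bsub>map_monoid S H\<^esub> h)"
    using assms by (auto simp: self_map_monoid_def compose_def fun_eq_iff)
next
  fix f assume "f \<in> carrier (map_monoid S H)"
  then have "f \<in> S \<rightarrow>\<^sub>E S" using assms by (auto simp: self_map_monoid_def)
  then show "\<one>\<^bsub>map_monoid S H\<^esub> \<otimes>\<^bsub>map_monoid S H\<^esub> f = f" "f \<otimes>\<^bsub>map_monoid S H\<^esub> \<one>\<^bsub>map_monoid S H\<^esub> = f"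
    by (auto simp: compose_def fun_eq_iff PiE_def extensional_def)
qed (use assms in \<open>auto simp: self_map_monoid_def\<close>)

locale uc_setting = cring K for K :: "('k, 'x) ring_scheme" (structure) +
  fixes S :: "'s set" and H :: "('s \<Rightarrow> 's) set"
  assumes self_map_monoid: "self_map_monoid S H"
begin

sublocale A: cring_monoid K "map_monoid S H"
  by (intro cring_monoid.intro monoid_map_monoid[OF self_map_monoid]) unfold_locales

lemma H_closed: "h \<in> H \<Longrightarrow> x \<in> S \<Longrightarrow> h x \<in> S"
  and compose_closed: "g \<in> H \<Longrightarrow> h \<in> H \<Longrightarrow> compose S g h \<in> H"
  and id_closed: "(\<lambda>x\<in>S. x) \<in> H"
  using self_map_monoid by (auto simp: self_map_monoid_def)

lemma UCMod_simps [simp]: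
  "Ob (UCMod K S H) = {V. left_module A.KM V \<and> uniformly_continuous K S H V}"
  "Hom (UCMod K S H) = lin_maps A.KM"
  "Idt (UCMod K S H) V = (\<lambda>x\<in>carrier V. x)"
  "Cmp (UCMod K S H) U V W g f = compose (carrier U) g f"
  by (simp_all add: UCMod_def)

lemma category_UCMod: "category (UCMod K S H)"
  unfolding UCMod_def by (intro category_full_subcat category_ModCat)

lemma lin_maps_KM_iff:
  assumes "left_module A.KM V" "left_module A.KM W"
  shows "f \<in> lin_maps A.KM V W \<longleftrightarrow> f \<in> lin_maps K (A.restrict_scalars V) (A.restrict_scalars W) \<and>
    (\<forall>h\<in>H. \<forall>v\<in>carrier V. f (A.act V h v) = A.act W h (f v))"
  using A.module_hom_KM_iff[OF assms] by (auto simp: lin_maps_def)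

lemma uniformly_continuous_iff:
  "uniformly_continuous K S H V \<longleftrightarrow>
    (\<forall>v\<in>carrier V. \<exists>B. finite B \<and> B \<subseteq> S \<and>
      (\<forall>h\<in>H. \<forall>h'\<in>H. (\<forall>x\<in>B. h x = h' x) \<longrightarrow> A.act V h v = A.act V h' v))"
  by (simp add: uniformly_continuous_def A.act_def)

lemma uniformly_continuousE:
  assumes "uniformly_continuous K S H V" "v \<in> carrier V"
  obtains B where "finite B" "B \<subseteq> S"
    "\<forall>h\<in>H. \<forall>h'\<in>H. (\<forall>x\<in>B. h x = h' x) \<longrightarrow> A.act V h v = A.act V h' v"
proof -
  have "\<exists>B. finite B \<and> B \<subseteq> S \<and>
      (\<forall>h\<in>H. \<forall>h'\<in>H. (\<forall>x\<in>B. h x = h' x) \<longrightarrow> A.act V h v = A.act V h' v)"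
    using assms unfolding uniformly_continuous_iff by (rule bspec)
  then show thesis by (elim exE conjE) (rule that)
qed

lemma act_compose:
  "\<lbrakk>left_module A.KM V; g \<in> H; h \<in> H; v \<in> carrier V\<rbrakk> \<Longrightarrow> A.act V (compose S g h) v = A.act V g (A.act V h v)"
  using A.act_mult[of V g h v] by simp

lemma act_id: "\<lbrakk>left_module A.KM V; v \<in> carrier V\<rbrakk> \<Longrightarrow> A.act V (\<lambda>x\<in>S. x) v = v"
  using A.act_one[of V v] by simp

end

text \<open>Both algebras consist of functions on the whole type of self-maps, with literally the
  same operations; only the admissible supports differ. So the very same record is a module over the
  smaller algebra.\<close>

lemma left_module_smaller_monoid:
  assumes H: "uc_setting K S H" and H': "uc_setting K S H'" and sub: "H \<subseteq> H'"
    and V: "left_module (monoid_algebra K (map_monoid S H')) V"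
  shows "left_module (monoid_algebra K (map_monoid S H)) V"
proof -
  interpret H: uc_setting K S H by fact
  interpret H': uc_setting K S H' by fact
  interpret V: left_module H'.A.KM V by fact
  have c: "a \<in> carrier H'.A.KM" if "a \<in> carrier H.A.KM" for a
    using that sub unfolding H.A.carrier_iff H'.A.carrier_iff by auto
  have eq: "add H.A.KM = add H'.A.KM" "mult H.A.KM = mult H'.A.KM" "one H.A.KM = one H'.A.KM"
    by (simp_all add: monoid_algebra_def map_monoid_def)
  show ?thesis
    by (intro left_module.intro left_module_axioms.intro H.A.ring_KM V.M.abelian_group_axioms)
      (auto simp: c eq V.smult_closed V.smult_l_distr V.smult_r_distr V.smult_assoc1 V.smult_one)
qed

text \<open>The forgetful functor is \<open>id_func\<close>, since a module over the larger algebra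
  is already one over the smaller. Fullness and essential surjectivity both rest on replacing an
  element of \<open>H'\<close> by an element of \<open>H\<close> that agrees with it on the finitely
  many points that matter for the vectors in question.\<close>

theorem UCMod_dense_submonoid:
  fixes K :: "('k, 'x) ring_scheme" and S :: "'s set"
  assumes H: "uc_setting K S H" and H': "uc_setting K S H'" and sub: "H \<subseteq> H'"
    and dense: "\<And>h' B. \<lbrakk>h' \<in> H'; finite B; B \<subseteq> S\<rbrakk> \<Longrightarrow> \<exists>h\<in>H. \<forall>x\<in>B. h x = h' x"
  shows "(UCMod K S H' :: (('s \<Rightarrow> 's) \<Rightarrow> 'k, 'a) mod_category) \<simeq>\<^sub>c\<^sub>a\<^sub>t
    (UCMod K S H :: (('s \<Rightarrow> 's) \<Rightarrow> 'k, 'a) mod_category)"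
proof -
  interpret H: uc_setting K S H by fact
  interpret H': uc_setting K S H' by fact
  have rs: "H'.A.restrict_scalars V = H.A.restrict_scalars V" for V
    by (simp add: H.A.restrict_scalars_def H'.A.restrict_scalars_def)
  have ob: "V \<in> Ob (UCMod K S H)" if "V \<in> Ob (UCMod K S H')" for V :: "(('s \<Rightarrow> 's) \<Rightarrow> 'k, 'a) module"
  proof -
    have "uniformly_continuous K S H V"
      using that sub by (auto simp: uniformly_continuous_def subset_iff) meson
    then show ?thesis using that left_module_smaller_monoid[OF H H' sub, of V] by simp
  qed
  have hom: "lin_maps H'.A.KM V W = lin_maps H.A.KM V W"
    if V: "V \<in> Ob (UCMod K S H')" and W: "W \<in> Ob (UCMod K S H')" for V W :: "(('s \<Rightarrow> 's) \<Rightarrow> 'k, 'a) module"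
  proof -
    have V': "left_module H'.A.KM V" "left_module H.A.KM V" and W': "left_module H'.A.KM W" "left_module H.A.KM W"
      using V W ob[OF V] ob[OF W] by simp_all
    have "f (H.A.act V h' v) = H.A.act W h' (f v)"
      if f: "f \<in> lin_maps H.A.KM V W" and h': "h' \<in> H'" and v: "v \<in> carrier V" for f h' v
    proof -
      have fv: "f v \<in> carrier W" using lin_maps_closed[OF f v] .
      have uc: "uniformly_continuous K S H' V" "uniformly_continuous K S H' W"
        using V W by simp_all
      obtain B where B: "finite B" "B \<subseteq> S"
        "\<forall>g\<in>H'. \<forall>h\<in>H'. (\<forall>x\<in>B. g x = h x) \<longrightarrow> H.A.act V g v = H.A.act V h v"
        by (rule H'.uniformly_continuousE[OF uc(1) v])
      obtain C where C: "finite C" "C \<subseteq> S"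
        "\<forall>g\<in>H'. \<forall>h\<in>H'. (\<forall>x\<in>C. g x = h x) \<longrightarrow> H.A.act W g (f v) = H.A.act W h (f v)"
        by (rule H'.uniformly_continuousE[OF uc(2) fv])
      \<comment> \<open>Agreement on both finite sets lets \<open>h\<close> stand in for
        \<open>h'\<close> on \<open>v\<close> in \<open>V\<close> and on \<open>f v\<close> in
        \<open>W\<close> at once.\<close>
      obtain h where h: "h \<in> H" "\<forall>x\<in>B \<union> C. h x = h' x"
        using dense[OF h', of "B \<union> C"] B C by auto
      then have "H.A.act V h' v = H.A.act V h v" "H.A.act W h' (f v) = H.A.act W h (f v)"
        using B(3)[rule_format, of h' h] C(3)[rule_format, of h' h] h' sub by auto
      moreover have "f (H.A.act V h v) = H.A.act W h (f v)"
        using f h(1) v unfolding H.lin_maps_KM_iff[OF V'(2) W'(2)] by simp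
      ultimately show ?thesis by simp
    qed
    then show ?thesis
      unfolding set_eq_iff H'.lin_maps_KM_iff[OF V'(1) W'(1)] rs
      using sub H.lin_maps_KM_iff[OF V'(2) W'(2)] by blast
  qed
  have F: "is_functor (UCMod K S H') (UCMod K S H) (id_func :: ((('s \<Rightarrow> 's) \<Rightarrow> 'k, 'a) module, 'a \<Rightarrow> 'a, _, _) func)"
    by (rule is_functorI) (use ob hom in \<open>simp_all add: id_func_def\<close>)
  moreover have "fully_faithful (UCMod K S H') (UCMod K S H) (id_func :: ((('s \<Rightarrow> 's) \<Rightarrow> 'k, 'a) module, 'a \<Rightarrow> 'a, _, _) func)"
    using hom by (auto simp: fully_faithful_def id_func_def bij_betw_def)
  moreover have "essentially_surjective (UCMod K S H') (UCMod K S H) (id_func :: ((('s \<Rightarrow> 's) \<Rightarrow> 'k, 'a) module, 'a \<Rightarrow> 'a, _, _) func)"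
    unfolding essentially_surjective_def
  proof
    fix V :: "(('s \<Rightarrow> 's) \<Rightarrow> 'k, 'a) module"
    assume "V \<in> Ob (UCMod K S H)"
    then have V: "left_module H.A.KM V" and uc: "uniformly_continuous K S H V" by simp_all
    interpret V: left_module H.A.KM V by fact
    \<comment> \<open>A finite set \<open>B v\<close> is fixed for every vector \<open>v\<close>, so
      that the extended action can be written as a function.\<close>
    have "\<forall>v. \<exists>B. v \<in> carrier V \<longrightarrow> finite B \<and> B \<subseteq> S \<and>
        (\<forall>g\<in>H. \<forall>h\<in>H. (\<forall>x\<in>B. g x = h x) \<longrightarrow> H.A.act V g v = H.A.act V h v)"
      using uc unfolding H.uniformly_continuous_iff by simp
    from choice[OF this] obtain B where B0: "\<forall>v. v \<in> carrier V \<longrightarrow> finite (B v) \<and> B v \<subseteq> S \<and>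
        (\<forall>g\<in>H. \<forall>h\<in>H. (\<forall>x\<in>B v. g x = h x) \<longrightarrow> H.A.act V g v = H.A.act V h v)" ..
    have B: "finite (B v) \<and> B v \<subseteq> S" if "v \<in> carrier V" for v
      using B0[rule_format, OF that] by (elim conjE) (intro conjI)
    have B2: "H.A.act V g v = H.A.act V h v"
      if "v \<in> carrier V" "g \<in> H" "h \<in> H" "\<forall>x\<in>B v. g x = h x" for v g h
      by (rule mp[OF spec[OF B0] that(1), THEN conjunct2, THEN conjunct2, rule_format, OF that(2,3)])
        (rule bspec[OF that(4)])
    \<comment> \<open>\<open>h'\<close> acts on \<open>v\<close> like any element of
      \<open>H\<close> that agrees with it on \<open>B v\<close>; by \<open>B2\<close> all of them
      act alike.\<close>
    define \<rho> where "\<rho> h' v = H.A.act V (SOME h. h \<in> H \<and> (\<forall>x\<in>B v. h x = h' x)) v" for h' v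
    have \<rho>: "\<rho> h' v = H.A.act V h v" if "v \<in> carrier V" "h \<in> H" "\<forall>x\<in>B v. h x = h' x" for h' h v
      using someI[of "\<lambda>h. h \<in> H \<and> (\<forall>x\<in>B v. h x = h' x)" h] that unfolding \<rho>_def
      by (intro B2) auto
    note acts = H.A.act_closed[OF V] H.A.act_add[OF V] H.A.act_smult[OF V]
    \<comment> \<open>One \<open>h\<close> approximates \<open>h'\<close> for finitely many vectors
      simultaneously. Each linearity axiom involves finitely many vectors, so it is inherited from
      the action of \<open>H\<close>.\<close>
    have appr: "\<exists>h\<in>H. \<forall>v\<in>X. \<rho> h' v = H.A.act V h v"
      if h': "h' \<in> H'" and X: "finite X" "X \<subseteq> carrier V" for h' X
    proof -
      obtain h where "h \<in> H" "\<forall>x\<in>(\<Union>v\<in>X. B v). h x = h' x"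
        using dense[OF h', of "\<Union>v\<in>X. B v"] B X by blast
      then show ?thesis using X(2) \<rho> by (intro bexI[of _ h]) auto
    qed
    have \<rho>c: "\<rho> h' v \<in> carrier V" if "h' \<in> H'" "v \<in> carrier V" for h' v
      using appr[of h' "{v}"] that acts by auto
    have "\<rho> h' \<in> module_hom K (H.A.restrict_scalars V) (H.A.restrict_scalars V)" if h': "h' \<in> H'" for h'
    proof -
      have "\<rho> h' (v \<oplus>\<^bsub>V\<^esub> w) = \<rho> h' v \<oplus>\<^bsub>V\<^esub> \<rho> h' w" if "v \<in> carrier V" "w \<in> carrier V" for v w
        using appr[OF h', of "{v, w, v \<oplus>\<^bsub>V\<^esub> w}"] that acts by auto
      moreover have "\<rho> h' (c \<odot>\<^bsub>H.A.restrict_scalars V\<^esub> v) = c \<odot>\<^bsub>H.A.restrict_scalars V\<^esub> \<rho> h' v"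
        if "c \<in> carrier K" "v \<in> carrier V" for c v
        using appr[OF h', of "{v, c \<odot>\<^bsub>H.A.restrict_scalars V\<^esub> v}"] that acts H.A.single_closed[of c]
          V.smult_closed H.id_closed by auto
      ultimately show ?thesis using \<rho>c[OF h'] by (auto simp: module_hom_def)
    qed
    moreover have "\<rho> (\<lambda>x\<in>S. x) v = v" if v: "v \<in> carrier V" for v
      using \<rho>[OF v H.id_closed, of "\<lambda>x\<in>S. x"] H.act_id[OF V v] by simp
    moreover have "\<rho> (compose S g' h') v = \<rho> g' (\<rho> h' v)"
      if g': "g' \<in> H'" and h': "h' \<in> H'" and v: "v \<in> carrier V" for g' h' v
    proof -
      obtain h where h: "h \<in> H" "\<forall>x\<in>B v. h x = h' x"
        using dense[OF h'] B[OF v] by blast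
      have hv: "H.A.act V h v \<in> carrier V" using acts(1) h v by simp
      \<comment> \<open>Agreement on the image of \<open>B v\<close> makes
        \<open>compose S g h\<close> approximate the composite on \<open>B v\<close>; agreement on
        the finite set of the vector moved by \<open>h\<close> makes \<open>g\<close> compute \<rho>
        there.\<close>
      obtain g where g: "g \<in> H" "\<forall>x\<in>h ` B v \<union> B (H.A.act V h v). g x = g' x"
        using dense[OF g', of "h ` B v \<union> B (H.A.act V h v)"] B[OF v] B[OF hv] H.H_closed[OF h(1)] by auto
      have "\<rho> (compose S g' h') v = H.A.act V (compose S g h) v"
        using g h B[OF v] by (intro \<rho> v H.compose_closed) (auto simp: compose_eq)
      also have "\<dots> = H.A.act V g (H.A.act V h v)" by (intro H.act_compose V g h v)
      also have "\<dots> = \<rho> g' (H.A.act V h v)" using \<rho>[OF hv g(1), of g'] g by simp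
      also have "H.A.act V h v = \<rho> h' v" using \<rho>[OF v h(1)] h by simp
      finally show ?thesis .
    qed
    ultimately have act\<rho>: "H'.A.is_action (H.A.restrict_scalars V) \<rho>"
      unfolding H'.A.is_action_def by simp
    let ?R = "H.A.restrict_scalars V"
    let ?N = "H'.A.action_module ?R \<rho>"
    have R: "left_module K ?R" by (rule H.A.left_module_restrict_scalars[OF V])
    have N': "left_module H'.A.KM ?N" by (rule H'.A.left_module_action_module[OF R act\<rho>])
    have aN: "H.A.act ?N h v = \<rho> h v" if "h \<in> H'" "v \<in> carrier V" for h v
      using H'.A.act_action_module[OF R act\<rho>, of h v] that by simp
    have "uniformly_continuous K S H' ?N"
      unfolding H'.uniformly_continuous_iff
    proof
      fix v assume "v \<in> carrier ?N"
      then have v: "v \<in> carrier V" by simp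
      \<comment> \<open>Agreement on \<open>B v\<close> makes the predicates under the choice in
        \<open>\<rho>_def\<close> equivalent, so the chosen elements of \<open>H\<close> are
        equal.\<close>
      have "H'.A.act ?N g v = H'.A.act ?N h v" if "g \<in> H'" "h \<in> H'" "\<forall>x\<in>B v. g x = h x" for g h
        unfolding aN[OF that(1) v] aN[OF that(2) v] using that(3) by (simp add: \<rho>_def)
      then show "\<exists>B. finite B \<and> B \<subseteq> S \<and>
          (\<forall>h\<in>H'. \<forall>h'\<in>H'. (\<forall>x\<in>B. h x = h' x) \<longrightarrow> H'.A.act ?N h v = H'.A.act ?N h' v)"
        by (intro exI[of _ "B v"] conjI ballI impI conjunct1[OF B[OF v]] conjunct2[OF B[OF v]])
    qed
    with N' have N: "?N \<in> Ob (UCMod K S H')" by simp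
    then have N'': "left_module H.A.KM ?N" using ob by simp
    \<comment> \<open>\<open>?N\<close> has the carrier of \<open>V\<close> but a newly built
      \<open>smult\<close>, so \<open>V\<close> is recovered only up to isomorphism, through the
      identity map.\<close>
    have "(\<lambda>x\<in>carrier ?N. x) \<in> lin_maps H.A.KM ?N V"
      unfolding H.lin_maps_KM_iff[OF N'' V]
    proof (intro conjI ballI lin_mapsI)
      fix h v assume h: "h \<in> H" and "v \<in> carrier ?N"
      then have v: "v \<in> carrier V" by simp
      have "H.A.act ?N h v = H.A.act V h v"
        using aN[of h v] \<rho>[OF v h, of h] h v sub by auto
      then show "(\<lambda>x\<in>carrier ?N. x) (H.A.act ?N h v) = H.A.act V h ((\<lambda>x\<in>carrier ?N. x) v)"
        using v acts(1)[OF _ v] h by simp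
    next
      fix c v assume c: "c \<in> carrier K" and "v \<in> carrier (H.A.restrict_scalars ?N)"
      then have v: "v \<in> carrier V" by simp
      have "single K c (\<lambda>x\<in>S. x) \<odot>\<^bsub>?N\<^esub> v = c \<odot>\<^bsub>?R\<^esub> \<rho> (\<lambda>x\<in>S. x) v"
        using H'.A.action_module_single[OF R act\<rho> c _ , of "\<lambda>x\<in>S. x" v] H'.id_closed v by simp
      then show "(\<lambda>x\<in>carrier ?N. x) (c \<odot>\<^bsub>H.A.restrict_scalars ?N\<^esub> v) =
          c \<odot>\<^bsub>H.A.restrict_scalars V\<^esub> ((\<lambda>x\<in>carrier ?N. x) v)"
        using v \<rho>[OF v H.id_closed, of "\<lambda>x\<in>S. x"] H.act_id[OF V v] V.smult_closed
          H.A.single_closed[OF c, of "\<lambda>x\<in>S. x"] H.id_closed by simp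
    qed auto
    then have "is_iso (UCMod K S H) ?N V (\<lambda>x\<in>carrier ?N. x)"
      unfolding UCMod_def is_iso_full_subcat
      by (intro is_iso_ModCatI N'' V) (auto simp: bij_betw_def)
    with N show "\<exists>X\<in>Ob (UCMod K S H'). \<exists>e. is_iso (UCMod K S H) (on_ob id_func X) V e"
      by (auto simp: id_func_def)
  qed
  ultimately show ?thesis
    by (rule equivalence_if_fully_faithful_essentially_surjective[OF H'.category_UCMod H.category_UCMod])
qed

section \<open>Functors on a category of finite subsets\<close>

lemma
  assumes F: "is_functor C (ModCat R) \<Phi>"
  shows functor_ob_module: "X \<in> Ob C \<Longrightarrow> left_module R (on_ob \<Phi> X)"
    and functor_lin_maps: "\<lbrakk>X \<in> Ob C; Y \<in> Ob C; f \<in> Hom C X Y\<rbrakk> \<Longrightarrow>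
      on_hom \<Phi> X Y f \<in> lin_maps R (on_ob \<Phi> X) (on_ob \<Phi> Y)"
    and functor_closed: "\<lbrakk>X \<in> Ob C; Y \<in> Ob C; f \<in> Hom C X Y; x \<in> carrier (on_ob \<Phi> X)\<rbrakk> \<Longrightarrow>
      on_hom \<Phi> X Y f x \<in> carrier (on_ob \<Phi> Y)"
    and functor_Idt_apply: "\<lbrakk>X \<in> Ob C; x \<in> carrier (on_ob \<Phi> X)\<rbrakk> \<Longrightarrow> on_hom \<Phi> X X (Idt C X) x = x"
    and functor_Cmp_apply: "\<lbrakk>X \<in> Ob C; Y \<in> Ob C; Z \<in> Ob C; f \<in> Hom C X Y; g \<in> Hom C Y Z;
        x \<in> carrier (on_ob \<Phi> X)\<rbrakk> \<Longrightarrow>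
      on_hom \<Phi> X Z (Cmp C X Y Z g f) x = on_hom \<Phi> Y Z g (on_hom \<Phi> X Y f x)"
proof -
  show *: "on_hom \<Phi> X Y f \<in> lin_maps R (on_ob \<Phi> X) (on_ob \<Phi> Y)"
    if "X \<in> Ob C" "Y \<in> Ob C" "f \<in> Hom C X Y" for X Y f
    using functor_on_hom[OF F that] by simp
  show "\<lbrakk>X \<in> Ob C; Y \<in> Ob C; f \<in> Hom C X Y; x \<in> carrier (on_ob \<Phi> X)\<rbrakk> \<Longrightarrow>
      on_hom \<Phi> X Y f x \<in> carrier (on_ob \<Phi> Y)"
    using lin_maps_closed[OF *] .
qed (use functor_on_ob[OF F] functor_Idt[OF F] functor_Cmp[OF F] in \<open>simp_all add: compose_eq\<close>)

text \<open>Morphisms of \<open>functor_cat\<close> are normalised off the objects, so the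
  transformation and its componentwise inverse both have to be restricted.\<close>

lemma is_iso_functor_catI:
  assumes C: "category C" and D: "category D" and F: "is_functor C D \<Phi>" "is_functor C D \<Psi>"
    and n: "nat_iso C D \<Phi> \<Psi> \<eta>"
  shows "is_iso (functor_cat C D) \<Phi> \<Psi> (restrict \<eta> (Ob C))"
proof -
  have restr: "nat_trans C D \<Phi> \<Psi> (restrict \<eta> (Ob C))" if "nat_trans C D \<Phi> \<Psi> \<eta>" for \<Phi> \<Psi> \<eta>
    using that by (simp add: nat_trans_def)
  have i: "is_iso D (on_ob \<Phi> X) (on_ob \<Psi> X) (\<eta> X)" if "X \<in> Ob C" for X
    using n that by (simp add: nat_iso_def)
  note n' = nat_iso_inverse[OF D F n]
  show ?thesis
    unfolding is_iso_def
  proof (intro conjI bexI)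
    show "restrict \<eta> (Ob C) \<in> Hom (functor_cat C D) \<Phi> \<Psi>"
      using n by (simp add: nat_iso_def restr)
    show "restrict (\<lambda>X. inverse_of D (on_ob \<Phi> X) (on_ob \<Psi> X) (\<eta> X)) (Ob C) \<in> Hom (functor_cat C D) \<Psi> \<Phi>"
      using n' by (simp add: nat_iso_def restr)
  qed (auto simp: inverse_left[OF i] inverse_right[OF i] restrict_def)
qed

lemma smult_zero_left:
  assumes "left_module R M" "x \<in> carrier M" shows "\<zero>\<^bsub>R\<^esub> \<odot>\<^bsub>M\<^esub> x = \<zero>\<^bsub>M\<^esub>"
proof -
  interpret left_module R M by fact
  show ?thesis
    by (rule abelian_group_zero_unique[OF M.abelian_group_axioms])
      (use assms(2) smult_l_distr[of "\<zero>\<^bsub>R\<^esub>" "\<zero>\<^bsub>R\<^esub>" x] in \<open>simp_all add: smult_closed\<close>)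
qed

text \<open>Closure under negation comes for free, the negative of \<open>v\<close> being its
  multiple by minus one.\<close>

lemma left_module_submodule:
  assumes V: "left_module R V" and sub: "N \<subseteq> carrier V" "\<zero>\<^bsub>V\<^esub> \<in> N"
    and add: "\<And>v w. \<lbrakk>v \<in> N; w \<in> N\<rbrakk> \<Longrightarrow> v \<oplus>\<^bsub>V\<^esub> w \<in> N"
    and smult: "\<And>c v. \<lbrakk>c \<in> carrier R; v \<in> N\<rbrakk> \<Longrightarrow> c \<odot>\<^bsub>V\<^esub> v \<in> N"
  shows "left_module R (V\<lparr>carrier := N\<rparr>)"
proof -
  interpret V: left_module R V by fact
  have N: "v \<in> carrier V" if "v \<in> N" for v using sub that by blast
  have "abelian_group (V\<lparr>carrier := N\<rparr>)"
  proof (rule abelian_groupI)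
    fix v assume "v \<in> carrier (V\<lparr>carrier := N\<rparr>)"
    then have v: "v \<in> N" by simp
    have "(\<ominus>\<^bsub>R\<^esub> \<one>\<^bsub>R\<^esub>) \<odot>\<^bsub>V\<^esub> v \<oplus>\<^bsub>V\<^esub> v = ((\<ominus>\<^bsub>R\<^esub> \<one>\<^bsub>R\<^esub>) \<oplus>\<^bsub>R\<^esub> \<one>\<^bsub>R\<^esub>) \<odot>\<^bsub>V\<^esub> v"
      by (subst V.smult_l_distr) (use N[OF v] in \<open>simp_all add: V.smult_one\<close>)
    also have "\<dots> = \<zero>\<^bsub>V\<^esub>" by (simp add: V.R.l_neg smult_zero_left[OF V N[OF v]])
    finally show "\<exists>y\<in>carrier (V\<lparr>carrier := N\<rparr>). y \<oplus>\<^bsub>V\<lparr>carrier := N\<rparr>\<^esub> v = \<zero>\<^bsub>V\<lparr>carrier := N\<rparr>\<^esub>"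
      using smult[OF _ v, of "\<ominus>\<^bsub>R\<^esub> \<one>\<^bsub>R\<^esub>"] by auto
  qed (use sub N add in \<open>auto simp: V.M.a_ac\<close>)
  then show ?thesis
    by (intro left_module.intro left_module_axioms.intro V.R.ring_axioms)
      (auto simp: N smult V.smult_l_distr V.smult_r_distr V.smult_assoc1 V.smult_one)
qed

lemma lin_maps_zero:
  assumes M: "left_module R M" and N: "left_module R N" and f: "f \<in> lin_maps R M N"
  shows "f \<zero>\<^bsub>M\<^esub> = \<zero>\<^bsub>N\<^esub>"
proof -
  interpret M: left_module R M by fact
  interpret N: left_module R N by fact
  show ?thesis
    by (rule abelian_group_zero_unique[OF N.M.abelian_group_axioms])
      (use lin_maps_add[OF f, of "\<zero>\<^bsub>M\<^esub>" "\<zero>\<^bsub>M\<^esub>"] lin_maps_closed[OF f, of "\<zero>\<^bsub>M\<^esub>"] in auto)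
qed

text \<open>A faithful functor from \<open>C\<close> to finite subsets of \<open>S\<close> and maps between them, with
  \<open>X \<mapsto> U X\<close> on objects and \<open>f \<mapsto> T X Y f\<close> on morphisms, whose image consists of the maps
  \<open>U X \<rightarrow> U Y\<close> that extend to an element of \<open>H\<close>.\<close>

locale finite_subset_category = uc_setting K S H
  for K :: "('k, 'x) ring_scheme" (structure) and S :: "'s set" and H :: "('s \<Rightarrow> 's) set" +
  fixes C :: "('o, 'm) cat" and U :: "'o \<Rightarrow> 's set" and T :: "'o \<Rightarrow> 'o \<Rightarrow> 'm \<Rightarrow> 's \<Rightarrow> 's" and E :: "nat \<Rightarrow> 'o"
  assumes category: "category C"
    and U_finite: "X \<in> Ob C \<Longrightarrow> finite (U X)"
    and U_subset: "X \<in> Ob C \<Longrightarrow> U X \<subseteq> S"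
    and T_Idt: "\<lbrakk>X \<in> Ob C; x \<in> U X\<rbrakk> \<Longrightarrow> T X X (Idt C X) x = x"
    and T_Cmp: "\<lbrakk>X \<in> Ob C; Y \<in> Ob C; Z \<in> Ob C; f \<in> Hom C X Y; g \<in> Hom C Y Z; x \<in> U X\<rbrakk> \<Longrightarrow>
      T X Z (Cmp C X Y Z g f) x = T Y Z g (T X Y f x)"
    and T_closed: "\<lbrakk>X \<in> Ob C; Y \<in> Ob C; f \<in> Hom C X Y; x \<in> U X\<rbrakk> \<Longrightarrow> T X Y f x \<in> U Y"
    and T_faithful: "\<lbrakk>X \<in> Ob C; Y \<in> Ob C; f \<in> Hom C X Y; g \<in> Hom C X Y;
      \<And>x. x \<in> U X \<Longrightarrow> T X Y f x = T X Y g x\<rbrakk> \<Longrightarrow> f = g"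
    and T_extend: "\<lbrakk>X \<in> Ob C; Y \<in> Ob C; f \<in> Hom C X Y\<rbrakk> \<Longrightarrow> \<exists>h\<in>H. \<forall>x\<in>U X. h x = T X Y f x"
    and T_restrict: "\<lbrakk>X \<in> Ob C; Y \<in> Ob C; h \<in> H; h ` U X \<subseteq> U Y\<rbrakk> \<Longrightarrow>
      \<exists>f\<in>Hom C X Y. \<forall>x\<in>U X. h x = T X Y f x"
    and E_Ob: "E n \<in> Ob C"
    and E_Suc: "U (E n) \<subseteq> U (E (Suc n))"
    and E_cover: "x \<in> S \<Longrightarrow> \<exists>n. x \<in> U (E n)"
begin

lemma E_mono: "n \<le> m \<Longrightarrow> U (E n) \<subseteq> U (E m)"
  by (rule lift_Suc_mono_le[of "\<lambda>n. U (E n)"]) (rule E_Suc)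

text \<open>Stated for all large \<open>m\<close> rather than for some \<open>m\<close>, so that
  finitely many such bounds can be met at a common stage.\<close>

lemma E_exhausts:
  assumes "finite B" "B \<subseteq> S" shows "\<exists>n. \<forall>m\<ge>n. B \<subseteq> U (E m)"
  using assms
proof (induction B rule: finite_induct)
  case (insert x B)
  obtain n where n: "x \<in> U (E n)" using E_cover insert.prems by blast
  obtain k where k: "\<forall>m\<ge>k. B \<subseteq> U (E m)" using insert.IH insert.prems by blast
  have "\<forall>m\<ge>max n k. insert x B \<subseteq> U (E m)" using n k E_mono by (meson insert_subset max.bounded_iff subsetD)
  then show ?case by blast
qed simp

lemma finite_subset_E:
  assumes "finite B" "B \<subseteq> S" obtains n where "B \<subseteq> U (E n)"
  using E_exhausts[OF assms] by blast

section \<open>Passing between morphisms of \<open>C\<close> and elements of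
  \<open>H\<close>\<close>

definition restriction :: "('s \<Rightarrow> 's) \<Rightarrow> 'o \<Rightarrow> 'o \<Rightarrow> 'm" where
  "restriction h X Y = (SOME f. f \<in> Hom C X Y \<and> (\<forall>x\<in>U X. h x = T X Y f x))"

lemma
  assumes "X \<in> Ob C" "Y \<in> Ob C" "h \<in> H" "h ` U X \<subseteq> U Y"
  shows restriction_Hom: "restriction h X Y \<in> Hom C X Y"
    and T_restriction: "x \<in> U X \<Longrightarrow> T X Y (restriction h X Y) x = h x"
proof -
  have "\<exists>f. f \<in> Hom C X Y \<and> (\<forall>x\<in>U X. h x = T X Y f x)" using T_restrict[OF assms] by blast
  from someI_ex[OF this, folded restriction_def]
  show "restriction h X Y \<in> Hom C X Y" "x \<in> U X \<Longrightarrow> T X Y (restriction h X Y) x = h x"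
    by auto
qed

text \<open>Inclusions are not part of the data: they arise because the identity of \<open>S\<close>
  lies in \<open>H\<close>. Distinct objects may have the same \<open>U\<close>, and then they are
  identified by mutually inverse inclusions.\<close>

definition incl :: "'o \<Rightarrow> 'o \<Rightarrow> 'm" where
  "incl X Y = restriction (\<lambda>x\<in>S. x) X Y"

lemma
  assumes "X \<in> Ob C" "Y \<in> Ob C" "U X \<subseteq> U Y"
  shows incl_Hom: "incl X Y \<in> Hom C X Y"
    and T_incl: "x \<in> U X \<Longrightarrow> T X Y (incl X Y) x = x"
proof -
  have "(\<lambda>x\<in>S. x) ` U X \<subseteq> U Y" using assms U_subset by auto
  note * = restriction_Hom[OF assms(1,2) id_closed this] T_restriction[OF assms(1,2) id_closed this]
  show "incl X Y \<in> Hom C X Y" "x \<in> U X \<Longrightarrow> T X Y (incl X Y) x = x"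
    using * U_subset[OF assms(1)] by (auto simp: incl_def)
qed

text \<open>Unlike \<open>restriction\<close>, this is a genuine choice, as a morphism may have many
  extensions; only its effect on suitably fixed vectors is canonical, see
  \<open>fixed_functor_hom\<close>.\<close>

definition extension :: "'o \<Rightarrow> 'o \<Rightarrow> 'm \<Rightarrow> 's \<Rightarrow> 's" where
  "extension X Y f = (SOME h. h \<in> H \<and> (\<forall>x\<in>U X. h x = T X Y f x))"

lemma
  assumes "X \<in> Ob C" "Y \<in> Ob C" "f \<in> Hom C X Y"
  shows extension_closed: "extension X Y f \<in> H"
    and extension_apply: "x \<in> U X \<Longrightarrow> extension X Y f x = T X Y f x"
proof -
  have "\<exists>h. h \<in> H \<and> (\<forall>x\<in>U X. h x = T X Y f x)" using T_extend[OF assms] by blast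
  from someI_ex[OF this, folded extension_def]
  show "extension X Y f \<in> H" "x \<in> U X \<Longrightarrow> extension X Y f x = T X Y f x" by auto
qed

text \<open>For a group \<open>H\<close> these are the vectors fixed by the pointwise stabiliser of
  \<open>U X\<close>. A monoid may have too few invertible elements for that description, hence the
  comparison of two elements of \<open>H\<close>.\<close>

definition fixed :: "(('s \<Rightarrow> 's) \<Rightarrow> 'k, 'a) module \<Rightarrow> 'o \<Rightarrow> 'a set" where
  "fixed V X = {v \<in> carrier V. \<forall>h\<in>H. \<forall>h'\<in>H. (\<forall>x\<in>U X. h x = h' x) \<longrightarrow> A.act V h v = A.act V h' v}"

lemma fixedI:
  assumes "v \<in> carrier V"
    and "\<And>h h'. \<lbrakk>h \<in> H; h' \<in> H; \<And>x. x \<in> U X \<Longrightarrow> h x = h' x\<rbrakk> \<Longrightarrow> A.act V h v = A.act V h' v"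
  shows "v \<in> fixed V X"
  unfolding fixed_def
  by (rule CollectI, intro conjI ballI impI assms(1), rule assms(2), assumption, assumption, rule bspec)

lemma fixed_carrier: "v \<in> fixed V X \<Longrightarrow> v \<in> carrier V"
  by (simp add: fixed_def)

lemma fixedD:
  assumes "v \<in> fixed V X" "h \<in> H" "h' \<in> H" "\<And>x. x \<in> U X \<Longrightarrow> h x = h' x"
  shows "A.act V h v = A.act V h' v"
  using assms unfolding fixed_def by blast

text \<open>If \<open>g\<close> and \<open>g'\<close> agree on \<open>U Y\<close>, then their
  composites with \<open>h\<close> agree on \<open>U X\<close>.\<close>

lemma act_fixed:
  assumes V: "left_module A.KM V" and v: "v \<in> fixed V X" and X: "X \<in> Ob C" and h: "h \<in> H" "h ` U X \<subseteq> U Y"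
  shows "A.act V h v \<in> fixed V Y"
proof (rule fixedI)
  note vc = fixed_carrier[OF v]
  show "A.act V h v \<in> carrier V" using A.act_closed[OF V _ vc] h by simp
  fix g g' assume g: "g \<in> H" "g' \<in> H" and eq: "\<And>x. x \<in> U Y \<Longrightarrow> g x = g' x"
  have "A.act V (compose S g h) v = A.act V (compose S g' h) v"
    by (rule fixedD[OF v]) (use g h eq U_subset[OF X] in \<open>auto simp: compose_closed compose_eq subset_iff\<close>)
  then show "A.act V g (A.act V h v) = A.act V g' (A.act V h v)"
    using act_compose[OF V g(1) h(1) vc] act_compose[OF V g(2) h(1) vc] by simp
qed

text \<open>This is how uniform continuity enters: it makes the module the increasing union of its
  parts fixed at the stages \<open>E m\<close>.\<close>

lemma fixed_exhausts:
  assumes V: "uniformly_continuous K S H V" and v: "v \<in> carrier V"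
  shows "\<exists>n. \<forall>m\<ge>n. v \<in> fixed V (E m)"
proof -
  obtain B where B: "finite B" "B \<subseteq> S"
    "\<forall>h\<in>H. \<forall>h'\<in>H. (\<forall>x\<in>B. h x = h' x) \<longrightarrow> A.act V h v = A.act V h' v"
    by (rule uniformly_continuousE[OF V v])
  obtain n where n: "\<forall>m\<ge>n. B \<subseteq> U (E m)" using E_exhausts[OF B(1,2)] by blast
  have "v \<in> fixed V (E m)" if "m \<ge> n" for m
    by (rule fixedI[OF v], rule B(3)[rule_format]) (use n that in auto)
  then show ?thesis by blast
qed

section \<open>The functor of fixed vectors of a module\<close>

definition fixed_functor :: "(('s \<Rightarrow> 's) \<Rightarrow> 'k, 'a) module \<Rightarrow> ('o, 'm, ('k, 'a) module, 'a \<Rightarrow> 'a) func" where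
  "fixed_functor V = \<lparr>on_ob = (\<lambda>X. (A.restrict_scalars V)\<lparr>carrier := fixed V X\<rparr>),
    on_hom = (\<lambda>X Y f. \<lambda>v\<in>fixed V X. A.act V (extension X Y f) v)\<rparr>"

lemma fixed_functor_simps [simp]:
  "carrier (on_ob (fixed_functor V) X) = fixed V X"
  "add (on_ob (fixed_functor V) X) = add V"
  "zero (on_ob (fixed_functor V) X) = zero V"
  "smult (on_ob (fixed_functor V) X) = smult (A.restrict_scalars V)"
  by (simp_all add: fixed_functor_def)

text \<open>Two extensions of \<open>f\<close> agree on \<open>U X\<close>, so on vectors fixed at
  \<open>X\<close> any extension may replace the chosen one.\<close>

lemma fixed_functor_hom:
  assumes V: "left_module A.KM V" and X: "X \<in> Ob C" and Y: "Y \<in> Ob C" and f: "f \<in> Hom C X Y"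
    and h: "h \<in> H" "\<And>x. x \<in> U X \<Longrightarrow> h x = T X Y f x" and v: "v \<in> fixed V X"
  shows "on_hom (fixed_functor V) X Y f v = A.act V h v"
proof -
  have "A.act V (extension X Y f) v = A.act V h v"
    by (rule fixedD[OF v extension_closed[OF X Y f] h(1)]) (simp add: h(2) extension_apply[OF X Y f])
  then show ?thesis using v by (simp add: fixed_functor_def)
qed

text \<open>The identity of \<open>S\<close> extends every inclusion, so the values of the functor
  are honestly nested subsets of the module.\<close>

lemma fixed_functor_incl:
  assumes V: "left_module A.KM V" and X: "X \<in> Ob C" and Y: "Y \<in> Ob C" and sub: "U X \<subseteq> U Y" and v: "v \<in> fixed V X"
  shows "on_hom (fixed_functor V) X Y (incl X Y) v = v"
proof -
  have "(\<lambda>x\<in>S. x) x = T X Y (incl X Y) x" if "x \<in> U X" for x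
    using T_incl[OF X Y sub that] U_subset[OF X] that by auto
  then show ?thesis
    using fixed_functor_hom[OF V X Y incl_Hom[OF X Y sub] id_closed _ v] act_id[OF V fixed_carrier[OF v]]
    by metis
qed

lemma extension_image:
  assumes "X \<in> Ob C" "Y \<in> Ob C" "f \<in> Hom C X Y"
  shows "extension X Y f ` U X \<subseteq> U Y"
  using extension_apply[OF assms] T_closed[OF assms] by auto

lemma left_module_fixed:
  assumes V: "left_module A.KM V"
  shows "left_module K (on_ob (fixed_functor V) X)"
proof -
  interpret V: left_module A.KM V by fact
  have sc: "single K c (\<lambda>x\<in>S. x) \<in> carrier A.KM" if "c \<in> carrier K" for c
    using A.single_closed[OF that, of "\<lambda>x\<in>S. x"] id_closed by simp
  note act_smult = A.act_smult[OF V, simplified map_monoid_simps]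
    and act_add = A.act_add[OF V, simplified map_monoid_simps]
  have "left_module K ((A.restrict_scalars V)\<lparr>carrier := fixed V X\<rparr>)"
  proof (rule left_module_submodule[OF A.left_module_restrict_scalars[OF V]])
    have z: "A.act V h \<zero>\<^bsub>V\<^esub> = \<zero>\<^bsub>V\<^esub>" if "h \<in> H" for h
      using abelian_group_zero_unique[OF V.M.abelian_group_axioms, of "A.act V h \<zero>\<^bsub>V\<^esub>"]
        act_add[OF that, of "\<zero>\<^bsub>V\<^esub>" "\<zero>\<^bsub>V\<^esub>"] A.act_closed[OF V, of h "\<zero>\<^bsub>V\<^esub>"] that by simp
    show "\<zero>\<^bsub>A.restrict_scalars V\<^esub> \<in> fixed V X"
      by (rule fixedI) (simp_all add: z)
  next
    fix v w assume vw: "v \<in> fixed V X" "w \<in> fixed V X"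
    show "v \<oplus>\<^bsub>A.restrict_scalars V\<^esub> w \<in> fixed V X"
    proof (rule fixedI)
      fix h h' assume h: "h \<in> H" "h' \<in> H" and eq: "\<And>x. x \<in> U X \<Longrightarrow> h x = h' x"
      show "A.act V h (v \<oplus>\<^bsub>A.restrict_scalars V\<^esub> w) = A.act V h' (v \<oplus>\<^bsub>A.restrict_scalars V\<^esub> w)"
        using fixedD[OF vw(1) h eq] fixedD[OF vw(2) h eq] h vw
        by (simp add: act_add fixed_carrier)
    qed (simp add: vw[THEN fixed_carrier])
  next
    fix c v assume c: "c \<in> carrier K" and v: "v \<in> fixed V X"
    show "c \<odot>\<^bsub>A.restrict_scalars V\<^esub> v \<in> fixed V X"
    proof (rule fixedI)
      fix h h' assume h: "h \<in> H" "h' \<in> H" and eq: "\<And>x. x \<in> U X \<Longrightarrow> h x = h' x"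
      show "A.act V h (c \<odot>\<^bsub>A.restrict_scalars V\<^esub> v) = A.act V h' (c \<odot>\<^bsub>A.restrict_scalars V\<^esub> v)"
        using fixedD[OF v h eq] h v c by (simp add: act_smult fixed_carrier)
    qed (simp add: v[THEN fixed_carrier] c sc V.smult_closed)
  qed (auto simp: fixed_def)
  then show ?thesis by (simp add: fixed_functor_def)
qed

lemma
  assumes V: "left_module A.KM V"
  shows act_add': "\<lbrakk>h \<in> H; v \<in> carrier V; w \<in> carrier V\<rbrakk> \<Longrightarrow> A.act V h (v \<oplus>\<^bsub>V\<^esub> w) = A.act V h v \<oplus>\<^bsub>V\<^esub> A.act V h w"
    and act_smult': "\<lbrakk>h \<in> H; c \<in> carrier K; v \<in> carrier V\<rbrakk> \<Longrightarrow>
      A.act V h (c \<odot>\<^bsub>A.restrict_scalars V\<^esub> v) = c \<odot>\<^bsub>A.restrict_scalars V\<^esub> A.act V h v"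
  using A.act_add[OF V] A.act_smult[OF V] by simp_all

lemma fixed_add: "\<lbrakk>left_module A.KM V; v \<in> fixed V X; w \<in> fixed V X\<rbrakk> \<Longrightarrow> v \<oplus>\<^bsub>V\<^esub> w \<in> fixed V X"
  using abelian_groupE(1)[OF left_module.axioms(2)[OF left_module_fixed[of V X]]] by simp

lemma fixed_smult: "\<lbrakk>left_module A.KM V; c \<in> carrier K; v \<in> fixed V X\<rbrakk> \<Longrightarrow>
    c \<odot>\<^bsub>A.restrict_scalars V\<^esub> v \<in> fixed V X"
  using left_module.smult_closed[OF left_module_fixed[of V X]] by (simp del: A.restrict_scalars_simps)

lemma is_functor_fixed_functor:
  assumes V: "left_module A.KM V"
  shows "is_functor C (ModCat K) (fixed_functor V)"
proof (rule is_functorI, goal_cases)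
  case (1 X) then show ?case using left_module_fixed[OF V] by simp
next
  case (2 X Y f)
  note e = extension_closed[OF 2] extension_image[OF 2]
  have "(\<lambda>v\<in>fixed V X. A.act V (extension X Y f) v) \<in> lin_maps K (on_ob (fixed_functor V) X) (on_ob (fixed_functor V) Y)"
    by (rule lin_mapsI)
      (simp_all add: act_fixed[OF V _ 2(1) e] fixed_add[OF V] fixed_smult[OF V] act_add'[OF V e(1)] act_smult'[OF V e(1)]
        fixed_carrier del: A.restrict_scalars_simps)
  then show ?case by (simp add: fixed_functor_def)
next
  case (3 X)
  have "on_hom (fixed_functor V) X X (Idt C X) v = v" if "v \<in> fixed V X" for v
  proof -
    have "(\<lambda>x\<in>S. x) x = T X X (Idt C X) x" if "x \<in> U X" for x
      using T_Idt[OF 3 that] U_subset[OF 3] that by auto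
    then show ?thesis
      using fixed_functor_hom[OF V 3 3 Idt_in_Hom[OF category 3] id_closed _ that]
        act_id[OF V fixed_carrier[OF that]] by metis
  qed
  then show ?case
    by (auto simp: fun_eq_iff fixed_functor_def)
next
  case (4 X Y Z f g)
  note f = extension_closed[OF 4(1,2,4)] extension_image[OF 4(1,2,4)] extension_apply[OF 4(1,2,4)]
    and g = extension_closed[OF 4(2,3,5)] extension_image[OF 4(2,3,5)] extension_apply[OF 4(2,3,5)]
  note gf = Cmp_in_Hom[OF category 4]
  have "on_hom (fixed_functor V) X Z (Cmp C X Y Z g f) v =
      on_hom (fixed_functor V) Y Z g (on_hom (fixed_functor V) X Y f v)" if v: "v \<in> fixed V X" for v
  proof -
    have "on_hom (fixed_functor V) X Z (Cmp C X Y Z g f) v = A.act V (compose S (extension Y Z g) (extension X Y f)) v"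
      by (rule fixed_functor_hom[OF V 4(1,3) gf _ _ v])
        (use f g T_closed[OF 4(1,2,4)] U_subset[OF 4(1)] in
          \<open>auto simp: compose_closed compose_eq subset_iff T_Cmp[OF 4]\<close>)
    then show ?thesis
      using act_compose[OF V g(1) f(1) fixed_carrier[OF v]] act_fixed[OF V v 4(1) f(1,2)] v
      by (simp add: fixed_functor_def)
  qed
  then show ?case
    by (auto simp: fun_eq_iff compose_def) (simp_all add: fixed_functor_def)
qed

section \<open>The passage from modules to functors is fully faithful\<close>

definition fixed_func :: "((('s \<Rightarrow> 's) \<Rightarrow> 'k, 'a) module, 'a \<Rightarrow> 'a,
    ('o, 'm, ('k, 'a) module, 'a \<Rightarrow> 'a) func, 'o \<Rightarrow> 'a \<Rightarrow> 'a) func" where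
  "fixed_func = \<lparr>on_ob = fixed_functor, on_hom = (\<lambda>V W \<phi>. \<lambda>X\<in>Ob C. restrict \<phi> (fixed V X))\<rparr>"

lemma lin_maps_fixed:
  assumes V: "left_module A.KM V" and W: "left_module A.KM W" and \<phi>: "\<phi> \<in> lin_maps A.KM V W"
    and v: "v \<in> fixed V X"
  shows "\<phi> v \<in> fixed W X"
proof (rule fixedI)
  note \<phi>' = \<phi>[unfolded lin_maps_KM_iff[OF V W], THEN conjunct2, rule_format]
  show "\<phi> v \<in> carrier W" using lin_maps_closed[OF \<phi> fixed_carrier[OF v]] .
  fix h h' assume h: "h \<in> H" "h' \<in> H" and eq: "\<And>x. x \<in> U X \<Longrightarrow> h x = h' x"
  show "A.act W h (\<phi> v) = A.act W h' (\<phi> v)"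
    using fixedD[OF v h eq] \<phi>'[OF h(1) fixed_carrier[OF v]] \<phi>'[OF h(2) fixed_carrier[OF v]] by simp
qed

lemma is_functor_fixed_func:
  "is_functor (UCMod K S H) (functor_cat C (ModCat K :: ('k, 'a) mod_category)) fixed_func"
proof (rule is_functorI, goal_cases)
  case (1 V) then show ?case by (simp add: fixed_func_def is_functor_fixed_functor)
next
  case (2 V W \<phi>)
  then have V: "left_module A.KM V" and W: "left_module A.KM W" and \<phi>: "\<phi> \<in> lin_maps A.KM V W" by simp_all
  note \<phi>' = \<phi>[unfolded lin_maps_KM_iff[OF V W]]
  have "restrict \<phi> (fixed V X) \<in> lin_maps K (on_ob (fixed_functor V) X) (on_ob (fixed_functor W) X)" for X
    by (rule lin_mapsI)
      (simp_all add: lin_maps_fixed[OF V W \<phi>] fixed_add[OF V] fixed_smult[OF V] lin_maps_add[OF \<phi>]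
        lin_maps_smult[OF \<phi>'[THEN conjunct1]] fixed_carrier del: A.restrict_scalars_simps(4))
  moreover have "compose (fixed V X) (restrict \<phi> (fixed V Y)) (on_hom (fixed_functor V) X Y f) =
      compose (fixed V X) (on_hom (fixed_functor W) X Y f) (restrict \<phi> (fixed V X))"
    if "X \<in> Ob C" "Y \<in> Ob C" "f \<in> Hom C X Y" for X Y f
  proof (rule ext)
    note e = extension_closed[OF that] extension_image[OF that]
    show "compose (fixed V X) (restrict \<phi> (fixed V Y)) (on_hom (fixed_functor V) X Y f) v =
      compose (fixed V X) (on_hom (fixed_functor W) X Y f) (restrict \<phi> (fixed V X)) v" for v
      using e(1) \<phi>'[THEN conjunct2] act_fixed[OF V _ that(1) e, of v] lin_maps_fixed[OF V W \<phi>, of v X]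
        fixed_carrier[of v V X]
      by (auto simp: compose_def fixed_functor_def)
  qed
  ultimately show ?case
    by (simp add: fixed_func_def nat_trans_def)
next
  case (3 V) then show ?case
    by (auto simp: fixed_func_def fun_eq_iff fixed_carrier)
next
  case (4 U V W f g)
  then have U: "left_module A.KM U" and V: "left_module A.KM V" and f: "f \<in> lin_maps A.KM U V" by simp_all
  show ?case
    by (auto simp: fixed_func_def fun_eq_iff compose_def fixed_carrier lin_maps_fixed[OF U V f])
qed

text \<open>Faithful because the fixed parts exhaust the module. For fullness, inclusions act as the
  identity in both functors, so naturality makes the components of \<eta> agree on nested objects,
  and they glue to one map \<phi>.\<close>

lemma fully_faithful_fixed_func:
  "fully_faithful (UCMod K S H) (functor_cat C (ModCat K :: ('k, 'a) mod_category)) fixed_func"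
  unfolding fully_faithful_def
proof (intro ballI bij_betw_imageI inj_onI equalityI subsetI)
  fix V W :: "(('s \<Rightarrow> 's) \<Rightarrow> 'k, 'a) module" and \<phi> \<psi>
  assume "V \<in> Ob (UCMod K S H)" and h: "\<phi> \<in> Hom (UCMod K S H) V W" "\<psi> \<in> Hom (UCMod K S H) V W"
    and eq: "on_hom fixed_func V W \<phi> = on_hom fixed_func V W \<psi>"
  then have V: "uniformly_continuous K S H V" by simp
  show "\<phi> = \<psi>"
  proof (rule lin_maps_eqI)
    fix v assume "v \<in> carrier V"
    then obtain n where n: "v \<in> fixed V (E n)" using fixed_exhausts[OF V] by blast
    have "on_hom fixed_func V W \<phi> (E n) v = on_hom fixed_func V W \<psi> (E n) v" using eq by simp
    then show "\<phi> v = \<psi> v" using n E_Ob by (simp add: fixed_func_def)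
  qed (use h in auto)
next
  fix V W :: "(('s \<Rightarrow> 's) \<Rightarrow> 'k, 'a) module" and \<eta>
  assume "V \<in> Ob (UCMod K S H)" "W \<in> Ob (UCMod K S H)" "\<eta> \<in> on_hom fixed_func V W ` Hom (UCMod K S H) V W"
  then show "\<eta> \<in> Hom (functor_cat C (ModCat K)) (on_ob fixed_func V) (on_ob fixed_func W)"
    using functor_on_hom[OF is_functor_fixed_func, of V W] by blast
next
  fix V W :: "(('s \<Rightarrow> 's) \<Rightarrow> 'k, 'a) module" and \<eta>
  assume VW: "V \<in> Ob (UCMod K S H)" "W \<in> Ob (UCMod K S H)"
    and "\<eta> \<in> Hom (functor_cat C (ModCat K)) (on_ob fixed_func V) (on_ob fixed_func W)"
  then have V: "left_module A.KM V" "uniformly_continuous K S H V"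
    and W: "left_module A.KM W" "uniformly_continuous K S H W"
    and \<eta>: "\<eta> \<in> extensional (Ob C)" "nat_trans C (ModCat K) (fixed_functor V) (fixed_functor W) \<eta>"
    by (simp_all add: fixed_func_def)
  interpret V: left_module A.KM V by fact
  have lin: "\<eta> X \<in> lin_maps K (on_ob (fixed_functor V) X) (on_ob (fixed_functor W) X)" if "X \<in> Ob C" for X
    using \<eta>(2) that by (simp add: nat_trans_def)
  have nat: "\<eta> Y (on_hom (fixed_functor V) X Y f v) = on_hom (fixed_functor W) X Y f (\<eta> X v)"
    if "X \<in> Ob C" "Y \<in> Ob C" "f \<in> Hom C X Y" "v \<in> fixed V X" for X Y f v
  proof -
    have "compose (fixed V X) (\<eta> Y) (on_hom (fixed_functor V) X Y f) v =
        compose (fixed V X) (on_hom (fixed_functor W) X Y f) (\<eta> X) v"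
      using \<eta>(2) that by (simp add: nat_trans_def)
    then show ?thesis using that(4) by (simp add: compose_def)
  qed
  have \<eta>c: "\<eta> X v \<in> fixed W X" if "X \<in> Ob C" "v \<in> fixed V X" for X v
    using lin_maps_closed[OF lin[OF that(1)], of v] that(2) by simp
  have mono: "\<eta> Y v = \<eta> X v" if "X \<in> Ob C" "Y \<in> Ob C" "U X \<subseteq> U Y" "v \<in> fixed V X" for X Y v
    using nat[OF that(1,2) incl_Hom[OF that(1-3)] that(4)]
      fixed_functor_incl[OF V(1) that] fixed_functor_incl[OF W(1) that(1-3) \<eta>c[OF that(1,4)]] by simp
  have level: "\<exists>n. v \<in> fixed V (E n)" if "v \<in> carrier V" for v
    using fixed_exhausts[OF V(2) that] by blast
  \<comment> \<open>The level chosen here is immaterial: two objects at which \<open>v\<close> is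
    fixed lie in a common stage, and there the components of \<eta> are compared.\<close>
  define \<phi> where "\<phi> = (\<lambda>v\<in>carrier V. \<eta> (E (SOME n. v \<in> fixed V (E n))) v)"
  have \<phi>: "\<phi> v = \<eta> X v" if X: "X \<in> Ob C" and v: "v \<in> fixed V X" for X v
  proof -
    let ?n = "SOME n. v \<in> fixed V (E n)"
    have n: "v \<in> fixed V (E ?n)" by (rule someI_ex[OF level[OF fixed_carrier[OF v]]])
    obtain m where m: "U X \<subseteq> U (E m)" "U (E ?n) \<subseteq> U (E m)"
      using finite_subset_E[of "U X \<union> U (E ?n)"] U_finite U_subset X E_Ob
      by (metis Un_subset_iff finite_Un)
    show ?thesis
      using mono[OF X E_Ob m(1) v] mono[OF E_Ob E_Ob m(2) n] fixed_carrier[OF v] by (simp add: \<phi>_def)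
  qed
  have common: "\<exists>n. v \<in> fixed V (E n) \<and> w \<in> fixed V (E n)" if "v \<in> carrier V" "w \<in> carrier V" for v w
    using fixed_exhausts[OF V(2) that(1)] fixed_exhausts[OF V(2) that(2)] by (meson nat_le_linear)
  have "\<phi> \<in> lin_maps A.KM V W"
    unfolding lin_maps_KM_iff[OF V(1) W(1)]
  proof (intro conjI lin_mapsI ballI)
    show "\<phi> \<in> extensional (carrier (A.restrict_scalars V))" by (simp add: \<phi>_def)
  next
    fix v assume "v \<in> carrier (A.restrict_scalars V)"
    then obtain n where "v \<in> fixed V (E n)" using level by auto
    then show "\<phi> v \<in> carrier (A.restrict_scalars W)"
      using \<eta>c[OF E_Ob, THEN fixed_carrier] by (simp add: \<phi>[OF E_Ob])
  next
    fix v w assume "v \<in> carrier (A.restrict_scalars V)" "w \<in> carrier (A.restrict_scalars V)"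
    then obtain n where n: "v \<in> fixed V (E n)" "w \<in> fixed V (E n)" using common by auto
    then show "\<phi> (v \<oplus>\<^bsub>A.restrict_scalars V\<^esub> w) = \<phi> v \<oplus>\<^bsub>A.restrict_scalars W\<^esub> \<phi> w"
      using lin_maps_add[OF lin[OF E_Ob], of v n w] by (simp add: \<phi>[OF E_Ob n(1)] \<phi>[OF E_Ob n(2)] \<phi>[OF E_Ob fixed_add[OF V(1) n]])
  next
    fix c v assume c: "c \<in> carrier K" and "v \<in> carrier (A.restrict_scalars V)"
    then obtain n where n: "v \<in> fixed V (E n)" using level by auto
    show "\<phi> (c \<odot>\<^bsub>A.restrict_scalars V\<^esub> v) = c \<odot>\<^bsub>A.restrict_scalars W\<^esub> \<phi> v"
      using lin_maps_smult[OF lin[OF E_Ob] c, of v n] n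
      by (simp add: \<phi>[OF E_Ob n] \<phi>[OF E_Ob fixed_smult[OF V(1) c n]] del: A.restrict_scalars_simps)
  next
    fix h v assume h: "h \<in> H" and "v \<in> carrier V"
    then obtain n where n: "v \<in> fixed V (E n)" using level by auto
    \<comment> \<open>A single \<open>h\<close> becomes a morphism of \<open>C\<close> once its
      target is a stage containing the finite image; equivariance is then naturality of
      \<eta>.\<close>
    have "finite (h ` U (E n))" "h ` U (E n) \<subseteq> S"
      using U_finite[OF E_Ob] U_subset[OF E_Ob] H_closed[OF h] by auto
    then obtain m where m: "h ` U (E n) \<subseteq> U (E m)" by (rule finite_subset_E)
    let ?f = "restriction h (E n) (E m)"
    note f = restriction_Hom[OF E_Ob E_Ob h m] T_restriction[OF E_Ob E_Ob h m]
    have "\<phi> (A.act V h v) = \<eta> (E m) (on_hom (fixed_functor V) (E n) (E m) ?f v)"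
      by (simp only: \<phi>[OF E_Ob act_fixed[OF V(1) n E_Ob h m]]
          fixed_functor_hom[OF V(1) E_Ob E_Ob f(1) h f(2)[symmetric] n])
    also have "\<dots> = on_hom (fixed_functor W) (E n) (E m) ?f (\<eta> (E n) v)"
      by (rule nat[OF E_Ob E_Ob f(1) n])
    also have "\<dots> = A.act W h (\<phi> v)"
      by (simp only: fixed_functor_hom[OF W(1) E_Ob E_Ob f(1) h f(2)[symmetric] \<eta>c[OF E_Ob n]] \<phi>[OF E_Ob n])
    finally show "\<phi> (A.act V h v) = A.act W h (\<phi> v)" .
  qed
  moreover have "\<eta> = on_hom fixed_func V W \<phi>"
  proof (rule extensionalityI[OF \<eta>(1)])
    show "on_hom fixed_func V W \<phi> \<in> extensional (Ob C)" by (simp add: fixed_func_def)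
    fix X assume X: "X \<in> Ob C"
    have "\<eta> X = restrict \<phi> (fixed V X)"
      by (rule extensionalityI[of _ "fixed V X"])
        (use lin_maps_extensional[OF lin[OF X]] \<phi>[OF X] in auto)
    then show "\<eta> X = on_hom fixed_func V W \<phi> X" using X by (simp add: fixed_func_def)
  qed
  ultimately show "\<eta> \<in> on_hom fixed_func V W ` Hom (UCMod K S H) V W" by simp
qed

end

section \<open>Colimits along a sequence of objects\<close>

text \<open>Cardinal arithmetic: the product of an infinite set with the natural numbers has the
  cardinality of that set. It makes countably many stages fit into the type of a single one.\<close>

lemma inj_nat_prod_infinite:
  assumes "infinite (UNIV :: 'a set)"
  shows "\<exists>e :: nat \<times> 'a \<Rightarrow> 'a. inj e"
proof -
  include cardinal_syntax
  have "|UNIV :: nat set| \<le>o |UNIV :: 'a set|" using assms infinite_iff_card_of_nat by blast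
  then have "|(UNIV :: 'a set) \<times> (UNIV :: nat set)| =o |UNIV :: 'a set|"
    by (intro conjunct1[OF card_of_Times_infinite[OF assms]]) auto
  then have "|(UNIV :: nat set) \<times> (UNIV :: 'a set)| \<le>o |UNIV :: 'a set|"
    using card_of_Times_commute ordIso_transitive ordIso_iff_ordLeq by blast
  then show ?thesis using card_of_ordLeq[of "UNIV \<times> UNIV" "UNIV :: 'a set"] by auto
qed

text \<open>The direct limit of a sequence of injections exists on the same infinite type: a class of
  pairs \<open>(n, x)\<close> is encoded by one of its members.\<close>

lemma sequential_colimit_exists:
  fixes X :: "nat \<Rightarrow> 'a set" and t :: "nat \<Rightarrow> nat \<Rightarrow> 'a \<Rightarrow> 'a"
  assumes inf: "infinite (UNIV :: 'a set)"
    and closed: "\<And>n m x. \<lbrakk>n \<le> m; x \<in> X n\<rbrakk> \<Longrightarrow> t n m x \<in> X m"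
    and refl: "\<And>n x. x \<in> X n \<Longrightarrow> t n n x = x"
    and trans: "\<And>n m k x. \<lbrakk>n \<le> m; m \<le> k; x \<in> X n\<rbrakk> \<Longrightarrow> t m k (t n m x) = t n k x"
    and inj: "\<And>n m. n \<le> m \<Longrightarrow> inj_on (t n m) (X n)"
  shows "\<exists>\<iota> :: nat \<Rightarrow> 'a \<Rightarrow> 'a. (\<forall>n. inj_on (\<iota> n) (X n)) \<and> (\<forall>n m x. n \<le> m \<longrightarrow> x \<in> X n \<longrightarrow> \<iota> m (t n m x) = \<iota> n x)"
proof -
  obtain e :: "nat \<times> 'a \<Rightarrow> 'a" where e: "inj e" using inj_nat_prod_infinite[OF inf] by blast
  define cls where "cls n x = {(m, y). y \<in> X m \<and> (\<exists>N. n \<le> N \<and> m \<le> N \<and> t n N x = t m N y)}" for n x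
  define \<iota> where "\<iota> n x = e (SOME p. p \<in> cls n x)" for n x
  \<comment> \<open>Equal codes mean a common representative \<open>(m, y)\<close>. Both elements
    meet \<open>y\<close> at some stage, hence agree at the later of the two stages, and transition
    maps are injective.\<close>
  have "inj_on (\<iota> n) (X n)" for n
  proof (rule inj_onI)
    fix x x' assume x: "x \<in> X n" "x' \<in> X n" and eq: "\<iota> n x = \<iota> n x'"
    obtain m y where p: "(SOME p. p \<in> cls n x) = (m, y)" by fastforce
    have mem: "(n, z) \<in> cls n z" if "z \<in> X n" for z using that by (auto simp: cls_def)
    have "(SOME p. p \<in> cls n x') = (m, y)" using eq p e by (simp add: \<iota>_def inj_eq)
    then have "(m, y) \<in> cls n x" "(m, y) \<in> cls n x'"
      using p someI[of "\<lambda>p. p \<in> cls n x", OF mem[OF x(1)]] someI[of "\<lambda>p. p \<in> cls n x'", OF mem[OF x(2)]] by auto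
    then obtain N N' where N: "y \<in> X m" "n \<le> N" "m \<le> N" "t n N x = t m N y" "n \<le> N'" "m \<le> N'" "t n N' x' = t m N' y"
      by (auto simp: cls_def)
    let ?M = "max N N'"
    have "t n ?M x = t m ?M y"
      using trans[of n N ?M x] trans[of m N ?M y] N x by simp
    also have "\<dots> = t n ?M x'"
      using trans[of n N' ?M x'] trans[of m N' ?M y] N x by simp
    finally have M: "t n ?M x = t n ?M x'" .
    have "n \<le> ?M" using N by simp
    from inj_onD[OF inj[OF this] M x] show "x = x'" .
  qed
  moreover have "\<iota> m (t n m x) = \<iota> n x" if nm: "n \<le> m" and x: "x \<in> X n" for n m x
  proof -
    \<comment> \<open>The classes coincide as sets, so the choice operator picks the same
      representative from them.\<close>
    have "cls m (t n m x) = cls n x"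
    proof (intro equalityI subsetI)
      fix p assume "p \<in> cls m (t n m x)"
      then obtain k y N where "p = (k, y)" "y \<in> X k" "m \<le> N" "k \<le> N" "t m N (t n m x) = t k N y"
        by (auto simp: cls_def)
      then show "p \<in> cls n x" using nm x by (auto simp: cls_def trans intro!: exI[of _ N])
    next
      fix p assume "p \<in> cls n x"
      then obtain k y N where p: "p = (k, y)" "y \<in> X k" "n \<le> N" "k \<le> N" "t n N x = t k N y"
        by (auto simp: cls_def)
      let ?M = "max N m"
      have "t m ?M (t n m x) = t n ?M x" using nm x by (simp add: trans)
      also have "\<dots> = t k ?M y"
        using trans[of n N ?M x] trans[of k N ?M y] p x by simp
      finally show "p \<in> cls m (t n m x)" using p nm by (auto simp: cls_def intro!: exI[of _ ?M])
    qed
    then show ?thesis by (simp add: \<iota>_def)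
  qed
  ultimately show ?thesis by blast
qed

lemma is_functor_full_subcat:
  assumes "is_functor C D \<Phi>" "\<And>X. X \<in> Ob C \<Longrightarrow> P (on_ob \<Phi> X)"
  shows "is_functor C (full_subcat D P) \<Phi>"
  by (rule is_functorI)
    (simp_all add: functor_on_ob[OF assms(1)] functor_on_hom[OF assms(1)] functor_Idt[OF assms(1)]
      functor_Cmp[OF assms(1)] assms(2))

lemma fully_faithful_full_subcat: "fully_faithful C D \<Phi> \<Longrightarrow> fully_faithful C (full_subcat D P) \<Phi>"
  unfolding fully_faithful_def full_subcat_simps .

context finite_subset_category
begin

text \<open>The two conditions that characterise the functors in the essential image of
  \<^term>\<open>fixed_functor\<close>.\<close>

definition injective_on_inclusions :: "('o, 'm, ('k, 'a) module, 'a \<Rightarrow> 'a) func \<Rightarrow> bool" where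
  "injective_on_inclusions \<Phi> \<longleftrightarrow> (\<forall>X\<in>Ob C. \<forall>Y\<in>Ob C. U X \<subseteq> U Y \<longrightarrow>
    inj_on (on_hom \<Phi> X Y (incl X Y)) (carrier (on_ob \<Phi> X)))"

definition descent_along_inclusions :: "('o, 'm, ('k, 'a) module, 'a \<Rightarrow> 'a) func \<Rightarrow> bool" where
  "descent_along_inclusions \<Phi> \<longleftrightarrow> (\<forall>X\<in>Ob C. \<forall>Y\<in>Ob C. U X \<subseteq> U Y \<longrightarrow> (\<forall>y\<in>carrier (on_ob \<Phi> Y).
    (\<forall>Z\<in>Ob C. \<forall>g\<in>Hom C Y Z. \<forall>g'\<in>Hom C Y Z.
      Cmp C X Y Z g (incl X Y) = Cmp C X Y Z g' (incl X Y) \<longrightarrow> on_hom \<Phi> Y Z g y = on_hom \<Phi> Y Z g' y) \<longrightarrow>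
    y \<in> on_hom \<Phi> X Y (incl X Y) ` carrier (on_ob \<Phi> X)))"

lemma incl_eqI:
  assumes "X \<in> Ob C" "Y \<in> Ob C" "U X \<subseteq> U Y" "f \<in> Hom C X Y" "\<And>x. x \<in> U X \<Longrightarrow> T X Y f x = x"
  shows "f = incl X Y"
  by (rule T_faithful[OF assms(1,2,4) incl_Hom[OF assms(1-3)]]) (simp add: assms(5) T_incl[OF assms(1-3)])

lemma incl_refl: "X \<in> Ob C \<Longrightarrow> incl X X = Idt C X"
  by (rule incl_eqI[symmetric]) (simp_all add: Idt_in_Hom[OF category] T_Idt)

lemma incl_incl:
  assumes "X \<in> Ob C" "Y \<in> Ob C" "Z \<in> Ob C" "U X \<subseteq> U Y" "U Y \<subseteq> U Z"
  shows "Cmp C X Y Z (incl Y Z) (incl X Y) = incl X Z"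
proof (rule incl_eqI)
  note i = incl_Hom[OF assms(1,2,4)] incl_Hom[OF assms(2,3,5)]
  show "Cmp C X Y Z (incl Y Z) (incl X Y) \<in> Hom C X Z"
    by (rule Cmp_in_Hom[OF category assms(1-3) i])
  show "T X Z (Cmp C X Y Z (incl Y Z) (incl X Y)) x = x" if "x \<in> U X" for x
    using that assms T_incl[OF assms(1,2,4) that] T_incl[OF assms(2,3,5), of x]
    by (auto simp: T_Cmp[OF assms(1-3) i])
qed (use assms in auto)

lemma E_contains: "X \<in> Ob C \<Longrightarrow> \<exists>n. \<forall>m\<ge>n. U X \<subseteq> U (E m)"
  using E_exhausts U_finite U_subset by simp

lemma U_subset_E:
  assumes "X \<in> Ob C" obtains n where "U X \<subseteq> U (E n)"
  using finite_subset_E[OF U_finite[OF assms] U_subset[OF assms]] .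

section \<open>The colimit of a functor as a uniformly continuous representation\<close>

context
  fixes \<Phi> :: "('o, 'm, ('k, 'a) module, 'a \<Rightarrow> 'a) func"
  assumes \<Phi>: "is_functor C (ModCat K) \<Phi>" and inj: "injective_on_inclusions \<Phi>"
    and inf: "infinite (UNIV :: 'a set)"
begin

abbreviation "P X \<equiv> carrier (on_ob \<Phi> X)"

lemma \<Phi>_incl: 
  assumes "X \<in> Ob C" "Y \<in> Ob C" "U X \<subseteq> U Y"
  shows "x \<in> P X \<Longrightarrow> on_hom \<Phi> X Y (incl X Y) x \<in> P Y"
    and "inj_on (on_hom \<Phi> X Y (incl X Y)) (P X)"
  using functor_closed[OF \<Phi> assms(1,2) incl_Hom[OF assms]] inj assms
  by (auto simp: injective_on_inclusions_def)

lemma \<Phi>_incl_incl: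
  assumes "X \<in> Ob C" "Y \<in> Ob C" "Z \<in> Ob C" "U X \<subseteq> U Y" "U Y \<subseteq> U Z" "x \<in> P X"
  shows "on_hom \<Phi> Y Z (incl Y Z) (on_hom \<Phi> X Y (incl X Y) x) = on_hom \<Phi> X Z (incl X Z) x"
  using functor_Cmp_apply[OF \<Phi> assms(1-3) incl_Hom[OF assms(1,2,4)] incl_Hom[OF assms(2,3,5)] assms(6)]
  by (simp add: incl_incl assms)

text \<open>The maps of the stages into the colimit, chosen once so that everything below refers to
  the same colimit.\<close>

definition \<iota> :: "nat \<Rightarrow> 'a \<Rightarrow> 'a" where
  "\<iota> = (SOME \<iota>. (\<forall>n. inj_on (\<iota> n) (P (E n))) \<and>
    (\<forall>n m x. n \<le> m \<longrightarrow> x \<in> P (E n) \<longrightarrow> \<iota> m (on_hom \<Phi> (E n) (E m) (incl (E n) (E m)) x) = \<iota> n x))"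

lemma \<iota>: "inj_on (\<iota> n) (P (E n))"
    "\<lbrakk>n \<le> m; x \<in> P (E n)\<rbrakk> \<Longrightarrow> \<iota> m (on_hom \<Phi> (E n) (E m) (incl (E n) (E m)) x) = \<iota> n x"
proof -
  have "\<exists>\<iota> :: nat \<Rightarrow> 'a \<Rightarrow> 'a. (\<forall>n. inj_on (\<iota> n) (P (E n))) \<and>
    (\<forall>n m x. n \<le> m \<longrightarrow> x \<in> P (E n) \<longrightarrow> \<iota> m (on_hom \<Phi> (E n) (E m) (incl (E n) (E m)) x) = \<iota> n x)"
    by (rule sequential_colimit_exists[OF inf])
      (simp_all add: \<Phi>_incl E_Ob E_mono \<Phi>_incl_incl incl_refl functor_Idt_apply[OF \<Phi>])
  from someI_ex[OF this, folded \<iota>_def]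
  show "inj_on (\<iota> n) (P (E n))"
    "\<lbrakk>n \<le> m; x \<in> P (E n)\<rbrakk> \<Longrightarrow> \<iota> m (on_hom \<Phi> (E n) (E m) (incl (E n) (E m)) x) = \<iota> n x"
    by blast+
qed

text \<open>Routes an arbitrary object through the first stage that contains it; by
  \<open>j_eq_\<iota>\<close> any stage containing it gives the same value.\<close>

definition j :: "'o \<Rightarrow> 'a \<Rightarrow> 'a" where
  "j X x = (let n = (LEAST n. U X \<subseteq> U (E n)) in \<iota> n (on_hom \<Phi> X (E n) (incl X (E n)) x))"

lemma j_eq_\<iota>:
  assumes X: "X \<in> Ob C" and m: "U X \<subseteq> U (E m)" and x: "x \<in> P X"
  shows "j X x = \<iota> m (on_hom \<Phi> X (E m) (incl X (E m)) x)"
proof -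
  let ?n = "LEAST n. U X \<subseteq> U (E n)"
  have n: "U X \<subseteq> U (E ?n)" "?n \<le> m" using m by (rule LeastI, rule Least_le)
  show ?thesis
    using \<iota>(2)[OF n(2) \<Phi>_incl(1)[OF X E_Ob n(1) x]] \<Phi>_incl_incl[OF X E_Ob E_Ob n(1) E_mono[OF n(2)] x]
    by (simp add: j_def Let_def)
qed

lemma j_incl:
  assumes X: "X \<in> Ob C" and Y: "Y \<in> Ob C" and sub: "U X \<subseteq> U Y" and x: "x \<in> P X"
  shows "j Y (on_hom \<Phi> X Y (incl X Y) x) = j X x"
proof -
  obtain m where m: "U Y \<subseteq> U (E m)" by (rule U_subset_E[OF Y])
  then show ?thesis
    using j_eq_\<iota>[OF Y m \<Phi>_incl(1)[OF X Y sub x]] j_eq_\<iota>[OF X _ x, of m] sub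
      \<Phi>_incl_incl[OF X Y E_Ob sub m x] by simp
qed

lemma j_inj: "X \<in> Ob C \<Longrightarrow> inj_on (j X) (P X)"
proof (rule inj_onI)
  fix x y assume X: "X \<in> Ob C" and xy: "x \<in> P X" "y \<in> P X" and eq: "j X x = j X y"
  obtain m where m: "U X \<subseteq> U (E m)" by (rule U_subset_E[OF X])
  have "on_hom \<Phi> X (E m) (incl X (E m)) x = on_hom \<Phi> X (E m) (incl X (E m)) y"
    by (rule inj_onD[OF \<iota>(1)[of m]])
      (use eq j_eq_\<iota>[OF X m] xy \<Phi>_incl(1)[OF X E_Ob m] in auto)
  then show "x = y" using inj_onD[OF \<Phi>_incl(2)[OF X E_Ob m]] xy by blast
qed

definition colim :: "'a set" where "colim = (\<Union>n. j (E n) ` P (E n))"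

lemma j_level:
  assumes "X \<in> Ob C" "x \<in> P X"
  shows "\<exists>n. \<forall>m\<ge>n. \<exists>y\<in>P (E m). j X x = j (E m) y"
proof -
  obtain n where n: "\<forall>m\<ge>n. U X \<subseteq> U (E m)" using E_contains[OF assms(1)] ..
  then show ?thesis using j_incl[OF assms(1) E_Ob] \<Phi>_incl(1)[OF assms(1) E_Ob] assms(2) by metis
qed

lemma j_colim: "\<lbrakk>X \<in> Ob C; x \<in> P X\<rbrakk> \<Longrightarrow> j X x \<in> colim"
  using j_level by (force simp: colim_def)

lemma colim_level: "v \<in> colim \<Longrightarrow> \<exists>n. \<forall>m\<ge>n. v \<in> j (E m) ` P (E m)"
  using j_level[OF E_Ob] by (force simp: colim_def)

lemma colim_common:
  assumes "finite B" "B \<subseteq> colim" shows "\<exists>n. \<forall>m\<ge>n. B \<subseteq> j (E m) ` P (E m)"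
  using assms
proof (induction B rule: finite_induct)
  case (insert v B)
  obtain n where n: "\<forall>m\<ge>n. v \<in> j (E m) ` P (E m)" using colim_level insert.prems by blast
  obtain k where k: "\<forall>m\<ge>k. B \<subseteq> j (E m) ` P (E m)" using insert.IH insert.prems by blast
  have "\<forall>m\<ge>max n k. insert v B \<subseteq> j (E m) ` P (E m)" using n k by simp
  then show ?case by blast
qed simp

text \<open>Well-definedness of the action. Both sides factor through one restriction
  \<open>?F\<close> of \<open>h\<close> between two stages, and the two elements already coincide at
  the first of these, because \<open>j\<close> is injective there.\<close>

lemma j_hom_independent:
  assumes X: "X \<in> Ob C" and Y: "Y \<in> Ob C" and f: "f \<in> Hom C X Y" and x: "x \<in> P X"
    and h: "h \<in> H" "\<And>z. z \<in> U X \<Longrightarrow> h z = T X Y f z"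
    and X': "X' \<in> Ob C" and Y': "Y' \<in> Ob C" and f': "f' \<in> Hom C X' Y'" and x': "x' \<in> P X'"
    and h': "\<And>z. z \<in> U X' \<Longrightarrow> h z = T X' Y' f' z"
    and eq: "j X x = j X' x'"
  shows "j Y (on_hom \<Phi> X Y f x) = j Y' (on_hom \<Phi> X' Y' f' x')"
proof -
  obtain n where n: "U X \<subseteq> U (E n)" "U X' \<subseteq> U (E n)"
    using E_contains[OF X] E_contains[OF X'] by (meson nat_le_linear)
  have "finite (U Y \<union> U Y' \<union> h ` U (E n))" "U Y \<union> U Y' \<union> h ` U (E n) \<subseteq> S"
    using U_finite U_subset[OF Y] U_subset[OF Y'] Y Y' E_Ob H_closed[OF h(1)] U_subset[OF E_Ob, of n] by auto
  then obtain m where m: "U Y \<subseteq> U (E m)" "U Y' \<subseteq> U (E m)" "h ` U (E n) \<subseteq> U (E m)"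
    using finite_subset_E by (metis Un_subset_iff)
  let ?F = "restriction h (E n) (E m)"
  note F = restriction_Hom[OF E_Ob E_Ob h(1) m(3)] T_restriction[OF E_Ob E_Ob h(1) m(3)]
  have key: "j Y (on_hom \<Phi> X Y f x) = j (E m) (on_hom \<Phi> (E n) (E m) ?F (on_hom \<Phi> X (E n) (incl X (E n)) x))"
    if X: "X \<in> Ob C" and Y: "Y \<in> Ob C" and f: "f \<in> Hom C X Y" and x: "x \<in> P X"
      and h: "\<And>z. z \<in> U X \<Longrightarrow> h z = T X Y f z" and n: "U X \<subseteq> U (E n)" and m: "U Y \<subseteq> U (E m)" for X Y f x
  proof -
    note i = incl_Hom[OF X E_Ob n] incl_Hom[OF Y E_Ob m]
    \<comment> \<open>Both composites send \<open>z\<close> to \<open>h z\<close>, so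
      \<open>T_faithful\<close> identifies them.\<close>
    have "Cmp C X (E n) (E m) ?F (incl X (E n)) = Cmp C X Y (E m) (incl Y (E m)) f"
    proof (rule T_faithful[OF X E_Ob])
      fix z assume z: "z \<in> U X"
      then have zn: "z \<in> U (E n)" using n by blast
      show "T X (E m) (Cmp C X (E n) (E m) ?F (incl X (E n))) z = T X (E m) (Cmp C X Y (E m) (incl Y (E m)) f) z"
        using z zn by (simp add: T_Cmp[OF X E_Ob E_Ob i(1) F(1)] T_Cmp[OF X Y E_Ob f i(2)]
            T_incl[OF X E_Ob n] T_incl[OF Y E_Ob m] F(2) h T_closed[OF X Y f])
    qed (use Cmp_in_Hom[OF category X E_Ob E_Ob i(1) F(1)] Cmp_in_Hom[OF category X Y E_Ob f i(2)] in auto)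
    then show ?thesis
      using functor_Cmp_apply[OF \<Phi> X E_Ob E_Ob i(1) F(1) x] functor_Cmp_apply[OF \<Phi> X Y E_Ob f i(2) x]
        j_incl[OF Y E_Ob m functor_closed[OF \<Phi> X Y f x]] by simp
  qed
  have "on_hom \<Phi> X (E n) (incl X (E n)) x = on_hom \<Phi> X' (E n) (incl X' (E n)) x'"
    by (rule inj_onD[OF j_inj[OF E_Ob[of n]]])
      (simp_all add: j_incl[OF X E_Ob n(1) x] j_incl[OF X' E_Ob n(2) x'] eq
        \<Phi>_incl(1)[OF X E_Ob n(1) x] \<Phi>_incl(1)[OF X' E_Ob n(2) x'])
  then show ?thesis
    using key[OF X Y f x h(2) n(1) m(1)] key[OF X' Y' f' x' h' n(2) m(2)] by simp
qed

text \<open>Computed from any representative of \<open>v\<close> and any morphism out of its object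
  that \<open>h\<close> extends; \<open>j_hom_independent\<close> makes the result unique for
  \<open>h\<close> in \<open>H\<close>.\<close>

definition \<rho> :: "('s \<Rightarrow> 's) \<Rightarrow> 'a \<Rightarrow> 'a" where
  "\<rho> h v = (SOME w. \<exists>X\<in>Ob C. \<exists>Y\<in>Ob C. \<exists>f\<in>Hom C X Y. \<exists>x\<in>P X. (\<forall>z\<in>U X. h z = T X Y f z) \<and>
    v = j X x \<and> w = j Y (on_hom \<Phi> X Y f x))"

lemma \<rho>_j:
  assumes X: "X \<in> Ob C" and Y: "Y \<in> Ob C" and f: "f \<in> Hom C X Y" and x: "x \<in> P X"
    and h: "h \<in> H" "\<And>z. z \<in> U X \<Longrightarrow> h z = T X Y f z"
  shows "\<rho> h (j X x) = j Y (on_hom \<Phi> X Y f x)"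
  unfolding \<rho>_def
proof (rule some_equality)
  show "\<exists>X'\<in>Ob C. \<exists>Y'\<in>Ob C. \<exists>f'\<in>Hom C X' Y'. \<exists>x'\<in>P X'. (\<forall>z\<in>U X'. h z = T X' Y' f' z) \<and>
    j X x = j X' x' \<and> j Y (on_hom \<Phi> X Y f x) = j Y' (on_hom \<Phi> X' Y' f' x')"
    using assms by blast
next
  fix w assume "\<exists>X'\<in>Ob C. \<exists>Y'\<in>Ob C. \<exists>f'\<in>Hom C X' Y'. \<exists>x'\<in>P X'. (\<forall>z\<in>U X'. h z = T X' Y' f' z) \<and>
    j X x = j X' x' \<and> w = j Y' (on_hom \<Phi> X' Y' f' x')"
  then show "w = j Y (on_hom \<Phi> X Y f x)"
    using j_hom_independent[OF assms] by metis
qed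

lemma \<rho>_level:
  assumes h: "h \<in> H"
  obtains m where "h ` U (E n) \<subseteq> U (E m)" "restriction h (E n) (E m) \<in> Hom C (E n) (E m)"
    "\<forall>x\<in>P (E n). \<rho> h (j (E n) x) = j (E m) (on_hom \<Phi> (E n) (E m) (restriction h (E n) (E m)) x)"
proof -
  have "finite (h ` U (E n))" "h ` U (E n) \<subseteq> S"
    using U_finite[OF E_Ob] U_subset[OF E_Ob] H_closed[OF h] by auto
  then obtain m where m: "h ` U (E n) \<subseteq> U (E m)" by (rule finite_subset_E)
  note F = restriction_Hom[OF E_Ob E_Ob h m] T_restriction[OF E_Ob E_Ob h m]
  show thesis
    by (rule that[OF m F(1)]) (use \<rho>_j[OF E_Ob E_Ob F(1) _ h] F(2) in auto)
qed

text \<open>Computed at any stage where both arguments are represented; independence of the stage is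
  \<open>j_add_independent\<close>.\<close>

definition colim_add :: "'a \<Rightarrow> 'a \<Rightarrow> 'a" where
  "colim_add u v = (SOME w. \<exists>n. \<exists>x\<in>P (E n). \<exists>y\<in>P (E n).
    u = j (E n) x \<and> v = j (E n) y \<and> w = j (E n) (x \<oplus>\<^bsub>on_ob \<Phi> (E n)\<^esub> y))"

definition colim_smult :: "'k \<Rightarrow> 'a \<Rightarrow> 'a" where
  "colim_smult c v = (SOME w. \<exists>n. \<exists>x\<in>P (E n). v = j (E n) x \<and> w = j (E n) (c \<odot>\<^bsub>on_ob \<Phi> (E n)\<^esub> x))"

lemma incl_lin_maps:
  assumes "X \<in> Ob C" "Y \<in> Ob C" "U X \<subseteq> U Y"
  shows "on_hom \<Phi> X Y (incl X Y) \<in> lin_maps K (on_ob \<Phi> X) (on_ob \<Phi> Y)"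
  by (rule functor_lin_maps[OF \<Phi> assms(1,2) incl_Hom[OF assms]])

lemma P_add: "\<lbrakk>X \<in> Ob C; x \<in> P X; y \<in> P X\<rbrakk> \<Longrightarrow> x \<oplus>\<^bsub>on_ob \<Phi> X\<^esub> y \<in> P X"
  by (rule abelian_groupE(1)[OF left_module.axioms(2)[OF functor_ob_module[OF \<Phi>]]])

lemma P_smult: "\<lbrakk>X \<in> Ob C; c \<in> carrier K; x \<in> P X\<rbrakk> \<Longrightarrow> c \<odot>\<^bsub>on_ob \<Phi> X\<^esub> x \<in> P X"
  by (rule left_module.smult_closed[OF functor_ob_module[OF \<Phi>]])

text \<open>Elements with the same image in the colimit already coincide at every stage containing
  both objects, since \<open>j\<close> is injective; the transition maps to that stage are
  linear.\<close>

lemma j_add_independent: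
  assumes X: "X \<in> Ob C" and Y: "Y \<in> Ob C" and x: "x \<in> P X" "x' \<in> P X" and y: "y \<in> P Y" "y' \<in> P Y"
    and eq: "j X x = j Y y" "j X x' = j Y y'"
  shows "j X (x \<oplus>\<^bsub>on_ob \<Phi> X\<^esub> x') = j Y (y \<oplus>\<^bsub>on_ob \<Phi> Y\<^esub> y')"
proof -
  obtain n where n: "U X \<subseteq> U (E n)" "U Y \<subseteq> U (E n)"
    using E_contains[OF X] E_contains[OF Y] by (meson nat_le_linear)
  have "on_hom \<Phi> X (E n) (incl X (E n)) z = on_hom \<Phi> Y (E n) (incl Y (E n)) w"
    if "z \<in> P X" "w \<in> P Y" "j X z = j Y w" for z w
    by (rule inj_onD[OF j_inj[OF E_Ob[of n]]])
      (simp_all add: that j_incl[OF X E_Ob n(1)] j_incl[OF Y E_Ob n(2)]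
        \<Phi>_incl(1)[OF X E_Ob n(1)] \<Phi>_incl(1)[OF Y E_Ob n(2)])
  then have "on_hom \<Phi> X (E n) (incl X (E n)) (x \<oplus>\<^bsub>on_ob \<Phi> X\<^esub> x') =
      on_hom \<Phi> Y (E n) (incl Y (E n)) (y \<oplus>\<^bsub>on_ob \<Phi> Y\<^esub> y')"
    using x y eq by (simp add: lin_maps_add[OF incl_lin_maps[OF X E_Ob n(1)]]
        lin_maps_add[OF incl_lin_maps[OF Y E_Ob n(2)]])
  then show ?thesis
    using j_incl[OF X E_Ob n(1) P_add[OF X x]] j_incl[OF Y E_Ob n(2) P_add[OF Y y]] by simp
qed

lemma j_smult_independent:
  assumes X: "X \<in> Ob C" and Y: "Y \<in> Ob C" and x: "x \<in> P X" and y: "y \<in> P Y"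
    and eq: "j X x = j Y y" and c: "c \<in> carrier K"
  shows "j X (c \<odot>\<^bsub>on_ob \<Phi> X\<^esub> x) = j Y (c \<odot>\<^bsub>on_ob \<Phi> Y\<^esub> y)"
proof -
  obtain n where n: "U X \<subseteq> U (E n)" "U Y \<subseteq> U (E n)"
    using E_contains[OF X] E_contains[OF Y] by (meson nat_le_linear)
  have "on_hom \<Phi> X (E n) (incl X (E n)) x = on_hom \<Phi> Y (E n) (incl Y (E n)) y"
    by (rule inj_onD[OF j_inj[OF E_Ob[of n]]])
      (simp_all add: x y eq j_incl[OF X E_Ob n(1)] j_incl[OF Y E_Ob n(2)]
        \<Phi>_incl(1)[OF X E_Ob n(1)] \<Phi>_incl(1)[OF Y E_Ob n(2)])
  then have "on_hom \<Phi> X (E n) (incl X (E n)) (c \<odot>\<^bsub>on_ob \<Phi> X\<^esub> x) =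
      on_hom \<Phi> Y (E n) (incl Y (E n)) (c \<odot>\<^bsub>on_ob \<Phi> Y\<^esub> y)"
    using x y c by (simp add: lin_maps_smult[OF incl_lin_maps[OF X E_Ob n(1)]]
        lin_maps_smult[OF incl_lin_maps[OF Y E_Ob n(2)]])
  then show ?thesis
    using j_incl[OF X E_Ob n(1) P_smult[OF X c x]] j_incl[OF Y E_Ob n(2) P_smult[OF Y c y]] by simp
qed

lemma colim_add_j:
  assumes X: "X \<in> Ob C" and x: "x \<in> P X" "y \<in> P X"
  shows "colim_add (j X x) (j X y) = j X (x \<oplus>\<^bsub>on_ob \<Phi> X\<^esub> y)"
  unfolding colim_add_def
proof (rule some_equality)
  obtain n where n: "U X \<subseteq> U (E n)" by (rule U_subset_E[OF X])
  show "\<exists>n. \<exists>x'\<in>P (E n). \<exists>y'\<in>P (E n). j X x = j (E n) x' \<and> j X y = j (E n) y' \<and>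
      j X (x \<oplus>\<^bsub>on_ob \<Phi> X\<^esub> y) = j (E n) (x' \<oplus>\<^bsub>on_ob \<Phi> (E n)\<^esub> y')"
    using j_add_independent[OF X E_Ob x] j_incl[OF X E_Ob n] \<Phi>_incl(1)[OF X E_Ob n] x by metis
next
  fix w assume "\<exists>n. \<exists>x'\<in>P (E n). \<exists>y'\<in>P (E n). j X x = j (E n) x' \<and> j X y = j (E n) y' \<and>
      w = j (E n) (x' \<oplus>\<^bsub>on_ob \<Phi> (E n)\<^esub> y')"
  then show "w = j X (x \<oplus>\<^bsub>on_ob \<Phi> X\<^esub> y)" using j_add_independent[OF X E_Ob x] by metis
qed

lemma colim_smult_j:
  assumes X: "X \<in> Ob C" and c: "c \<in> carrier K" and x: "x \<in> P X"
  shows "colim_smult c (j X x) = j X (c \<odot>\<^bsub>on_ob \<Phi> X\<^esub> x)"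
  unfolding colim_smult_def
proof (rule some_equality)
  obtain n where n: "U X \<subseteq> U (E n)" by (rule U_subset_E[OF X])
  show "\<exists>n. \<exists>x'\<in>P (E n). j X x = j (E n) x' \<and>
      j X (c \<odot>\<^bsub>on_ob \<Phi> X\<^esub> x) = j (E n) (c \<odot>\<^bsub>on_ob \<Phi> (E n)\<^esub> x')"
    using j_smult_independent[OF X E_Ob x _ _ c] j_incl[OF X E_Ob n] \<Phi>_incl(1)[OF X E_Ob n] x by metis
next
  fix w assume "\<exists>n. \<exists>x'\<in>P (E n). j X x = j (E n) x' \<and> w = j (E n) (c \<odot>\<^bsub>on_ob \<Phi> (E n)\<^esub> x')"
  then show "w = j X (c \<odot>\<^bsub>on_ob \<Phi> X\<^esub> x)" using j_smult_independent[OF X E_Ob x _ _ c] by metis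
qed

text \<open>The zero is taken from stage \<open>0\<close>; by \<open>colim_zero\<close> the zero at
  any object gives the same element.\<close>

definition colim_module :: "('k, 'a) module" where
  "colim_module = \<lparr>carrier = colim, mult = undefined, one = undefined, zero = j (E 0) \<zero>\<^bsub>on_ob \<Phi> (E 0)\<^esub>,
    add = colim_add, smult = colim_smult\<rparr>"

lemma colim_module_simps [simp]:
  "carrier colim_module = colim" "add colim_module = colim_add" "smult colim_module = colim_smult"
  by (simp_all add: colim_module_def)

lemma colim_zero: "X \<in> Ob C \<Longrightarrow> \<zero>\<^bsub>colim_module\<^esub> = j X \<zero>\<^bsub>on_ob \<Phi> X\<^esub>"
proof -
  assume X: "X \<in> Ob C"
  obtain n where n: "U X \<subseteq> U (E n)" by (rule U_subset_E[OF X])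
  have *: "j X \<zero>\<^bsub>on_ob \<Phi> X\<^esub> = j (E n) \<zero>\<^bsub>on_ob \<Phi> (E n)\<^esub>" if "X \<in> Ob C" "U X \<subseteq> U (E n)" for X n
    using j_incl[OF that(1) E_Ob that(2), of "\<zero>\<^bsub>on_ob \<Phi> X\<^esub>"]
      lin_maps_zero[OF functor_ob_module[OF \<Phi> that(1)] functor_ob_module[OF \<Phi> E_Ob]
        incl_lin_maps[OF that(1) E_Ob that(2)]]
      abelian_groupE(2)[OF left_module.axioms(2)[OF functor_ob_module[OF \<Phi> that(1)]]] by simp
  show ?thesis
    using *[OF X n] *[OF E_Ob E_mono[of 0 n]] by (simp add: colim_module_def)
qed

text \<open>A module axiom involves at most three vectors, so it can be checked at a single stage,
  where it holds already.\<close>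

lemma colim_obtain3:
  assumes "u \<in> colim" "v \<in> colim" "w \<in> colim"
  obtains n x y z where "x \<in> P (E n)" "y \<in> P (E n)" "z \<in> P (E n)"
    "u = j (E n) x" "v = j (E n) y" "w = j (E n) z"
proof -
  obtain n where "\<forall>m\<ge>n. {u, v, w} \<subseteq> j (E m) ` P (E m)"
    using colim_common[of "{u, v, w}"] assms by auto
  then have "u \<in> j (E n) ` P (E n)" "v \<in> j (E n) ` P (E n)" "w \<in> j (E n) ` P (E n)" by simp_all
  then show thesis by (elim imageE) (rule that)
qed

lemma colim_obtain2:
  assumes "u \<in> colim" "v \<in> colim"
  obtains n x y where "x \<in> P (E n)" "y \<in> P (E n)" "u = j (E n) x" "v = j (E n) y"
  by (rule colim_obtain3[OF assms assms(2)]) (rule that)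

lemma colim_obtain1:
  assumes "v \<in> colim" obtains n x where "x \<in> P (E n)" "v = j (E n) x"
  using assms by (auto simp: colim_def)

lemma left_module_colim: "left_module K colim_module"
proof -
  have M: "left_module K (on_ob \<Phi> (E n))" for n by (rule functor_ob_module[OF \<Phi> E_Ob])
  note A = abelian_groupE[OF left_module.axioms(2)[OF M]]
  note add = colim_add_j[OF E_Ob] and smult = colim_smult_j[OF E_Ob]
  note Pa = P_add[OF E_Ob] and Ps = P_smult[OF E_Ob]
  have "abelian_group colim_module"
  proof (rule abelian_groupI)
    fix u v assume "u \<in> carrier colim_module" "v \<in> carrier colim_module"
    then obtain n x y where xy: "x \<in> P (E n)" "y \<in> P (E n)" "u = j (E n) x" "v = j (E n) y"
      unfolding colim_module_simps by (rule colim_obtain2)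
    then show "u \<oplus>\<^bsub>colim_module\<^esub> v \<in> carrier colim_module" by (simp add: add j_colim[OF E_Ob] Pa)
    show "u \<oplus>\<^bsub>colim_module\<^esub> v = v \<oplus>\<^bsub>colim_module\<^esub> u" using xy A(4)[of x n y] by (simp add: add)
  next
    fix u v w assume "u \<in> carrier colim_module" "v \<in> carrier colim_module" "w \<in> carrier colim_module"
    then obtain n x y z where "x \<in> P (E n)" "y \<in> P (E n)" "z \<in> P (E n)"
        "u = j (E n) x" "v = j (E n) y" "w = j (E n) z"
      unfolding colim_module_simps by (rule colim_obtain3)
    then show "u \<oplus>\<^bsub>colim_module\<^esub> v \<oplus>\<^bsub>colim_module\<^esub> w = u \<oplus>\<^bsub>colim_module\<^esub> (v \<oplus>\<^bsub>colim_module\<^esub> w)"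
      using A(3)[of x n y z] by (simp add: add Pa)
  next
    show "\<zero>\<^bsub>colim_module\<^esub> \<in> carrier colim_module"
      by (simp add: colim_zero[OF E_Ob, of 0] j_colim[OF E_Ob] A(2))
    fix u assume "u \<in> carrier colim_module"
    then obtain n x where x: "x \<in> P (E n)" "u = j (E n) x" unfolding colim_module_simps A.action_module_simps by (rule colim_obtain1)
    then show "\<zero>\<^bsub>colim_module\<^esub> \<oplus>\<^bsub>colim_module\<^esub> u = u"
      using A(5)[of x n] by (simp add: colim_zero[OF E_Ob, of n] add A(2))
    obtain y where "y \<in> P (E n)" "y \<oplus>\<^bsub>on_ob \<Phi> (E n)\<^esub> x = \<zero>\<^bsub>on_ob \<Phi> (E n)\<^esub>" using A(6)[OF x(1)] by blast
    then show "\<exists>v\<in>carrier colim_module. v \<oplus>\<^bsub>colim_module\<^esub> u = \<zero>\<^bsub>colim_module\<^esub>"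
      using x by (intro bexI[of _ "j (E n) y"]) (simp_all add: colim_zero[OF E_Ob, of n] add j_colim[OF E_Ob])
  qed
  then show ?thesis
  proof (intro left_module.intro left_module_axioms.intro ring_axioms)
    fix c v assume c: "c \<in> carrier K" and "v \<in> carrier colim_module"
    then obtain n x where "x \<in> P (E n)" "v = j (E n) x" by (auto elim: colim_obtain1)
    with c show "c \<odot>\<^bsub>colim_module\<^esub> v \<in> carrier colim_module"
      by (simp add: smult j_colim[OF E_Ob] Ps)
  next
    fix c d v assume cd: "c \<in> carrier K" "d \<in> carrier K" and "v \<in> carrier colim_module"
    then have "v \<in> colim" by simp
    then obtain n x where x: "x \<in> P (E n)" "v = j (E n) x" by (rule colim_obtain1)
    show "(c \<oplus> d) \<odot>\<^bsub>colim_module\<^esub> v = c \<odot>\<^bsub>colim_module\<^esub> v \<oplus>\<^bsub>colim_module\<^esub> d \<odot>\<^bsub>colim_module\<^esub> v"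
      using cd x left_module.smult_l_distr[OF M cd, of x n] by (simp add: smult add Ps)
    show "(c \<otimes> d) \<odot>\<^bsub>colim_module\<^esub> v = c \<odot>\<^bsub>colim_module\<^esub> (d \<odot>\<^bsub>colim_module\<^esub> v)"
      using cd x left_module.smult_assoc1[OF M cd, of x n] by (simp add: smult Ps)
  next
    fix c u v assume c: "c \<in> carrier K" and "u \<in> carrier colim_module" "v \<in> carrier colim_module"
    from this(2,3) obtain n x y where xy: "x \<in> P (E n)" "y \<in> P (E n)" "u = j (E n) x" "v = j (E n) y"
      unfolding colim_module_simps by (rule colim_obtain2)
    then show "c \<odot>\<^bsub>colim_module\<^esub> (u \<oplus>\<^bsub>colim_module\<^esub> v) = c \<odot>\<^bsub>colim_module\<^esub> u \<oplus>\<^bsub>colim_module\<^esub> c \<odot>\<^bsub>colim_module\<^esub> v"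
      using c left_module.smult_r_distr[OF M c xy(1,2)] by (simp add: smult add Ps Pa)
  next
    fix v assume "v \<in> carrier colim_module"
    then obtain n x where "x \<in> P (E n)" "v = j (E n) x" unfolding colim_module_simps A.action_module_simps by (rule colim_obtain1)
    then show "\<one> \<odot>\<^bsub>colim_module\<^esub> v = v" using left_module.smult_one[OF M, of x n] by (simp add: smult)
  qed
qed

lemma j_lin: 
  assumes "X \<in> Ob C"
  shows "\<lbrakk>x \<in> P X; y \<in> P X\<rbrakk> \<Longrightarrow> j X (x \<oplus>\<^bsub>on_ob \<Phi> X\<^esub> y) = j X x \<oplus>\<^bsub>colim_module\<^esub> j X y"
    and "\<lbrakk>c \<in> carrier K; x \<in> P X\<rbrakk> \<Longrightarrow> j X (c \<odot>\<^bsub>on_ob \<Phi> X\<^esub> x) = c \<odot>\<^bsub>colim_module\<^esub> j X x"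
  using assms by (simp_all add: colim_add_j colim_smult_j)

text \<open>Between suitable stages \<open>h\<close> acts through a morphism of \<open>C\<close>,
  which \<Phi> sends to a linear map. The product rule is functoriality, as restrictions of
  \<open>h\<close> and \<open>g\<close> compose to a morphism extended by
  \<open>compose S g h\<close>.\<close>

lemma is_action_\<rho>: "A.is_action colim_module \<rho>"
  unfolding A.is_action_def map_monoid_simps
proof (intro conjI ballI)
  fix h assume h: "h \<in> H"
  have c: "\<rho> h v \<in> colim" if v: "v \<in> colim" for v
  proof -
    obtain n x where x: "x \<in> P (E n)" "v = j (E n) x" by (rule colim_obtain1[OF v])
    obtain m where "h ` U (E n) \<subseteq> U (E m)" "restriction h (E n) (E m) \<in> Hom C (E n) (E m)"
      "\<forall>x\<in>P (E n). \<rho> h (j (E n) x) = j (E m) (on_hom \<Phi> (E n) (E m) (restriction h (E n) (E m)) x)"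
      by (rule \<rho>_level[OF h])
    then show ?thesis using x by (simp add: j_colim[OF E_Ob] functor_closed[OF \<Phi> E_Ob E_Ob])
  qed
  moreover have "\<rho> h (u \<oplus>\<^bsub>colim_module\<^esub> v) = \<rho> h u \<oplus>\<^bsub>colim_module\<^esub> \<rho> h v"
    if uv: "u \<in> colim" "v \<in> colim" for u v
  proof -
    obtain n x y where xy: "x \<in> P (E n)" "y \<in> P (E n)" "u = j (E n) x" "v = j (E n) y"
      by (rule colim_obtain2[OF uv])
    obtain m where "h ` U (E n) \<subseteq> U (E m)" and f: "restriction h (E n) (E m) \<in> Hom C (E n) (E m)"
      and m: "\<forall>x\<in>P (E n). \<rho> h (j (E n) x) = j (E m) (on_hom \<Phi> (E n) (E m) (restriction h (E n) (E m)) x)"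
      by (rule \<rho>_level[OF h])
    show ?thesis
      using xy by (simp add: colim_add_j[OF E_Ob] m P_add[OF E_Ob] lin_maps_add[OF functor_lin_maps[OF \<Phi> E_Ob E_Ob f]]
          functor_closed[OF \<Phi> E_Ob E_Ob f])
  qed
  moreover have "\<rho> h (c \<odot>\<^bsub>colim_module\<^esub> v) = c \<odot>\<^bsub>colim_module\<^esub> \<rho> h v"
    if c: "c \<in> carrier K" and v: "v \<in> colim" for c v
  proof -
    obtain n x where x: "x \<in> P (E n)" "v = j (E n) x" by (rule colim_obtain1[OF v])
    obtain m where "h ` U (E n) \<subseteq> U (E m)" and f: "restriction h (E n) (E m) \<in> Hom C (E n) (E m)"
      and m: "\<forall>x\<in>P (E n). \<rho> h (j (E n) x) = j (E m) (on_hom \<Phi> (E n) (E m) (restriction h (E n) (E m)) x)"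
      by (rule \<rho>_level[OF h])
    show ?thesis
      using x c by (simp add: colim_smult_j[OF E_Ob] m P_smult[OF E_Ob] lin_maps_smult[OF functor_lin_maps[OF \<Phi> E_Ob E_Ob f]]
          functor_closed[OF \<Phi> E_Ob E_Ob f])
  qed
  ultimately show "\<rho> h \<in> module_hom K colim_module colim_module"
    by (auto simp: module_hom_def)
next
  fix v assume "v \<in> carrier colim_module"
  then obtain n x where x: "x \<in> P (E n)" "v = j (E n) x" unfolding colim_module_simps A.action_module_simps by (rule colim_obtain1)
  have "\<rho> (\<lambda>x\<in>S. x) (j (E n) x) = j (E n) (on_hom \<Phi> (E n) (E n) (Idt C (E n)) x)"
    by (rule \<rho>_j[OF E_Ob E_Ob Idt_in_Hom[OF category E_Ob] x(1) id_closed])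
      (use U_subset[OF E_Ob] T_Idt[OF E_Ob] in auto)
  then show "\<rho> (\<lambda>x\<in>S. x) v = v" using x functor_Idt_apply[OF \<Phi> E_Ob] by simp
next
  fix g h v assume g: "g \<in> H" and h: "h \<in> H" and "v \<in> carrier colim_module"
  from this(3) obtain n x where x: "x \<in> P (E n)" "v = j (E n) x" unfolding colim_module_simps by (rule colim_obtain1)
  obtain m where m: "h ` U (E n) \<subseteq> U (E m)" and f: "restriction h (E n) (E m) \<in> Hom C (E n) (E m)"
    and fm: "\<forall>x\<in>P (E n). \<rho> h (j (E n) x) = j (E m) (on_hom \<Phi> (E n) (E m) (restriction h (E n) (E m)) x)"
    by (rule \<rho>_level[OF h])
  obtain k where k: "g ` U (E m) \<subseteq> U (E k)" and f': "restriction g (E m) (E k) \<in> Hom C (E m) (E k)"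
    and fk: "\<forall>x\<in>P (E m). \<rho> g (j (E m) x) = j (E k) (on_hom \<Phi> (E m) (E k) (restriction g (E m) (E k)) x)"
    by (rule \<rho>_level[OF g])
  have "\<rho> (compose S g h) (j (E n) x) = j (E k) (on_hom \<Phi> (E n) (E k)
      (Cmp C (E n) (E m) (E k) (restriction g (E m) (E k)) (restriction h (E n) (E m))) x)"
  proof (rule \<rho>_j[OF E_Ob E_Ob Cmp_in_Hom[OF category E_Ob E_Ob E_Ob f f'] x(1) compose_closed[OF g h]])
    fix z assume z: "z \<in> U (E n)"
    then have "z \<in> S" "h z \<in> U (E m)" using U_subset[OF E_Ob] m by auto
    then show "compose S g h z = T (E n) (E k) (Cmp C (E n) (E m) (E k) (restriction g (E m) (E k)) (restriction h (E n) (E m))) z"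
      using z by (simp add: T_Cmp[OF E_Ob E_Ob E_Ob f f'] T_restriction[OF E_Ob E_Ob h m]
          T_restriction[OF E_Ob E_Ob g k] compose_eq)
  qed
  then show "\<rho> (compose S g h) v = \<rho> g (\<rho> h v)"
    using x fm fk functor_closed[OF \<Phi> E_Ob E_Ob f] functor_Cmp_apply[OF \<Phi> E_Ob E_Ob E_Ob f f'] by simp
qed

abbreviation "colimit_rep \<equiv> A.action_module colim_module \<rho>"

lemma left_module_colimit_rep: "left_module A.KM colimit_rep"
  by (rule A.left_module_action_module[OF left_module_colim is_action_\<rho>])

lemma act_colimit_rep: "\<lbrakk>h \<in> H; v \<in> colim\<rbrakk> \<Longrightarrow> A.act colimit_rep h v = \<rho> h v"
  using A.act_action_module[OF left_module_colim is_action_\<rho>] by simp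

text \<open>If \<open>h\<close> and \<open>h'\<close> agree on \<open>U X\<close>, then one morphism
  out of \<open>X\<close> is extended by both, and \<open>\<rho>_j\<close> computes both actions
  from it.\<close>

lemma j_fixed:
  assumes X: "X \<in> Ob C" and x: "x \<in> P X"
  shows "j X x \<in> fixed colimit_rep X"
proof (rule fixedI)
  note jc = j_colim[OF X x]
  then show "j X x \<in> carrier colimit_rep" by simp
  fix h h' assume h: "h \<in> H" "h' \<in> H" and eq: "\<And>z. z \<in> U X \<Longrightarrow> h z = h' z"
  have "finite (h ` U X)" "h ` U X \<subseteq> S" using U_finite[OF X] U_subset[OF X] H_closed[OF h(1)] by auto
  then obtain m where m: "h ` U X \<subseteq> U (E m)" by (rule finite_subset_E)
  note f = restriction_Hom[OF X E_Ob h(1) m] T_restriction[OF X E_Ob h(1) m]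
  show "A.act colimit_rep h (j X x) = A.act colimit_rep h' (j X x)"
    using \<rho>_j[OF X E_Ob f(1) x h(1)] \<rho>_j[OF X E_Ob f(1) x h(2)] f(2) eq
    by (simp add: act_colimit_rep[OF _ jc] h)
qed

lemma uniformly_continuous_colimit_rep: "uniformly_continuous K S H colimit_rep"
  unfolding uniformly_continuous_iff
proof
  fix v assume "v \<in> carrier colimit_rep"
  then obtain n x where x: "x \<in> P (E n)" "v = j (E n) x" unfolding colim_module_simps A.action_module_simps by (rule colim_obtain1)
  have "v \<in> fixed colimit_rep (E n)" using j_fixed[OF E_Ob x(1)] x(2) by simp
  then show "\<exists>B. finite B \<and> B \<subseteq> S \<and> (\<forall>h\<in>H. \<forall>h'\<in>H. (\<forall>x\<in>B. h x = h' x) \<longrightarrow>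
      A.act colimit_rep h v = A.act colimit_rep h' v)"
    using U_finite[OF E_Ob, of n] U_subset[OF E_Ob, of n] unfolding fixed_def by blast
qed

text \<open>A fixed vector appears at some stage \<open>E n\<close> containing \<open>X\<close>.
  Morphisms out of \<open>E n\<close> that agree on \<open>X\<close> have extensions agreeing on
  \<open>U X\<close>, which act alike on the vector; as \<open>j\<close> is injective, \<Phi>
  already equalises them, and descent pulls the vector back to \<open>X\<close>.\<close>

lemma fixed_colimit_rep:
  assumes desc: "descent_along_inclusions \<Phi>" and X: "X \<in> Ob C"
  shows "fixed colimit_rep X = j X ` P X"
proof (intro equalityI subsetI)
  fix v assume v: "v \<in> fixed colimit_rep X"
  then have vc: "v \<in> colim" using fixed_carrier[OF v] by simp
  obtain k where k: "\<forall>m\<ge>k. v \<in> j (E m) ` P (E m)" using colim_level[OF vc] by blast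
  obtain l where l: "\<forall>m\<ge>l. U X \<subseteq> U (E m)" using E_contains[OF X] ..
  define n where "n = max k l"
  have n: "U X \<subseteq> U (E n)" and "v \<in> j (E n) ` P (E n)" using k l by (simp_all add: n_def)
  then obtain x where x: "x \<in> P (E n)" "v = j (E n) x" by blast
  have "on_hom \<Phi> (E n) Z g x = on_hom \<Phi> (E n) Z g' x"
    if Z: "Z \<in> Ob C" and g: "g \<in> Hom C (E n) Z" and g': "g' \<in> Hom C (E n) Z"
      and eq: "Cmp C X (E n) Z g (incl X (E n)) = Cmp C X (E n) Z g' (incl X (E n))" for Z g g'
  proof -
    let ?h = "extension (E n) Z g" and ?h' = "extension (E n) Z g'"
    note i = incl_Hom[OF X E_Ob n]
    note h = extension_closed[OF E_Ob Z g] extension_apply[OF E_Ob Z g]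
    note h' = extension_closed[OF E_Ob Z g'] extension_apply[OF E_Ob Z g']
    have agree: "?h z = ?h' z" if z: "z \<in> U X" for z
      using T_Cmp[OF X E_Ob Z i g z] T_Cmp[OF X E_Ob Z i g' z] eq n z h(2) h'(2)
      by (auto simp: T_incl[OF X E_Ob n z])
    have "\<rho> ?h v = \<rho> ?h' v"
      using fixedD[OF v h(1) h'(1) agree] by (simp add: act_colimit_rep vc h(1) h'(1))
    then have "j Z (on_hom \<Phi> (E n) Z g x) = j Z (on_hom \<Phi> (E n) Z g' x)"
      using \<rho>_j[OF E_Ob Z g x(1) h] \<rho>_j[OF E_Ob Z g' x(1) h'] x(2) by simp
    then show ?thesis
      using inj_onD[OF j_inj[OF Z]] functor_closed[OF \<Phi> E_Ob Z g x(1)] functor_closed[OF \<Phi> E_Ob Z g' x(1)]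
      by blast
  qed
  then have "x \<in> on_hom \<Phi> X (E n) (incl X (E n)) ` P X"
    using desc[unfolded descent_along_inclusions_def, rule_format, OF X E_Ob n x(1)] by blast
  then show "v \<in> j X ` P X" using x(2) j_incl[OF X E_Ob n] by auto
next
  fix v assume "v \<in> j X ` P X" then show "v \<in> fixed colimit_rep X" using j_fixed[OF X] by blast
qed

lemma nat_iso_colimit_rep:
  assumes desc: "descent_along_inclusions \<Phi>"
  shows "nat_iso C (ModCat K) \<Phi> (fixed_functor colimit_rep) (\<lambda>X. \<lambda>x\<in>P X. j X x)"
proof -
  note V = left_module_colimit_rep
  \<comment> \<open>Scalars of the representation act as monomials at the identity, where \<rho> is
    trivial.\<close>
  have smult: "c \<odot>\<^bsub>A.restrict_scalars colimit_rep\<^esub> v = c \<odot>\<^bsub>colim_module\<^esub> v"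
    if "c \<in> carrier K" "v \<in> colim" for c v
    using A.action_module_single[OF left_module_colim is_action_\<rho> that(1), of "\<lambda>x\<in>S. x" v] that id_closed
      is_action_\<rho> by (simp add: A.is_action_def)
  have lin: "(\<lambda>x\<in>P X. j X x) \<in> lin_maps K (on_ob \<Phi> X) (on_ob (fixed_functor colimit_rep) X)" if X: "X \<in> Ob C" for X
    by (rule lin_mapsI)
      (simp_all add: j_fixed[OF X] P_add[OF X] P_smult[OF X] j_lin[OF X] smult j_colim[OF X]
        del: A.restrict_scalars_simps(4) colim_module_simps(2,3))
  have "is_iso (ModCat K) (on_ob \<Phi> X) (on_ob (fixed_functor colimit_rep) X) (\<lambda>x\<in>P X. j X x)" if X: "X \<in> Ob C" for X
  proof (rule is_iso_ModCatI[OF functor_ob_module[OF \<Phi> X] left_module_fixed[OF V] lin[OF X]])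
    show "bij_betw (\<lambda>x\<in>P X. j X x) (P X) (carrier (on_ob (fixed_functor colimit_rep) X))"
      using j_inj[OF X] fixed_colimit_rep[OF desc X] by (auto simp: bij_betw_def inj_on_def)
  qed
  moreover have "compose (P X) (\<lambda>x\<in>P Y. j Y x) (on_hom \<Phi> X Y f) =
      compose (P X) (on_hom (fixed_functor colimit_rep) X Y f) (\<lambda>x\<in>P X. j X x)"
    if X: "X \<in> Ob C" and Y: "Y \<in> Ob C" and f: "f \<in> Hom C X Y" for X Y f
  proof (rule ext)
    fix x
    show "compose (P X) (\<lambda>x\<in>P Y. j Y x) (on_hom \<Phi> X Y f) x =
      compose (P X) (on_hom (fixed_functor colimit_rep) X Y f) (\<lambda>x\<in>P X. j X x) x"
    proof (cases "x \<in> P X")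
      case x: True
      note h = extension_closed[OF X Y f] extension_apply[OF X Y f]
      show ?thesis
        using x fixed_functor_hom[OF V X Y f h j_fixed[OF X x]] act_colimit_rep[OF h(1) j_colim[OF X x]]
          \<rho>_j[OF X Y f x h] functor_closed[OF \<Phi> X Y f x] by (simp add: compose_eq)
    qed (simp add: compose_def)
  qed
  ultimately show ?thesis
    using lin by (simp add: nat_iso_def nat_trans_def)
qed

end

text \<open>\<open>Q\<close> is squeezed between the functors \<open>fixed_functor V\<close> and the
  two conditions, so that one theorem serves for all functors on \<open>C\<close> as well as for
  sheaves.\<close>

theorem UCMod_equivalent_functors:
  fixes Q :: "('o, 'm, ('k, 'a) module, 'a \<Rightarrow> 'a) func \<Rightarrow> bool"
  assumes inf: "infinite (UNIV :: 'a set)"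
    and Q_fixed: "\<And>V. V \<in> Ob (UCMod K S H) \<Longrightarrow> Q (fixed_functor V)"
    and Q: "\<And>\<Phi>. \<lbrakk>is_functor C (ModCat K) \<Phi>; Q \<Phi>\<rbrakk> \<Longrightarrow> injective_on_inclusions \<Phi> \<and> descent_along_inclusions \<Phi>"
  shows "(UCMod K S H :: (('s \<Rightarrow> 's) \<Rightarrow> 'k, 'a) mod_category) \<simeq>\<^sub>c\<^sub>a\<^sub>t
    full_subcat (functor_cat C (ModCat K :: ('k, 'a) mod_category)) Q"
proof (rule equivalence_if_fully_faithful_essentially_surjective[OF category_UCMod])
  let ?D = "full_subcat (functor_cat C (ModCat K :: ('k, 'a) mod_category)) Q"
  show "category ?D"
    by (intro category_full_subcat category_functor_cat category category_ModCat)
  show "is_functor (UCMod K S H) ?D fixed_func"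
    by (rule is_functor_full_subcat[OF is_functor_fixed_func]) (simp add: fixed_func_def Q_fixed)
  show "fully_faithful (UCMod K S H) ?D fixed_func"
    by (rule fully_faithful_full_subcat[OF fully_faithful_fixed_func])
  show "essentially_surjective (UCMod K S H) ?D fixed_func"
    unfolding essentially_surjective_def
  proof
    fix \<Phi> assume "\<Phi> \<in> Ob ?D"
    then have F: "is_functor C (ModCat K) \<Phi>" and "Q \<Phi>" by simp_all
    note q = Q[OF this, THEN conjunct1] Q[OF this, THEN conjunct2]
    let ?V = "colimit_rep \<Phi>"
    have V: "?V \<in> Ob (UCMod K S H)"
      using left_module_colimit_rep[OF F q(1) inf] uniformly_continuous_colimit_rep[OF F q(1) inf] by simp
    have "is_iso (functor_cat C (ModCat K)) \<Phi> (fixed_functor ?V) (\<lambda>X\<in>Ob C. \<lambda>x\<in>carrier (on_ob \<Phi> X). j \<Phi> X x)"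
      using is_iso_functor_catI[OF category category_ModCat F
          is_functor_fixed_functor[OF left_module_colimit_rep[OF F q(1) inf]] nat_iso_colimit_rep[OF F q(1) inf q(2)]] .
    from is_iso_inverse[OF this] V
    show "\<exists>V\<in>Ob (UCMod K S H). \<exists>e. is_iso ?D (on_ob fixed_func V) \<Phi> e"
      by (auto simp: fixed_func_def)
  qed
qed

end

section \<open>Split inclusions and atomic sheaves\<close>

lemma opposite_simps [simp]:
  "Ob (opposite C) = Ob C" "Hom (opposite C) X Y = Hom C Y X" "Idt (opposite C) = Idt C"
  "Cmp (opposite C) X Y Z g f = Cmp C Z Y X f g"
  by (simp_all add: opposite_def)

lemma opposite_opposite [simp]: "opposite (opposite C) = C"
  by (cases C) (simp add: opposite_def)

lemma full_subcat_True [simp]: "full_subcat C (\<lambda>_. True) = C"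
  by (simp add: full_subcat_def)

context finite_subset_category
begin

text \<open>A retraction \<open>r\<close> of the inclusion \<open>i\<close> makes the image of
  \<open>i\<close> under \<Phi> injective. The idempotent \<open>i r\<close> agrees with the
  identity on \<open>X\<close>, so a vector equalised by such pairs is the image under
  \<open>i\<close> of its image under \<open>r\<close>.\<close>

lemma split_inclusions:
  assumes F: "is_functor C (ModCat K) \<Phi>"
    and split: "\<And>X Y. \<lbrakk>X \<in> Ob C; Y \<in> Ob C; U X \<subseteq> U Y\<rbrakk> \<Longrightarrow> \<exists>r\<in>Hom C Y X. Cmp C X Y X r (incl X Y) = Idt C X"
  shows "injective_on_inclusions \<Phi> \<and> descent_along_inclusions \<Phi>"
  unfolding injective_on_inclusions_def descent_along_inclusions_def
proof (intro conjI ballI impI)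
  fix X Y assume XY: "X \<in> Ob C" "Y \<in> Ob C" "U X \<subseteq> U Y"
  note i = incl_Hom[OF XY]
  obtain r where r: "r \<in> Hom C Y X" "Cmp C X Y X r (incl X Y) = Idt C X" using split[OF XY] by blast
  show "inj_on (on_hom \<Phi> X Y (incl X Y)) (carrier (on_ob \<Phi> X))"
  proof (rule inj_on_inverseI)
    fix x assume x: "x \<in> carrier (on_ob \<Phi> X)"
    show "on_hom \<Phi> Y X r (on_hom \<Phi> X Y (incl X Y) x) = x"
      using functor_Cmp_apply[OF F XY(1,2,1) i r(1) x] functor_Idt_apply[OF F XY(1) x] r(2) by simp
  qed
  fix y assume y: "y \<in> carrier (on_ob \<Phi> Y)"
    and desc: "\<forall>Z\<in>Ob C. \<forall>g\<in>Hom C Y Z. \<forall>g'\<in>Hom C Y Z.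
      Cmp C X Y Z g (incl X Y) = Cmp C X Y Z g' (incl X Y) \<longrightarrow> on_hom \<Phi> Y Z g y = on_hom \<Phi> Y Z g' y"
  let ?p = "Cmp C Y X Y (incl X Y) r"
  have p: "?p \<in> Hom C Y Y" using Cmp_in_Hom[OF category XY(2,1,2) r(1) i] .
  have "Cmp C X Y Y ?p (incl X Y) = Cmp C X X Y (incl X Y) (Cmp C X Y X r (incl X Y))"
    by (rule Cmp_assoc[OF category XY(1,2,1,2) i r(1) i])
  also have "\<dots> = Cmp C X Y Y (Idt C Y) (incl X Y)"
    using r(2) Cmp_Idt_left[OF category XY(1,2) i] Cmp_Idt_right[OF category XY(1,2) i] by simp
  finally have "on_hom \<Phi> Y Y ?p y = on_hom \<Phi> Y Y (Idt C Y) y"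
    using desc XY(2) p Idt_in_Hom[OF category XY(2)] by blast
  then have "on_hom \<Phi> X Y (incl X Y) (on_hom \<Phi> Y X r y) = y"
    using functor_Cmp_apply[OF F XY(2,1,2) r(1) i y] functor_Idt_apply[OF F XY(2) y] by simp
  then show "y \<in> on_hom \<Phi> X Y (incl X Y) ` carrier (on_ob \<Phi> X)"
    using functor_closed[OF F XY(2,1) r(1) y] by (metis imageI)
qed

section \<open>Sheaves for the atomic topology as functors on \<open>C\<close>\<close>

abbreviation atomic_sheaf :: "('o, 'm, ('k, 'a) module, 'a \<Rightarrow> 'a) func \<Rightarrow> bool" where
  "atomic_sheaf \<equiv> is_sheaf (opposite C) (atomic_topology (opposite C))"

text \<open>A cosieve in \<open>C\<close>: the morphisms out of \<open>X\<close> that factor through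
  \<open>f\<close>. In \<open>opposite C\<close> it is the sieve generated by
  \<open>f\<close>.\<close>

definition principal_sieve :: "'o \<Rightarrow> 'o \<Rightarrow> 'm \<Rightarrow> ('o \<times> 'm) set" where
  "principal_sieve X Y f = {(Z, Cmp C X Y Z g f) | Z g. Z \<in> Ob C \<and> g \<in> Hom C Y Z}"

lemma principal_sieve_atomic:
  assumes "X \<in> Ob C" "Y \<in> Ob C" "f \<in> Hom C X Y"
  shows "principal_sieve X Y f \<in> atomic_topology (opposite C) X"
proof -
  have "(Y, Cmp C X Y Y (Idt C Y) f) \<in> principal_sieve X Y f"
    using assms Idt_in_Hom[OF category] by (auto simp: principal_sieve_def)
  moreover have "(W, Cmp C X Z W h (Cmp C X Y Z g f)) \<in> principal_sieve X Y f"
    if "Z \<in> Ob C" "g \<in> Hom C Y Z" "W \<in> Ob C" "h \<in> Hom C Z W" for Z g W h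
    using Cmp_assoc[OF category assms(1,2) that(1,3) assms(3) that(2,4)]
      Cmp_in_Hom[OF category assms(2) that(1,3,2,4)] that unfolding principal_sieve_def by force
  ultimately show ?thesis
    using assms Cmp_in_Hom[OF category assms(1,2) _ assms(3)]
    by (auto simp: atomic_topology_def sieve_def) (auto simp: principal_sieve_def)
qed

lemma atomic_sheaf_ex1:
  assumes "atomic_sheaf \<Phi>" "X \<in> Ob C" "R \<in> atomic_topology (opposite C) X" "matching_family (opposite C) \<Phi> X R x"
  shows "\<exists>!s. s \<in> carrier (on_ob \<Phi> X) \<and> (\<forall>(Y, f)\<in>R. on_hom \<Phi> X Y f s = x Y f)"
proof -
  have "X \<in> Ob (opposite C)" using assms(2) by simp
  from assms(1)[unfolded is_sheaf_def, THEN bspec, OF this, THEN bspec, OF assms(3), THEN spec, of x] assms(4)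
  show ?thesis by blast
qed

text \<open>Apply the sheaf condition to the sieve generated by an inclusion: uniqueness of the
  amalgamation gives injectivity, its existence gives descent.\<close>

lemma atomic_sheaf_conditions:
  assumes F: "is_functor C (ModCat K) \<Phi>" and sheaf: "atomic_sheaf \<Phi>"
  shows "injective_on_inclusions \<Phi> \<and> descent_along_inclusions \<Phi>"
  unfolding injective_on_inclusions_def descent_along_inclusions_def
proof (intro conjI ballI impI)
  fix X Y assume XY: "X \<in> Ob C" "Y \<in> Ob C" "U X \<subseteq> U Y"
  note i = incl_Hom[OF XY]
  let ?S = "principal_sieve X Y (incl X Y)"
  note S = principal_sieve_atomic[OF XY(1,2) i]
  show "inj_on (on_hom \<Phi> X Y (incl X Y)) (carrier (on_ob \<Phi> X))"
  proof (rule inj_onI)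
    fix s s' assume s: "s \<in> carrier (on_ob \<Phi> X)" "s' \<in> carrier (on_ob \<Phi> X)"
      and eq: "on_hom \<Phi> X Y (incl X Y) s = on_hom \<Phi> X Y (incl X Y) s'"
    \<comment> \<open>\<open>s\<close> and \<open>s'\<close> both amalgamate this family, since
      every member of the sieve factors through the inclusion, where they agree.\<close>
    let ?x = "\<lambda>Z k. on_hom \<Phi> X Z k s"
    have m: "matching_family (opposite C) \<Phi> X ?S ?x"
      unfolding matching_family_def
    proof (clarify, intro conjI ballI)
      fix Z k assume "(Z, k) \<in> ?S"
      then have Z: "Z \<in> Ob C" and k: "k \<in> Hom C X Z"
        using Cmp_in_Hom[OF category XY(1,2) _ i] by (auto simp: principal_sieve_def)
      show "on_hom \<Phi> X Z k s \<in> carrier (on_ob \<Phi> Z)" by (rule functor_closed[OF F XY(1) Z k s(1)])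
      fix W g assume "W \<in> Ob (opposite C)" "g \<in> Hom (opposite C) W Z"
      then show "on_hom \<Phi> Z W g (on_hom \<Phi> X Z k s) = on_hom \<Phi> X W (Cmp (opposite C) W Z X k g) s"
        using functor_Cmp_apply[OF F XY(1) Z _ k _ s(1)] by simp
    qed
    have s': "on_hom \<Phi> X Z k s' = on_hom \<Phi> X Z k s" if Zk: "(Z, k) \<in> ?S" for Z k
    proof -
      obtain g where g: "Z \<in> Ob C" "g \<in> Hom C Y Z" "k = Cmp C X Y Z g (incl X Y)"
        using Zk by (auto simp: principal_sieve_def)
      show ?thesis
        unfolding g(3) functor_Cmp_apply[OF F XY(1,2) g(1) i g(2) s(1)] functor_Cmp_apply[OF F XY(1,2) g(1) i g(2) s(2)] eq ..
    qed
    note ex1 = atomic_sheaf_ex1[OF sheaf XY(1) S m]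
    show "s = s'"
      by (rule Uniq_D[OF conjunct2[OF iffD1[OF ex1_iff_ex_Uniq ex1]]]) (use s s' in auto)
  qed
  fix y assume y: "y \<in> carrier (on_ob \<Phi> Y)"
    and desc: "\<forall>Z\<in>Ob C. \<forall>g\<in>Hom C Y Z. \<forall>g'\<in>Hom C Y Z.
      Cmp C X Y Z g (incl X Y) = Cmp C X Y Z g' (incl X Y) \<longrightarrow> on_hom \<Phi> Y Z g y = on_hom \<Phi> Y Z g' y"
  \<comment> \<open>The member \<open>g\<close> after the inclusion receives the value
    \<open>on_hom \<Phi> Y Z g y\<close>; by \<open>desc\<close> the factor \<open>g\<close> chosen
    for it does not matter.\<close>
  define x where "x Z k = on_hom \<Phi> Y Z (SOME g. g \<in> Hom C Y Z \<and> k = Cmp C X Y Z g (incl X Y)) y" for Z k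
  have x: "x Z (Cmp C X Y Z g (incl X Y)) = on_hom \<Phi> Y Z g y" if g: "Z \<in> Ob C" "g \<in> Hom C Y Z" for Z g
  proof -
    have some: "(SOME g'. g' \<in> Hom C Y Z \<and> Cmp C X Y Z g (incl X Y) = Cmp C X Y Z g' (incl X Y)) \<in> Hom C Y Z \<and>
      Cmp C X Y Z g (incl X Y) =
      Cmp C X Y Z (SOME g'. g' \<in> Hom C Y Z \<and> Cmp C X Y Z g (incl X Y) = Cmp C X Y Z g' (incl X Y)) (incl X Y)"
      by (rule someI[of _ g]) (simp add: g)
    show ?thesis
      unfolding x_def
      by (rule desc[rule_format, OF g(1) conjunct1[OF some] g(2) conjunct2[OF some, symmetric]])
  qed
  have "matching_family (opposite C) \<Phi> X ?S x"
    unfolding matching_family_def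
  proof (clarify, intro conjI ballI)
    fix Z k assume "(Z, k) \<in> ?S"
    then obtain g where g: "Z \<in> Ob C" "g \<in> Hom C Y Z" "k = Cmp C X Y Z g (incl X Y)"
      by (auto simp: principal_sieve_def)
    show "x Z k \<in> carrier (on_ob \<Phi> Z)" using x[OF g(1,2)] g(3) functor_closed[OF F XY(2) g(1,2) y] by simp
    fix W h assume W: "W \<in> Ob (opposite C)" and h: "h \<in> Hom (opposite C) W Z"
    then have W: "W \<in> Ob C" and h: "h \<in> Hom C Z W" by simp_all
    have "x W (Cmp C X Z W h k) = x W (Cmp C X Y W (Cmp C Y Z W h g) (incl X Y))"
      using Cmp_assoc[OF category XY(1,2) g(1) W i g(2) h] g(3) by simp
    also have "\<dots> = on_hom \<Phi> Z W h (on_hom \<Phi> Y Z g y)"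
      using x[OF W Cmp_in_Hom[OF category XY(2) g(1) W g(2) h]] functor_Cmp_apply[OF F XY(2) g(1) W g(2) h y] by simp
    finally show "on_hom \<Phi> Z W h (x Z k) = x W (Cmp (opposite C) W Z X k h)"
      using x[OF g(1,2)] g(3) by simp
  qed
  from atomic_sheaf_ex1[OF sheaf XY(1) S this]
  obtain s where s: "s \<in> carrier (on_ob \<Phi> X)" "\<forall>(Z, k)\<in>?S. on_hom \<Phi> X Z k s = x Z k" by (elim ex1E conjE)
  \<comment> \<open>The inclusion itself lies in the sieve, and there the amalgamation
    \<open>s\<close> takes the value \<open>y\<close>.\<close>
  have "(Y, Cmp C X Y Y (Idt C Y) (incl X Y)) \<in> ?S"
    using XY(2) Idt_in_Hom[OF category] by (auto simp: principal_sieve_def)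
  then have "on_hom \<Phi> X Y (Cmp C X Y Y (Idt C Y) (incl X Y)) s = x Y (Cmp C X Y Y (Idt C Y) (incl X Y))"
    using s(2) by blast
  then have "on_hom \<Phi> X Y (incl X Y) s = y"
    using x[OF XY(2) Idt_in_Hom[OF category XY(2)]] functor_Idt_apply[OF F XY(2) y]
      Cmp_Idt_left[OF category XY(1,2) i] by simp
  then show "y \<in> on_hom \<Phi> X Y (incl X Y) ` carrier (on_ob \<Phi> X)" using s(1) by blast
qed

text \<open>As elements of \<open>H\<close> are invertible, a section can be recovered from its
  value at one member \<open>f\<close> of the sieve by undoing an extension \<open>h\<close> of
  \<open>f\<close>. The work is to show that the result is fixed at \<open>X\<close> and restricts
  correctly along every other member.\<close>

lemma atomic_sheaf_fixed_functor:
  assumes iv: "\<And>h. h \<in> H \<Longrightarrow> \<exists>g\<in>H. compose S g h = (\<lambda>x\<in>S. x) \<and> compose S h g = (\<lambda>x\<in>S. x)"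
    and V: "left_module A.KM V"
  shows "atomic_sheaf (fixed_functor V)"
proof -
  define iv where "iv h = (SOME g. g \<in> H \<and> compose S g h = (\<lambda>x\<in>S. x) \<and> compose S h g = (\<lambda>x\<in>S. x))" for h
  have iv: "iv h \<in> H" "compose S (iv h) h = (\<lambda>x\<in>S. x)" "compose S h (iv h) = (\<lambda>x\<in>S. x)" if "h \<in> H" for h
  proof -
    have "\<exists>g. g \<in> H \<and> compose S g h = (\<lambda>x\<in>S. x) \<and> compose S h g = (\<lambda>x\<in>S. x)"
      using assms(1)[OF that] by blast
    from someI_ex[OF this, folded iv_def]
    show "iv h \<in> H" "compose S (iv h) h = (\<lambda>x\<in>S. x)" "compose S h (iv h) = (\<lambda>x\<in>S. x)" by auto
  qed
  have inv_apply: "iv h (h x) = x" if "h \<in> H" "x \<in> S" for h x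
    using fun_cong[OF iv(2)[OF that(1)], of x] that by (simp add: compose_eq)
  have act_inv: "A.act V (iv h) (A.act V h v) = v" "A.act V h (A.act V (iv h) v) = v"
    if "h \<in> H" "v \<in> carrier V" for h v
    using act_compose[OF V iv(1)[OF that(1)] that] act_compose[OF V that(1) iv(1)[OF that(1)] that(2)]
      act_id[OF V that(2)] iv(2,3)[OF that(1)] by simp_all
  \<comment> \<open>All morphisms act injectively, being restrictions of invertible operators on
    \<open>V\<close>.\<close>
  have hom_inj: "v = w"
    if "X \<in> Ob C" "Y \<in> Ob C" "f \<in> Hom C X Y" "v \<in> fixed V X" "w \<in> fixed V X"
      "on_hom (fixed_functor V) X Y f v = on_hom (fixed_functor V) X Y f w" for X Y f v w
  proof -
    have "A.act V (extension X Y f) v = A.act V (extension X Y f) w"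
      using that(4-6) by (simp add: fixed_functor_def)
    then show ?thesis
      using act_inv(1)[OF extension_closed[OF that(1-3)] fixed_carrier[OF that(4)]]
        act_inv(1)[OF extension_closed[OF that(1-3)] fixed_carrier[OF that(5)]] by metis
  qed
  note F = is_functor_fixed_functor[OF V]
  show ?thesis
    unfolding is_sheaf_def
  proof (intro ballI allI impI)
    fix X R x
    assume "X \<in> Ob (opposite C)" and R: "R \<in> atomic_topology (opposite C) X"
      and "matching_family (opposite C) (fixed_functor V) X R x"
    then have X: "X \<in> Ob C" and M: "\<forall>(Y, f)\<in>R. x Y f \<in> fixed V Y \<and> (\<forall>Z\<in>Ob C. \<forall>g\<in>Hom C Y Z.
        on_hom (fixed_functor V) Y Z g (x Y f) = x Z (Cmp C X Y Z g f))"
      unfolding matching_family_def by simp_all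
    have m1: "x Y f \<in> fixed V Y" if "(Y, f) \<in> R" for Y f
      using bspec[OF M that] by simp
    have m2: "on_hom (fixed_functor V) Y Z g (x Y f) = x Z (Cmp C X Y Z g f)"
      if "(Y, f) \<in> R" "Z \<in> Ob C" "g \<in> Hom C Y Z" for Y f Z g
      using bspec[OF M that(1)] that(2,3) by simp
    have R': "\<And>Y f. (Y, f) \<in> R \<Longrightarrow> Y \<in> Ob C \<and> f \<in> Hom C X Y" "R \<noteq> {}"
      using R by (auto simp: atomic_topology_def sieve_def)
    obtain Y f where Yf: "(Y, f) \<in> R" using R'(2) by fast
    then have Y: "Y \<in> Ob C" and f: "f \<in> Hom C X Y" using R'(1) by auto
    define h where "h = extension X Y f"
    have h: "h \<in> H" "\<And>z. z \<in> U X \<Longrightarrow> h z = T X Y f z"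
      using extension_closed[OF X Y f] extension_apply[OF X Y f] by (simp_all add: h_def)
    define s where "s = A.act V (iv h) (x Y f)"
    note y = m1[OF Yf]
    \<comment> \<open>If \<open>a\<close> and \<open>a'\<close> agree on \<open>U X\<close>, then \<open>a \<circ> h\<^sup>-\<^sup>1\<close> and \<open>a' \<circ> h\<^sup>-\<^sup>1\<close> become equal after composition with \<open>f\<close>.\<close>
    have s: "s \<in> fixed V X"
    proof (rule fixedI)
      show "s \<in> carrier V"
        using A.act_closed[OF V] iv(1)[OF h(1)] fixed_carrier[OF y] by (simp add: s_def)
      fix a a' assume a: "a \<in> H" "a' \<in> H" and eq: "\<And>z. z \<in> U X \<Longrightarrow> a z = a' z"
      let ?b = "compose S a (iv h)" and ?b' = "compose S a' (iv h)"
      have b: "?b \<in> H" "?b' \<in> H" using a iv(1)[OF h(1)] by (simp_all add: compose_closed)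
      have "finite (?b ` U Y \<union> ?b' ` U Y)" "?b ` U Y \<union> ?b' ` U Y \<subseteq> S"
        using U_finite[OF Y] U_subset[OF Y] H_closed[OF b(1)] H_closed[OF b(2)] by auto
      then obtain n where n: "?b ` U Y \<union> ?b' ` U Y \<subseteq> U (E n)" by (rule finite_subset_E)
      then have n: "?b ` U Y \<subseteq> U (E n)" "?b' ` U Y \<subseteq> U (E n)" by simp_all
      let ?g = "restriction ?b Y (E n)" and ?g' = "restriction ?b' Y (E n)"
      note g = restriction_Hom[OF Y E_Ob b(1) n(1)] T_restriction[OF Y E_Ob b(1) n(1)]
      note g' = restriction_Hom[OF Y E_Ob b(2) n(2)] T_restriction[OF Y E_Ob b(2) n(2)]
      have "Cmp C X Y (E n) ?g f = Cmp C X Y (E n) ?g' f"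
      proof (rule T_faithful[OF X E_Ob])
        fix z assume z: "z \<in> U X"
        then have zS: "z \<in> S" using U_subset[OF X] by blast
        have fz: "T X Y f z \<in> U Y" using T_closed[OF X Y f z] .
        have "?b (h z) = a z" "?b' (h z) = a' z"
          using H_closed[OF h(1) zS] inv_apply[OF h(1) zS] by (simp_all add: compose_eq)
        then show "T X (E n) (Cmp C X Y (E n) ?g f) z = T X (E n) (Cmp C X Y (E n) ?g' f) z"
          using T_Cmp[OF X Y E_Ob f g(1) z] T_Cmp[OF X Y E_Ob f g'(1) z] g(2)[OF fz] g'(2)[OF fz] h(2)[OF z] eq[OF z]
          by simp
      qed (use Cmp_in_Hom[OF category X Y E_Ob f g(1)] Cmp_in_Hom[OF category X Y E_Ob f g'(1)] in auto)
      then have "on_hom (fixed_functor V) Y (E n) ?g (x Y f) = on_hom (fixed_functor V) Y (E n) ?g' (x Y f)"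
        using m2[OF Yf E_Ob g(1)] m2[OF Yf E_Ob g'(1)] by simp
      then have "A.act V ?b (x Y f) = A.act V ?b' (x Y f)"
        using fixed_functor_hom[OF V Y E_Ob g(1) b(1) g(2)[symmetric] y]
          fixed_functor_hom[OF V Y E_Ob g'(1) b(2) g'(2)[symmetric] y] by metis
      then show "A.act V a s = A.act V a' s"
        using act_compose[OF V a(1) iv(1)[OF h(1)] fixed_carrier[OF y]]
          act_compose[OF V a(2) iv(1)[OF h(1)] fixed_carrier[OF y]] by (simp add: s_def)
    qed
    have sf: "on_hom (fixed_functor V) X Y f s = x Y f"
      using fixed_functor_hom[OF V X Y f h s] act_inv(2)[OF h(1) fixed_carrier[OF y]] by (simp add: s_def)
    have all: "on_hom (fixed_functor V) X Y' f' s = x Y' f'" if Yf': "(Y', f') \<in> R" for Y' f'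
    proof -
      have Y': "Y' \<in> Ob C" and f': "f' \<in> Hom C X Y'" using R'(1)[OF Yf'] by auto
      let ?h' = "extension X Y' f'"
      note h' = extension_closed[OF X Y' f'] extension_apply[OF X Y' f']
      let ?b = "iv h" and ?b' = "iv ?h'"
      have b: "?b \<in> H" "?b' \<in> H" using iv(1) h(1) h'(1) by auto
      have "finite (?b ` U Y \<union> ?b' ` U Y')" "?b ` U Y \<union> ?b' ` U Y' \<subseteq> S"
        using U_finite[OF Y] U_subset[OF Y] U_finite[OF Y'] U_subset[OF Y'] H_closed[OF b(1)] H_closed[OF b(2)] by auto
      then obtain n where n: "?b ` U Y \<union> ?b' ` U Y' \<subseteq> U (E n)" by (rule finite_subset_E)
      then have n: "?b ` U Y \<subseteq> U (E n)" "?b' ` U Y' \<subseteq> U (E n)" by simp_all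
      let ?g = "restriction ?b Y (E n)" and ?g' = "restriction ?b' Y' (E n)"
      note g = restriction_Hom[OF Y E_Ob b(1) n(1)] T_restriction[OF Y E_Ob b(1) n(1)]
      note g' = restriction_Hom[OF Y' E_Ob b(2) n(2)] T_restriction[OF Y' E_Ob b(2) n(2)]
      \<comment> \<open>Undoing the extensions turns \<open>f\<close> and \<open>f'\<close> into the
        same morphism, the inclusion of \<open>X\<close> into \<open>E n\<close>. There the matching
        condition compares the two values, and \<open>hom_inj\<close> then cancels
        \<open>?g'\<close>.\<close>
      have c: "Cmp C X Y (E n) ?g f = Cmp C X Y' (E n) ?g' f'"
      proof (rule T_faithful[OF X E_Ob])
        fix z assume z: "z \<in> U X"
        then have zS: "z \<in> S" using U_subset[OF X] by blast
        show "T X (E n) (Cmp C X Y (E n) ?g f) z = T X (E n) (Cmp C X Y' (E n) ?g' f') z"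
          using T_Cmp[OF X Y E_Ob f g(1) z] T_Cmp[OF X Y' E_Ob f' g'(1) z]
            g(2)[OF T_closed[OF X Y f z]] g'(2)[OF T_closed[OF X Y' f' z]] h(2)[OF z] h'(2)[OF z]
            inv_apply[OF h(1) zS] inv_apply[OF h'(1) zS] by simp
      qed (use Cmp_in_Hom[OF category X Y E_Ob f g(1)] Cmp_in_Hom[OF category X Y' E_Ob f' g'(1)] in auto)
      have sX: "s \<in> carrier (on_ob (fixed_functor V) X)" using s by simp
      have "on_hom (fixed_functor V) Y' (E n) ?g' (on_hom (fixed_functor V) X Y' f' s) =
          on_hom (fixed_functor V) Y (E n) ?g (x Y f)"
        using functor_Cmp_apply[OF F X Y' E_Ob f' g'(1) sX] functor_Cmp_apply[OF F X Y E_Ob f g(1) sX] c sf by simp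
      also have "\<dots> = on_hom (fixed_functor V) Y' (E n) ?g' (x Y' f')"
        using m2[OF Yf E_Ob g(1)] m2[OF Yf' E_Ob g'(1)] c by simp
      finally show ?thesis
        using hom_inj[OF Y' E_Ob g'(1) _ m1[OF Yf']] functor_closed[OF F X Y' f' sX] by simp
    qed
    show "\<exists>!s. s \<in> carrier (on_ob (fixed_functor V) X) \<and> (\<forall>(Y, f)\<in>R. on_hom (fixed_functor V) X Y f s = x Y f)"
    proof (rule ex1I[of _ s])
      show "s \<in> carrier (on_ob (fixed_functor V) X) \<and> (\<forall>(Y, f)\<in>R. on_hom (fixed_functor V) X Y f s = x Y f)"
        using s all by auto
      fix s' assume "s' \<in> carrier (on_ob (fixed_functor V) X) \<and> (\<forall>(Y, f)\<in>R. on_hom (fixed_functor V) X Y f s' = x Y f)"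
      then have "s' \<in> fixed V X" "on_hom (fixed_functor V) X Y f s' = x Y f" using Yf by auto
      then show "s' = s" using hom_inj[OF X Y f _ s] sf by simp
    qed
  qed
qed

end

section \<open>Finite dimensional spaces over a finite field\<close>

lemma lin_maps_inj_onI:
  assumes M: "left_module R M" and N: "left_module R N" and f: "f \<in> lin_maps R M N"
    and ker: "\<And>x. \<lbrakk>x \<in> carrier M; f x = \<zero>\<^bsub>N\<^esub>\<rbrakk> \<Longrightarrow> x = \<zero>\<^bsub>M\<^esub>"
  shows "inj_on f (carrier M)"
proof (rule inj_onI)
  interpret M: left_module R M by fact
  interpret N: left_module R N by fact
  fix x y assume x: "x \<in> carrier M" and y: "y \<in> carrier M" and eq: "f x = f y"
  let ?z = "\<ominus>\<^bsub>M\<^esub> y"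
  have "f (?z \<oplus>\<^bsub>M\<^esub> x) = f (?z \<oplus>\<^bsub>M\<^esub> y)" using x y eq by (simp add: lin_maps_add[OF f])
  then have "f (?z \<oplus>\<^bsub>M\<^esub> x) = \<zero>\<^bsub>N\<^esub>" using y lin_maps_zero[OF M N f] by (simp add: M.M.l_neg)
  then have "?z \<oplus>\<^bsub>M\<^esub> x = ?z \<oplus>\<^bsub>M\<^esub> y" using ker x y by (simp add: M.M.l_neg)
  then show "x = y" using x y by simp
qed

text \<open>Transport of structure along an injection; it moves a copy of F^n onto the type that
  carries the objects of \<open>VA F\<close>.\<close>

lemma left_module_transport:
  fixes e :: "'b \<Rightarrow> 'a"
  assumes M: "left_module R M" and e: "inj_on e (carrier M)"
  shows "\<exists>N :: (_, 'a) module. left_module R N \<and> carrier N = e ` carrier M \<and> restrict e (carrier M) \<in> lin_maps R M N"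
proof -
  interpret M: left_module R M by fact
  define d where "d = inv_into (carrier M) e"
  have d: "d (e x) = x" if "x \<in> carrier M" for x using e that by (simp add: d_def)
  define N :: "(_, 'a) module" where "N = \<lparr>carrier = e ` carrier M, mult = undefined, one = undefined,
    zero = e \<zero>\<^bsub>M\<^esub>, add = (\<lambda>x y. e (d x \<oplus>\<^bsub>M\<^esub> d y)), smult = (\<lambda>c x. e (c \<odot>\<^bsub>M\<^esub> d x))\<rparr>"
  have "abelian_group N"
  proof (rule abelian_groupI)
    fix y assume "y \<in> carrier N"
    then obtain x where x: "x \<in> carrier M" "y = e x" by (auto simp: N_def)
    then show "\<exists>z\<in>carrier N. z \<oplus>\<^bsub>N\<^esub> y = \<zero>\<^bsub>N\<^esub>"
      by (intro bexI[of _ "e (\<ominus>\<^bsub>M\<^esub> x)"]) (simp_all add: N_def d M.M.l_neg)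
  qed (auto simp: N_def d M.M.a_ac)
  then have "left_module R N"
    by (intro left_module.intro left_module_axioms.intro M.R.ring_axioms)
      (auto simp: N_def d M.smult_closed M.smult_l_distr M.smult_r_distr M.smult_assoc1 M.smult_one)
  moreover have "restrict e (carrier M) \<in> lin_maps R M N"
    by (rule lin_mapsI) (auto simp: N_def d M.smult_closed)
  ultimately show ?thesis by (intro exI[of _ N]) (simp add: N_def)
qed

locale finite_scalars = field F for F :: "('f, 'x) ring_scheme" (structure) +
  assumes finite_carrier: "finite (carrier F)"
begin

text \<open>Over a finite field, finite dimension means finite carrier: a finite set has finitely
  many linear combinations, and a finite space is spanned by its own carrier. Bases are thereby
  avoided.\<close>

lemma Ob_VA: "Ob (VA F) = {V. left_module F V \<and> finite (carrier V)}"
proof -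
  have "vectorspace F V \<and> vectorspace.fin_dim F V \<longleftrightarrow> finite (carrier V)" if "left_module F V" for V :: "('f, 'a) module"
  proof -
    interpret V: module F V using that left_module_iff_module[OF is_cring] by blast
    interpret V: vectorspace F V by unfold_locales
    have "V.fin_dim \<longleftrightarrow> finite (carrier V)"
    proof
      assume "V.fin_dim"
      then obtain A where A: "finite A" "A \<subseteq> carrier V" "V.span A = carrier V" by (auto simp: V.fin_dim_def)
      have "V.span A \<subseteq> (\<lambda>a. V.lincomb a A) ` (A \<rightarrow>\<^sub>E carrier F)"
      proof
        fix v assume "v \<in> V.span A"
        then obtain a where a: "a \<in> A \<rightarrow> carrier F" "v = V.lincomb a A"
          using V.finite_span[OF A(1,2)] by auto
        \<comment> \<open>Only the coefficients on \<open>A\<close> matter; normalised off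
          \<open>A\<close>, there are finitely many coefficient functions.\<close>
        have "V.lincomb a A = V.lincomb (restrict a A) A"
          unfolding V.lincomb_def using a A(2) by (intro V.M.finsum_cong') (auto intro!: V.smult_closed)
        then show "v \<in> (\<lambda>a. V.lincomb a A) ` (A \<rightarrow>\<^sub>E carrier F)"
          using a by (intro image_eqI[of _ _ "restrict a A"]) auto
      qed
      then have "finite (V.span A)"
        by (rule finite_subset) (intro finite_imageI finite_PiE A(1) finite_carrier)
      then show "finite (carrier V)" using A by simp
    next
      assume fin: "finite (carrier V)"
      have "V.span (carrier V) = carrier V"
        using V.in_own_span[of "carrier V"] V.span_is_subset2[of "carrier V"] by auto
      then show "V.fin_dim" using fin by (auto simp: V.fin_dim_def)
    qed
    then show ?thesis using V.vectorspace_axioms by simp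
  qed
  then show ?thesis by (auto simp: VA_def)
qed

lemma VA_simps [simp]:
  "Hom (VA F) = lin_maps F" "Idt (VA F) V = (\<lambda>x\<in>carrier V. x)" "Cmp (VA F) U V W g f = compose (carrier U) g f"
  by (simp_all add: VA_def)

lemma category_VA: "category (VA F)"
  unfolding VA_def by (intro category_full_subcat category_ModCat)

lemma VI_simps [simp]:
  "Ob (VI F) = Ob (VA F)" "Hom (VI F) V W = {f \<in> lin_maps F V W. inj_on f (carrier V)}"
  "Idt (VI F) V = (\<lambda>x\<in>carrier V. x)" "Cmp (VI F) U V W g f = compose (carrier U) g f"
  by (simp_all add: VI_def)

lemma inj_on_compose:
  assumes "f \<in> lin_maps F U V" "inj_on f (carrier U)" "inj_on g (carrier V)"
  shows "inj_on (compose (carrier U) g f) (carrier U)"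
proof (rule inj_onI)
  fix x y assume xy: "x \<in> carrier U" "y \<in> carrier U"
    and "compose (carrier U) g f x = compose (carrier U) g f y"
  then have "g (f x) = g (f y)" by (simp add: compose_eq)
  then have "f x = f y"
    using inj_onD[OF assms(3)] lin_maps_closed[OF assms(1)] xy by blast
  then show "x = y" using inj_onD[OF assms(2)] xy by blast
qed

lemma category_VI: "category (VI F)"
  unfolding VI_def by (rule category_wide_subcat[OF category_VA]) (auto simp: inj_on_compose)

lemma finite_support_iff: "finite {i. x i \<noteq> \<zero>} \<longleftrightarrow> (\<exists>m::nat. \<forall>i\<ge>m. x i = \<zero>)"
  by (auto simp: finite_nat_set_iff_bounded) (meson leD not_less)+

lemma \<Omega>_iff: "x \<in> carrier (\<Omega> F) \<longleftrightarrow> (\<forall>i. x i \<in> carrier F) \<and> (\<exists>m. \<forall>i\<ge>m. x i = \<zero>)"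
  by (auto simp: \<Omega>_def finite_support_iff)

lemma \<Omega>_I: "\<lbrakk>\<And>i. x i \<in> carrier F; \<And>i. i \<ge> m \<Longrightarrow> x i = \<zero>\<rbrakk> \<Longrightarrow> x \<in> carrier (\<Omega> F)"
  by (auto simp: \<Omega>_iff)

lemma \<Omega>_simps [simp]:
  "(x \<oplus>\<^bsub>\<Omega> F\<^esub> y) i = x i \<oplus> y i" "\<zero>\<^bsub>\<Omega> F\<^esub> i = \<zero>" "(c \<odot>\<^bsub>\<Omega> F\<^esub> x) i = c \<otimes> x i"
  by (simp_all add: \<Omega>_def)

lemma \<Omega>_coeff: "x \<in> carrier (\<Omega> F) \<Longrightarrow> x i \<in> carrier F"
  by (simp add: \<Omega>_iff)

lemma left_module_\<Omega>: "left_module F (\<Omega> F)"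
proof -
  have add: "x \<oplus>\<^bsub>\<Omega> F\<^esub> y \<in> carrier (\<Omega> F)" if x: "x \<in> carrier (\<Omega> F)" and y: "y \<in> carrier (\<Omega> F)" for x y
  proof -
    obtain m k where "\<forall>i\<ge>m. x i = \<zero>" "\<forall>i\<ge>k. y i = \<zero>" using x y unfolding \<Omega>_iff by blast
    then show ?thesis using \<Omega>_coeff x y by (intro \<Omega>_I[of _ "max m k"]) auto
  qed
  have smult: "c \<odot>\<^bsub>\<Omega> F\<^esub> x \<in> carrier (\<Omega> F)" if c: "c \<in> carrier F" and x: "x \<in> carrier (\<Omega> F)" for c x
  proof -
    obtain m where "\<forall>i\<ge>m. x i = \<zero>" using x unfolding \<Omega>_iff by blast
    then show ?thesis using \<Omega>_coeff c x by (intro \<Omega>_I[of _ m]) auto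
  qed
  have "abelian_group (\<Omega> F)"
  proof (rule abelian_groupI)
    fix x assume x: "x \<in> carrier (\<Omega> F)"
    have "(\<ominus> \<one>) \<odot>\<^bsub>\<Omega> F\<^esub> x \<oplus>\<^bsub>\<Omega> F\<^esub> x = \<zero>\<^bsub>\<Omega> F\<^esub>"
      by (rule ext) (use \<Omega>_coeff[OF x] in \<open>simp add: l_minus l_neg\<close>)
    then show "\<exists>y\<in>carrier (\<Omega> F). y \<oplus>\<^bsub>\<Omega> F\<^esub> x = \<zero>\<^bsub>\<Omega> F\<^esub>" using smult[OF _ x] by blast
  qed (auto simp: add fun_eq_iff a_ac \<Omega>_coeff, simp add: \<Omega>_iff)
  then show ?thesis
    by (intro left_module.intro left_module_axioms.intro ring_axioms)
      (auto simp: smult fun_eq_iff l_distr r_distr m_assoc \<Omega>_coeff)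
qed

sublocale \<Omega>: left_module F "\<Omega> F" by (rule left_module_\<Omega>)

section \<open>Copies of F^n inside \<Omega> and truncation of coordinates\<close>

definition Fin :: "nat \<Rightarrow> (nat \<Rightarrow> 'f) set" where
  "Fin n = {x \<in> carrier (\<Omega> F). \<forall>i\<ge>n. x i = \<zero>}"

abbreviation FinM :: "nat \<Rightarrow> ('f, nat \<Rightarrow> 'f) module" where
  "FinM n \<equiv> (\<Omega> F)\<lparr>carrier := Fin n\<rparr>"

lemma Fin_iff: "x \<in> Fin n \<longleftrightarrow> (\<forall>i. x i \<in> carrier F) \<and> (\<forall>i\<ge>n. x i = \<zero>)"
  by (auto simp: Fin_def \<Omega>_iff)

lemma Fin_\<Omega>: "x \<in> Fin n \<Longrightarrow> x \<in> carrier (\<Omega> F)" by (simp add: Fin_def)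

lemma Fin_mono: "n \<le> m \<Longrightarrow> Fin n \<subseteq> Fin m" by (auto simp: Fin_def)

lemma Fin_cover: "x \<in> carrier (\<Omega> F) \<Longrightarrow> \<exists>n. x \<in> Fin n" by (auto simp: Fin_iff \<Omega>_iff)

lemma finite_subset_Fin: "\<lbrakk>finite B; B \<subseteq> carrier (\<Omega> F)\<rbrakk> \<Longrightarrow> \<exists>n. B \<subseteq> Fin n"
proof (induction B rule: finite_induct)
  case (insert x B)
  then obtain n m where "x \<in> Fin n" "B \<subseteq> Fin m" using Fin_cover by blast
  then have "insert x B \<subseteq> Fin (max n m)" using Fin_mono[of n "max n m"] Fin_mono[of m "max n m"] by auto
  then show ?case ..
qed simp

lemma left_module_FinM: "left_module F (FinM n)"
  by (rule left_module_submodule[OF left_module_\<Omega>]) (simp_all add: subsetI Fin_\<Omega>, simp_all add: Fin_iff)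

lemma finite_Fin: "finite (Fin n)"
proof -
  have "inj_on (\<lambda>x. restrict x {..<n}) (Fin n)"
  proof (rule inj_onI, rule ext)
    fix x y i assume xy: "x \<in> Fin n" "y \<in> Fin n" and "restrict x {..<n} = restrict y {..<n}"
    then have "i < n \<Longrightarrow> x i = y i" by (metis lessThan_iff restrict_apply')
    then show "x i = y i" using xy by (cases "i < n") (auto simp: Fin_iff)
  qed
  moreover have "(\<lambda>x. restrict x {..<n}) ` Fin n \<subseteq> {..<n} \<rightarrow>\<^sub>E carrier F"
    by (rule image_subsetI) (simp add: Fin_iff)
  ultimately show ?thesis
    using finite_PiE[of "{..<n}" "\<lambda>_. carrier F"] finite_carrier by (meson finite_lessThan inj_on_finite)
qed

definition unit :: "nat \<Rightarrow> nat \<Rightarrow> 'f" where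
  "unit n = (\<lambda>i. if i = n then \<one> else \<zero>)"

lemma unit_Fin: "unit n \<in> Fin (Suc n)" by (auto simp: unit_def Fin_iff)

lemma unit_not_Fin: "unit n \<notin> Fin n" by (auto simp: unit_def Fin_iff)

lemma Fin_strict: "Fin n \<subset> Fin (Suc n)"
  using Fin_mono[of n "Suc n"] unit_Fin[of n] unit_not_Fin[of n] by auto

text \<open>A crude bound from the strictly increasing chain, used to limit the \<open>n\<close> for
  which \<open>Fin n\<close> embeds into a given finite space.\<close>

lemma card_Fin: "n \<le> card (Fin n)"
  by (induction n) (use psubset_card_mono[OF finite_Fin Fin_strict] in \<open>auto intro: Suc_leI le_less_trans\<close>)

text \<open>The sets \<open>Fin n\<close> form a chain, so equal finite cardinalities force
  equality. This identifies the image of a transported copy of \<open>Fin n\<close>.\<close>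

lemma Fin_card_inject: "card (Fin n) = card (Fin m) \<Longrightarrow> Fin n = Fin m"
  using Fin_mono card_subset_eq[OF finite_Fin] by (metis nat_le_linear)

text \<open>The coordinate projection of \<Omega> onto \<open>Fin n\<close>; it serves to extend
  linear maps and to split inclusions.\<close>

definition trunc :: "nat \<Rightarrow> (nat \<Rightarrow> 'f) \<Rightarrow> nat \<Rightarrow> 'f" where
  "trunc n x = (\<lambda>i. if i < n then x i else \<zero>)"

lemma trunc_Fin: "x \<in> carrier (\<Omega> F) \<Longrightarrow> trunc n x \<in> Fin n"
  by (auto simp: trunc_def Fin_iff \<Omega>_coeff)

lemma trunc_eq: "x \<in> Fin n \<Longrightarrow> trunc n x = x"
  by (auto simp: trunc_def Fin_iff fun_eq_iff)

lemma trunc_add: "trunc n (x \<oplus>\<^bsub>\<Omega> F\<^esub> y) = trunc n x \<oplus>\<^bsub>\<Omega> F\<^esub> trunc n y"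
  by (rule ext) (simp add: trunc_def)

lemma trunc_smult: "c \<in> carrier F \<Longrightarrow> trunc n (c \<odot>\<^bsub>\<Omega> F\<^esub> x) = c \<odot>\<^bsub>\<Omega> F\<^esub> trunc n x"
  by (rule ext) (simp add: trunc_def)

lemma trunc_decompose: "x \<in> Fin (Suc n) \<Longrightarrow> x = trunc n x \<oplus>\<^bsub>\<Omega> F\<^esub> x n \<odot>\<^bsub>\<Omega> F\<^esub> unit n"
  by (rule ext) (auto simp: trunc_def unit_def Fin_iff)

lemma Fin_0: "x \<in> Fin 0 \<Longrightarrow> x = \<zero>\<^bsub>\<Omega> F\<^esub>" by (auto simp: Fin_iff fun_eq_iff)

subsection \<open>Extension of linear maps\<close>

lemma \<E>_iff: "h \<in> \<E> F \<longleftrightarrow> h \<in> lin_maps F (\<Omega> F) (\<Omega> F)"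
  by (simp add: End_all_def)

lemma GL_iff: "h \<in> GL F \<longleftrightarrow> h \<in> lin_maps F (\<Omega> F) (\<Omega> F) \<and> bij_betw h (carrier (\<Omega> F)) (carrier (\<Omega> F))"
  using lin_maps_extensional[of h F "\<Omega> F" "\<Omega> F"] by (auto simp: GL_def \<E>_iff Bij_def)

lemma GL_I:
  assumes f: "f \<in> lin_maps F (\<Omega> F) (\<Omega> F)"
    and g: "\<And>x. x \<in> carrier (\<Omega> F) \<Longrightarrow> g x \<in> carrier (\<Omega> F)"
    and "\<And>x. x \<in> carrier (\<Omega> F) \<Longrightarrow> g (f x) = x" "\<And>x. x \<in> carrier (\<Omega> F) \<Longrightarrow> f (g x) = x"
  shows "f \<in> GL F"
  unfolding GL_iff
  by (intro conjI f bij_betw_byWitness[of _ g]) (use assms lin_maps_closed[OF f] in auto)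

lemma compose_\<E>: "\<lbrakk>g \<in> \<E> F; h \<in> \<E> F\<rbrakk> \<Longrightarrow> compose (carrier (\<Omega> F)) g h \<in> \<E> F"
  unfolding \<E>_iff using compose_in_lin_maps[OF left_module_\<Omega>] .

lemma compose_GL: "\<lbrakk>g \<in> GL F; h \<in> GL F\<rbrakk> \<Longrightarrow> compose (carrier (\<Omega> F)) g h \<in> GL F"
  unfolding GL_iff using compose_in_lin_maps[OF left_module_\<Omega>] bij_betw_compose by blast

lemma id_GL: "(\<lambda>x\<in>carrier (\<Omega> F). x) \<in> GL F"
  unfolding GL_iff using id_in_lin_maps[OF left_module_\<Omega>] by (auto simp: bij_betw_def inj_on_def)

lemma inverse_GL:
  assumes h: "h \<in> GL F"
  shows "\<exists>g\<in>GL F. compose (carrier (\<Omega> F)) g h = (\<lambda>x\<in>carrier (\<Omega> F). x) \<and>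
    compose (carrier (\<Omega> F)) h g = (\<lambda>x\<in>carrier (\<Omega> F). x)"
proof (intro bexI conjI)
  let ?S = "carrier (\<Omega> F)" let ?g = "\<lambda>y\<in>?S. inv_into ?S h y"
  have l: "h \<in> lin_maps F (\<Omega> F) (\<Omega> F)" and b: "bij_betw h ?S ?S" using h by (auto simp: GL_iff)
  show "compose ?S ?g h = (\<lambda>x\<in>?S. x)" "compose ?S h ?g = (\<lambda>x\<in>?S. x)"
    using b lin_maps_closed[OF l]
    by (auto simp: fun_eq_iff compose_def bij_betw_inv_into_left bij_betw_inv_into_right)
  show "?g \<in> GL F"
  proof (rule GL_I[where g = h])
    show "?g \<in> lin_maps F (\<Omega> F) (\<Omega> F)" by (rule inverse_in_lin_maps[OF left_module_\<Omega> left_module_\<Omega> l b])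
  qed (use b lin_maps_closed[OF l] in \<open>auto simp: bij_betw_inv_into_left bij_betw_inv_into_right\<close>)
qed

text \<open>Precompose with truncation, a linear projection of \<Omega> onto
  \<open>Fin n\<close>.\<close>

lemma extend_\<E>:
  assumes f: "f \<in> lin_maps F (FinM n) (\<Omega> F)"
  shows "\<exists>h\<in>\<E> F. \<forall>x\<in>Fin n. h x = f x"
proof (intro bexI ballI)
  let ?h = "\<lambda>x\<in>carrier (\<Omega> F). f (trunc n x)"
  show "?h \<in> \<E> F"
    unfolding \<E>_iff
    by (rule lin_mapsI)
      (use lin_maps_closed[OF f] lin_maps_add[OF f] lin_maps_smult[OF f] in
        \<open>simp_all add: trunc_Fin trunc_add trunc_smult \<Omega>.smult_closed\<close>)
  show "?h x = f x" if "x \<in> Fin n" for x using that by (simp add: Fin_\<Omega> trunc_eq)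
qed

lemma restrict_Fin:
  assumes "h \<in> lin_maps F (\<Omega> F) (\<Omega> F)"
  shows "restrict h (Fin n) \<in> lin_maps F (FinM n) (\<Omega> F)"
  by (rule lin_mapsI)
    (use lin_maps_closed[OF assms] lin_maps_add[OF assms] lin_maps_smult[OF assms]
      left_module.smult_closed[OF left_module_FinM[of n]]
      abelian_groupE(1)[OF left_module.axioms(2)[OF left_module_FinM[of n]]] in \<open>simp_all add: Fin_\<Omega>\<close>)

lemma dense_surj:
  assumes h: "h \<in> \<E> F" and B: "finite B" "B \<subseteq> carrier (\<Omega> F)"
  shows "\<exists>g\<in>\<E>\<^sub>s F. \<forall>x\<in>B. g x = h x"
proof -
  obtain n where n: "B \<subseteq> Fin n" using finite_subset_Fin[OF B] by blast
  have h: "h \<in> lin_maps F (\<Omega> F) (\<Omega> F)" using h by (simp add: \<E>_iff)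
  \<comment> \<open>Adding the shift by \<open>n\<close> places, which vanishes on \<open>Fin n\<close>, makes the map surjective.\<close>
  define g where "g = (\<lambda>x\<in>carrier (\<Omega> F). h (trunc n x) \<oplus>\<^bsub>\<Omega> F\<^esub> (\<lambda>i. x (i + n)))"
  have shift: "(\<lambda>i. x (i + n)) \<in> carrier (\<Omega> F)" if "x \<in> carrier (\<Omega> F)" for x
    using that unfolding \<Omega>_iff by (meson trans_le_add1)
  have t: "h (trunc n x) \<in> carrier (\<Omega> F)" if "x \<in> carrier (\<Omega> F)" for x
    using lin_maps_closed[OF h] trunc_Fin[OF that] Fin_\<Omega> by blast
  have gl: "g \<in> lin_maps F (\<Omega> F) (\<Omega> F)"
  proof (rule lin_mapsI)
    fix x y assume xy: "x \<in> carrier (\<Omega> F)" "y \<in> carrier (\<Omega> F)"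
    show "g (x \<oplus>\<^bsub>\<Omega> F\<^esub> y) = g x \<oplus>\<^bsub>\<Omega> F\<^esub> g y"
      using xy shift t \<Omega>_coeff[OF t] \<Omega>_coeff trunc_Fin[THEN Fin_\<Omega>]
      by (simp add: g_def trunc_add lin_maps_add[OF h]) (simp add: fun_eq_iff a_ac)
  next
    fix c x assume "c \<in> carrier F" "x \<in> carrier (\<Omega> F)"
    then show "g (c \<odot>\<^bsub>\<Omega> F\<^esub> x) = c \<odot>\<^bsub>\<Omega> F\<^esub> g x"
      using shift t \<Omega>_coeff[OF t] \<Omega>_coeff trunc_Fin[THEN Fin_\<Omega>]
      by (simp add: g_def trunc_smult lin_maps_smult[OF h] \<Omega>.smult_closed) (simp add: fun_eq_iff r_distr)
  qed (simp_all add: g_def shift t)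
  have "y \<in> g ` carrier (\<Omega> F)" if y: "y \<in> carrier (\<Omega> F)" for y
  proof (rule image_eqI)
    \<comment> \<open>Moving \<open>y\<close> up by \<open>n\<close> places leaves the first
      \<open>n\<close> coordinates zero, so the summand with \<open>h\<close> vanishes and the shift
      in \<open>g\<close> returns \<open>y\<close>.\<close>
    let ?x = "\<lambda>i. if i < n then \<zero> else y (i - n)"
    obtain m where m: "\<forall>i\<ge>m. y i = \<zero>" using y unfolding \<Omega>_iff by blast
    then have "\<forall>i\<ge>m + n. ?x i = \<zero>" by auto
    then show x: "?x \<in> carrier (\<Omega> F)" using y unfolding \<Omega>_iff by auto
    have "trunc n ?x = \<zero>\<^bsub>\<Omega> F\<^esub>" by (rule ext) (simp add: trunc_def)
    then show "y = g ?x"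
      using x lin_maps_zero[OF left_module_\<Omega> left_module_\<Omega> h] y by (simp add: g_def)
  qed
  then have "g \<in> \<E>\<^sub>s F"
    using gl lin_maps_closed[OF gl] by (auto simp: End_surj_def \<E>_iff)
  moreover have "g x = h x" if "x \<in> B" for x
  proof -
    have x: "x \<in> Fin n" using n that by blast
    then have "(\<lambda>i. x (i + n)) = \<zero>\<^bsub>\<Omega> F\<^esub>" by (simp add: fun_eq_iff Fin_iff)
    then show ?thesis using Fin_\<Omega>[OF x] lin_maps_closed[OF h] by (simp add: g_def trunc_eq[OF x])
  qed
  ultimately show ?thesis by blast
qed

text \<open>Supplies the induction step of \<open>extend_GL\<close>, where the image of the next
  basis vector is prescribed. Explicit automorphisms avoid bases and complements.\<close>

lemma GL_moves_unit:
  assumes y: "y \<in> carrier (\<Omega> F)" "y \<notin> Fin n"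
  shows "\<exists>k\<in>GL F. (\<forall>x\<in>Fin n. k x = x) \<and> k (unit n) = y"
proof -
  let ?S = "carrier (\<Omega> F)"
  obtain j where j: "n \<le> j" "y j \<noteq> \<zero>" using y by (auto simp: Fin_def)
  \<comment> \<open>The transposition \<open>\<sigma>\<close> moves a non-zero coordinate of \<open>y\<close> to place \<open>n\<close>; then \<open>\<tau>\<close> changes only the
    basis vector with index \<open>n\<close>.\<close>
  define s where "s i = (if i = n then j else if i = j then n else i)" for i
  have ss: "s (s i) = i" for i by (auto simp: s_def)
  define \<sigma> where "\<sigma> = (\<lambda>x\<in>?S. \<lambda>i. x (s i))"
  have sc: "(\<lambda>i. x (s i)) \<in> ?S" if x: "x \<in> ?S" for x
  proof -
    obtain m where "\<forall>i\<ge>m. x i = \<zero>" using x unfolding \<Omega>_iff by blast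
    then have "\<forall>i\<ge>max m (Suc j). x (s i) = \<zero>" using j by (auto simp: s_def)
    then show ?thesis using \<Omega>_coeff[OF x] unfolding \<Omega>_iff by blast
  qed
  have \<sigma>: "\<sigma> \<in> GL F"
  proof (rule GL_I[where g = \<sigma>])
    show "\<sigma> \<in> lin_maps F (\<Omega> F) (\<Omega> F)"
      by (rule lin_mapsI) (simp_all add: \<sigma>_def sc \<Omega>.smult_closed fun_eq_iff)
  qed (simp_all add: \<sigma>_def sc ss)
  have \<sigma>n: "\<sigma> x = x" if "x \<in> Fin n" for x
  proof -
    have "x (s i) = x i" for i using that j by (auto simp: s_def Fin_iff)
    then show ?thesis using Fin_\<Omega>[OF that] by (simp add: \<sigma>_def)
  qed
  define z where "z = \<sigma> y"
  have z: "z \<in> ?S" using y(1) sc by (simp add: z_def \<sigma>_def)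
  have zn: "z n \<noteq> \<zero>" using y(1) j by (simp add: z_def \<sigma>_def s_def)
  note zc = \<Omega>_coeff[OF z]
  have zu: "z n \<in> Units F" using zn zc field_Units by simp
  note zi = Units_inv_closed[OF zu] Units_r_inv[OF zu] Units_l_inv[OF zu]
  define \<tau> where "\<tau> = (\<lambda>x\<in>?S. \<lambda>i. if i = n then x n \<otimes> z n else x i \<oplus> x n \<otimes> z i)"
  \<comment> \<open>The inverse of \<tau>: divide coordinate \<open>n\<close> by \<open>z n\<close>,
    which \<sigma> made non-zero, and subtract the resulting multiple of the other coordinates of
    \<open>z\<close>.\<close>
  define \<tau>' where "\<tau>' = (\<lambda>x\<in>?S. \<lambda>i. if i = n then x n \<otimes> inv (z n) else x i \<ominus> (x n \<otimes> inv (z n)) \<otimes> z i)"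
  obtain mz where mz: "\<forall>i\<ge>mz. z i = \<zero>" using z unfolding \<Omega>_iff by blast
  have \<tau>c: "\<tau> x \<in> ?S" if x: "x \<in> ?S" for x
  proof -
    obtain m where "\<forall>i\<ge>m. x i = \<zero>" using x unfolding \<Omega>_iff by blast
    then show ?thesis
      using mz x zc \<Omega>_coeff[OF x] by (intro \<Omega>_I[of _ "max m mz"]) (auto simp: \<tau>_def)
  qed
  have \<tau>'c: "\<tau>' x \<in> ?S" if x: "x \<in> ?S" for x
  proof -
    obtain m where "\<forall>i\<ge>m. x i = \<zero>" using x unfolding \<Omega>_iff by blast
    then show ?thesis
      using mz x zc zi \<Omega>_coeff[OF x] by (intro \<Omega>_I[of _ "max m mz"]) (auto simp: \<tau>'_def minus_eq)
  qed
  have \<tau>: "\<tau> \<in> GL F"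
  proof (rule GL_I[where g = \<tau>'])
    show "\<tau> \<in> lin_maps F (\<Omega> F) (\<Omega> F)"
    proof (rule lin_mapsI)
      fix a b assume "a \<in> ?S" "b \<in> ?S"
      then show "\<tau> (a \<oplus>\<^bsub>\<Omega> F\<^esub> b) = \<tau> a \<oplus>\<^bsub>\<Omega> F\<^esub> \<tau> b"
        using \<Omega>_coeff[of a] \<Omega>_coeff[of b] zc by (auto simp: \<tau>_def fun_eq_iff l_distr a_ac)
    next
      fix c a assume "c \<in> carrier F" "a \<in> ?S"
      then show "\<tau> (c \<odot>\<^bsub>\<Omega> F\<^esub> a) = c \<odot>\<^bsub>\<Omega> F\<^esub> \<tau> a"
        using \<Omega>_coeff[of a] zc by (auto simp: \<tau>_def fun_eq_iff r_distr m_assoc \<Omega>.smult_closed)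
    qed (auto simp: \<tau>c, simp add: \<tau>_def)
    show "\<tau>' x \<in> ?S" if "x \<in> ?S" for x using \<tau>'c[OF that] .
    show "\<tau>' (\<tau> x) = x" if x: "x \<in> ?S" for x
    proof
      fix i
      note xc = \<Omega>_coeff[OF x]
      have n: "x n \<otimes> z n \<otimes> inv (z n) = x n" using xc zc zi by (simp add: m_assoc)
      have "x i \<oplus> x n \<otimes> z i \<ominus> x n \<otimes> z i = x i"
        using xc zc by (simp add: minus_eq a_assoc r_neg)
      then show "\<tau>' (\<tau> x) i = x i" using \<tau>c[OF x] x n by (simp add: \<tau>'_def \<tau>_def)
    qed
    show "\<tau> (\<tau>' x) = x" if x: "x \<in> ?S" for x
    proof
      fix i
      note xc = \<Omega>_coeff[OF x]
      have n: "x n \<otimes> inv (z n) \<otimes> z n = x n" using xc zc zi by (simp add: m_assoc)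
      have "x i \<ominus> (x n \<otimes> inv (z n)) \<otimes> z i \<oplus> (x n \<otimes> inv (z n)) \<otimes> z i = x i"
        using xc zc zi by (simp add: minus_eq a_assoc l_neg)
      then show "\<tau> (\<tau>' x) i = x i" using \<tau>'c[OF x] x n by (simp add: \<tau>'_def \<tau>_def)
    qed
  qed
  have \<tau>n: "\<tau> x = x" if "x \<in> Fin n" for x
    using that Fin_\<Omega>[OF that] zc by (auto simp: \<tau>_def Fin_iff fun_eq_iff)
  have u: "unit n \<in> ?S" using unit_Fin Fin_\<Omega> by blast
  have \<tau>u: "\<tau> (unit n) = z" using u zc by (auto simp: \<tau>_def fun_eq_iff unit_def)
  have "\<sigma> z = y" using y(1) sc ss by (simp add: z_def \<sigma>_def)
  then show ?thesis
    using compose_GL[OF \<sigma> \<tau>] \<sigma>n \<tau>n \<tau>u u Fin_\<Omega> by (intro bexI[of _ "compose ?S \<sigma> \<tau>"]) (auto simp: compose_eq)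
qed

text \<open>After eta-expansion these rules would also rewrite the unapplied vectors \<open>x \<oplus>\<^bsub>\<Omega> F\<^esub> y\<close>.\<close>

declare \<Omega>_simps [simp del]

text \<open>By induction some automorphism \<open>g\<close> extends \<open>f\<close> on
  \<open>Fin n\<close>. The preimage \<open>y\<close> under \<open>g\<close> of the required value
  at \<open>unit n\<close> lies outside \<open>Fin n\<close>, so some automorphism \<open>k\<close>
  fixes \<open>Fin n\<close> pointwise and sends \<open>unit n\<close> to \<open>y\<close>; then
  \<open>g\<close> after \<open>k\<close> extends \<open>f\<close> on
  \<open>Fin (Suc n)\<close>.\<close>

lemma extend_GL:
  assumes "f \<in> lin_maps F (FinM n) (\<Omega> F)" "inj_on f (Fin n)"
  shows "\<exists>h\<in>GL F. \<forall>x\<in>Fin n. h x = f x"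
  using assms
proof (induction n arbitrary: f)
  case 0
  have z: "f \<zero>\<^bsub>\<Omega> F\<^esub> = \<zero>\<^bsub>\<Omega> F\<^esub>"
    using lin_maps_zero[OF left_module_FinM left_module_\<Omega> 0(1)] by simp
  show ?case
  proof (intro bexI ballI)
    fix x assume "x \<in> Fin 0"
    then have x: "x = \<zero>\<^bsub>\<Omega> F\<^esub>" by (rule Fin_0)
    show "(\<lambda>x\<in>carrier (\<Omega> F). x) x = f x" unfolding x z by simp
  qed (rule id_GL)
next
  case (Suc n)
  let ?S = "carrier (\<Omega> F)"
  note f = lin_maps_closed[OF Suc.prems(1)] lin_maps_add[OF Suc.prems(1)] lin_maps_smult[OF Suc.prems(1)]
  have sub: "x \<in> Fin (Suc n)" if "x \<in> Fin n" for x using Fin_mono[of n "Suc n"] that by auto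
  have rl: "restrict f (Fin n) \<in> lin_maps F (FinM n) (\<Omega> F)"
    by (rule lin_mapsI)
      (use f left_module.smult_closed[OF left_module_FinM[of n]]
        abelian_groupE(1)[OF left_module.axioms(2)[OF left_module_FinM[of n]]] in
          \<open>simp_all add: sub\<close>)
  have ri: "inj_on (restrict f (Fin n)) (Fin n)"
    using Suc.prems(2) sub by (auto simp: inj_on_def)
  from Suc.IH[OF rl ri] obtain g where g: "g \<in> GL F" "\<forall>x\<in>Fin n. g x = f x" by auto
  have gl: "g \<in> lin_maps F (\<Omega> F) (\<Omega> F)" and gb: "bij_betw g ?S ?S" using g(1) by (simp_all add: GL_iff)
  have fu: "f (unit n) \<in> ?S" using f(1)[of "unit n"] unit_Fin by simp
  then obtain y where y: "y \<in> ?S" "g y = f (unit n)" using gb by (metis bij_betw_imp_surj_on imageE)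
  \<comment> \<open>Otherwise \<open>f\<close> would agree at \<open>y\<close> and at
    \<open>unit n\<close>, two distinct points of \<open>Fin (Suc n)\<close>.\<close>
  have "y \<notin> Fin n"
  proof
    assume yn: "y \<in> Fin n"
    then have "f y = f (unit n)" using g(2) y(2) by simp
    then have "y = unit n" using inj_onD[OF Suc.prems(2)] sub[OF yn] unit_Fin by blast
    then show False using yn unit_not_Fin by simp
  qed
  then obtain k where k: "k \<in> GL F" "\<forall>x\<in>Fin n. k x = x" "k (unit n) = y" using GL_moves_unit[OF y(1)] by blast
  have kl: "k \<in> lin_maps F (\<Omega> F) (\<Omega> F)" using k(1) by (simp add: GL_iff)
  have "compose ?S g k x = f x" if x: "x \<in> Fin (Suc n)" for x
  proof -
    let ?t = "trunc n x"
    have t: "?t \<in> Fin n" "?t \<in> ?S" using trunc_Fin[OF Fin_\<Omega>[OF x]] Fin_\<Omega> by auto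
    have c: "x n \<in> carrier F" using x by (simp add: Fin_iff)
    have u: "unit n \<in> ?S" using unit_Fin Fin_\<Omega> by blast
    have cu: "x n \<odot>\<^bsub>\<Omega> F\<^esub> unit n \<in> Fin (Suc n)" using c by (auto simp: Fin_iff unit_def \<Omega>_simps)
    have "compose ?S g k x = g (k (?t \<oplus>\<^bsub>\<Omega> F\<^esub> x n \<odot>\<^bsub>\<Omega> F\<^esub> unit n))"
      using Fin_\<Omega>[OF x] trunc_decompose[OF x] by (simp add: compose_eq)
    also have "\<dots> = g ?t \<oplus>\<^bsub>\<Omega> F\<^esub> x n \<odot>\<^bsub>\<Omega> F\<^esub> g y"
      using t c u y(1) k(2,3)
      by (simp add: lin_maps_add[OF kl] lin_maps_smult[OF kl] lin_maps_add[OF gl] lin_maps_smult[OF gl] \<Omega>.smult_closed)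
    also have "\<dots> = f ?t \<oplus>\<^bsub>\<Omega> F\<^esub> x n \<odot>\<^bsub>\<Omega> F\<^esub> f (unit n)" using g(2) t y(2) by simp
    also have "\<dots> = f (?t \<oplus>\<^bsub>\<Omega> F\<^esub> x n \<odot>\<^bsub>\<Omega> F\<^esub> unit n)"
      using f(2)[of ?t "x n \<odot>\<^bsub>\<Omega> F\<^esub> unit n"] f(3)[of "x n" "unit n"] sub[OF t(1)] cu c unit_Fin by simp
    also have "\<dots> = f x" using trunc_decompose[OF x] by simp
    finally show ?thesis .
  qed
  then show ?case using compose_GL[OF g(1) k(1)] by blast
qed

text \<open>A finite set lies in some \<open>Fin n\<close>, and \<open>extend_GL\<close> applies to
  the restriction of \<open>h\<close> to it.\<close>

lemma dense_GL:
  assumes h: "h \<in> \<E>\<^sub>i F" and B: "finite B" "B \<subseteq> carrier (\<Omega> F)"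
  shows "\<exists>g\<in>GL F. \<forall>x\<in>B. g x = h x"
proof -
  obtain n where n: "B \<subseteq> Fin n" using finite_subset_Fin[OF B] by blast
  have "h \<in> lin_maps F (\<Omega> F) (\<Omega> F)" "inj_on h (carrier (\<Omega> F))" using h by (simp_all add: End_inj_def \<E>_iff)
  then have "restrict h (Fin n) \<in> lin_maps F (FinM n) (\<Omega> F)" "inj_on (restrict h (Fin n)) (Fin n)"
    using restrict_Fin Fin_\<Omega> by (auto simp: inj_on_def)
  from extend_GL[OF this] obtain g where "g \<in> GL F" "\<forall>x\<in>Fin n. g x = restrict h (Fin n) x" ..
  then show ?thesis using n by (intro bexI[of _ g]) auto
qed

lemma GL_subset_inj: "GL F \<subseteq> \<E>\<^sub>i F"
  by (auto simp: GL_iff End_inj_def \<E>_iff bij_betw_def)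

lemma self_map_monoids:
  "self_map_monoid (carrier (\<Omega> F)) (\<E> F)" "self_map_monoid (carrier (\<Omega> F)) (\<E>\<^sub>s F)"
  "self_map_monoid (carrier (\<Omega> F)) (\<E>\<^sub>i F)" "self_map_monoid (carrier (\<Omega> F)) (GL F)"
proof -
  let ?S = "carrier (\<Omega> F)"
  have E: "\<E> F \<subseteq> ?S \<rightarrow>\<^sub>E ?S"
    by (auto simp: \<E>_iff PiE_def dest: lin_maps_closed lin_maps_extensional)
  have idE: "(\<lambda>x\<in>?S. x) \<in> \<E> F" using id_GL by (simp add: GL_iff \<E>_iff)
  show "self_map_monoid ?S (\<E> F)" unfolding self_map_monoid_def using E idE compose_\<E> by blast
  show "self_map_monoid ?S (\<E>\<^sub>s F)"
    unfolding self_map_monoid_def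
  proof (intro conjI ballI)
    fix g h assume "g \<in> \<E>\<^sub>s F" "h \<in> \<E>\<^sub>s F"
    then show "compose ?S g h \<in> \<E>\<^sub>s F" using compose_\<E> by (auto simp: End_surj_def surj_compose)
  qed (use E idE in \<open>auto simp: End_surj_def\<close>)
  show "self_map_monoid ?S (\<E>\<^sub>i F)"
    unfolding self_map_monoid_def
  proof (intro conjI ballI)
    fix g h assume "g \<in> \<E>\<^sub>i F" "h \<in> \<E>\<^sub>i F"
    then show "compose ?S g h \<in> \<E>\<^sub>i F" using compose_\<E> inj_on_compose by (auto simp: End_inj_def \<E>_iff)
  qed (use E idE in \<open>auto simp: End_inj_def\<close>)
  show "self_map_monoid ?S (GL F)"
    unfolding self_map_monoid_def
    using compose_GL id_GL E by (auto simp: GL_def)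
qed

subsection \<open>Finite spaces as subsets of \<open>\<Omega>\<close>\<close>

text \<open>Take the largest \<open>n\<close> for which \<open>Fin n\<close> embeds into
  \<open>W\<close>. The embedding is onto, since a vector outside its image would allow one more
  dimension; its inverse is the required map.\<close>

lemma embedding_exists:
  assumes W: "left_module F W" and fin: "finite (carrier W)"
  shows "\<exists>i n. i \<in> lin_maps F W (\<Omega> F) \<and> inj_on i (carrier W) \<and> i ` carrier W = Fin n"
proof -
  interpret W: left_module F W by fact
  let ?P = "\<lambda>n. \<exists>j\<in>lin_maps F (FinM n) W. inj_on j (Fin n)"
  have P0: "?P 0"
  proof (intro bexI)
    let ?j = "\<lambda>x\<in>Fin 0. \<zero>\<^bsub>W\<^esub>"
    interpret F0: left_module F "FinM 0" by (rule left_module_FinM)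
    have "c \<odot>\<^bsub>W\<^esub> \<zero>\<^bsub>W\<^esub> = \<zero>\<^bsub>W\<^esub>" if "c \<in> carrier F" for c
      using abelian_group_zero_unique[OF W.M.abelian_group_axioms, of "c \<odot>\<^bsub>W\<^esub> \<zero>\<^bsub>W\<^esub>"]
        W.smult_r_distr[of c "\<zero>\<^bsub>W\<^esub>" "\<zero>\<^bsub>W\<^esub>"] that by (simp add: W.smult_closed)
    then show "?j \<in> lin_maps F (FinM 0) W"
      using F0.smult_closed F0.M.a_closed by (intro lin_mapsI) simp_all
    show "inj_on ?j (Fin 0)" by (intro inj_onI) (metis Fin_0)
  qed
  \<comment> \<open>\<open>Greatest\<close> is meaningful only for a bounded predicate:
    \<open>n \<le> card (Fin n) \<le> card (carrier W)\<close>.\<close>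
  have bound: "n \<le> card (carrier W)" if P: "?P n" for n
  proof -
    obtain j where "j \<in> lin_maps F (FinM n) W" "inj_on j (Fin n)" using P by blast
    then have "card (Fin n) \<le> card (carrier W)"
      using lin_maps_closed[of j F "FinM n" W] by (intro card_inj_on_le[OF _ _ fin]) auto
    then show ?thesis using card_Fin[of n] by simp
  qed
  define n where "n = Greatest ?P"
  have n: "?P n" unfolding n_def by (rule GreatestI_nat[of ?P 0, OF P0]) (rule bound)
  have max: "m \<le> n" if "?P m" for m unfolding n_def by (rule Greatest_le_nat[of ?P, OF that]) (rule bound)
  obtain j where jl: "j \<in> lin_maps F (FinM n) W" and inj: "inj_on j (Fin n)" using n by blast
  note j = lin_maps_closed[OF jl, simplified] lin_maps_add[OF jl, simplified] lin_maps_smult[OF jl, simplified]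
  interpret Fn: left_module F "FinM n" by (rule left_module_FinM)
  interpret FSn: left_module F "FinM (Suc n)" by (rule left_module_FinM)
  have "w \<in> j ` Fin n" if w: "w \<in> carrier W" for w
  proof (rule ccontr)
    assume notin: "w \<notin> j ` Fin n"
    have t: "trunc n x \<in> Fin n" "x n \<in> carrier F" if "x \<in> Fin (Suc n)" for x
      using trunc_Fin[OF Fin_\<Omega>[OF that]] that by (auto simp: Fin_iff)
    \<comment> \<open>Extends \<open>j\<close> by sending \<open>unit n\<close> to \<open>w\<close>;
      its injectivity contradicts the maximality of \<open>n\<close>.\<close>
    define j' where "j' = (\<lambda>x\<in>Fin (Suc n). j (trunc n x) \<oplus>\<^bsub>W\<^esub> x n \<odot>\<^bsub>W\<^esub> w)"
    have j'l: "j' \<in> lin_maps F (FinM (Suc n)) W"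
    proof (rule lin_mapsI)
      fix x y assume "x \<in> carrier (FinM (Suc n))" "y \<in> carrier (FinM (Suc n))"
      then have xy: "x \<in> Fin (Suc n)" "y \<in> Fin (Suc n)" by simp_all
      have "x \<oplus>\<^bsub>\<Omega> F\<^esub> y \<in> Fin (Suc n)" using FSn.M.a_closed xy by simp
      then show "j' (x \<oplus>\<^bsub>FinM (Suc n)\<^esub> y) = j' x \<oplus>\<^bsub>W\<^esub> j' y"
        using xy t[OF xy(1)] t[OF xy(2)] w j
        by (simp add: j'_def trunc_add \<Omega>_simps(1)[of x y n] W.smult_l_distr W.smult_closed W.M.a_ac)
    next
      fix c x assume c: "c \<in> carrier F" and "x \<in> carrier (FinM (Suc n))"
      then have x: "x \<in> Fin (Suc n)" by simp
      have "c \<odot>\<^bsub>\<Omega> F\<^esub> x \<in> Fin (Suc n)" using FSn.smult_closed[OF c] x by simp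
      then show "j' (c \<odot>\<^bsub>FinM (Suc n)\<^esub> x) = c \<odot>\<^bsub>W\<^esub> j' x"
        using c x t[OF x] w j
        by (simp add: j'_def trunc_smult \<Omega>_simps(3)[of c x n] W.smult_r_distr W.smult_assoc1 W.smult_closed)
    qed (use t w j in \<open>simp_all add: j'_def W.smult_closed\<close>)
    have "inj_on j' (Fin (Suc n))"
    proof -
      have "x = \<zero>\<^bsub>\<Omega> F\<^esub>" if x: "x \<in> Fin (Suc n)" and zero: "j' x = \<zero>\<^bsub>W\<^esub>" for x
      proof -
        have e: "j (trunc n x) \<oplus>\<^bsub>W\<^esub> x n \<odot>\<^bsub>W\<^esub> w = \<zero>\<^bsub>W\<^esub>" using x zero by (simp add: j'_def)
        have jz: "j \<zero>\<^bsub>\<Omega> F\<^esub> = \<zero>\<^bsub>W\<^esub>"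
          using lin_maps_zero[OF left_module_FinM W jl] by simp
        have z0: "\<zero>\<^bsub>\<Omega> F\<^esub> \<in> Fin n" using Fn.M.zero_closed by simp
        \<comment> \<open>Otherwise dividing the relation by \<open>x n\<close> expresses
          \<open>w\<close> as a value of \<open>j\<close>.\<close>
        have "x n = \<zero>"
        proof (rule ccontr)
          assume "x n \<noteq> \<zero>"
          then have u: "x n \<in> Units F" using t(2)[OF x] field_Units by simp
          let ?c = "inv (x n)"
          have c: "?c \<in> carrier F" "?c \<otimes> x n = \<one>" using u by auto
          let ?u = "?c \<odot>\<^bsub>\<Omega> F\<^esub> trunc n x"
          have uF: "?u \<in> Fin n" using Fn.smult_closed[OF c(1)] t(1)[OF x] by simp
          have "?c \<odot>\<^bsub>W\<^esub> (j (trunc n x) \<oplus>\<^bsub>W\<^esub> x n \<odot>\<^bsub>W\<^esub> w) = j ?u \<oplus>\<^bsub>W\<^esub> w"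
            using c t[OF x] w j by (simp add: W.smult_r_distr W.smult_closed W.smult_assoc1[symmetric] W.smult_one)
          moreover have "?c \<odot>\<^bsub>W\<^esub> \<zero>\<^bsub>W\<^esub> = \<zero>\<^bsub>W\<^esub>"
            using j(3)[OF c(1) z0] jz Fn.smult_r_distr[OF c(1)] lin_maps_zero[OF left_module_FinM W jl]
              abelian_group_zero_unique[OF W.M.abelian_group_axioms, of "?c \<odot>\<^bsub>W\<^esub> \<zero>\<^bsub>W\<^esub>"]
              W.smult_r_distr[of ?c "\<zero>\<^bsub>W\<^esub>" "\<zero>\<^bsub>W\<^esub>"] c(1) by (simp add: W.smult_closed)
          ultimately have "j ?u \<oplus>\<^bsub>W\<^esub> w = \<zero>\<^bsub>W\<^esub>" using e by simp
          moreover obtain v where v: "v \<in> Fin n" "v \<oplus>\<^bsub>\<Omega> F\<^esub> ?u = \<zero>\<^bsub>\<Omega> F\<^esub>"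
            using Fn.M.l_neg[of ?u] Fn.M.a_inv_closed[of ?u] uF by auto
          then have "j v \<oplus>\<^bsub>W\<^esub> j ?u = \<zero>\<^bsub>W\<^esub>" using j(2)[OF v(1) uF] jz by simp
          ultimately have "w = j v"
            using w j(1)[OF v(1)] j(1)[OF uF] W.M.a_comm[of w "j ?u"] W.M.minus_equality[of w "j ?u"]
              W.M.minus_equality[of "j v" "j ?u"] by simp
          then show False using notin v(1) by blast
        qed
        then have "j (trunc n x) = \<zero>\<^bsub>W\<^esub>"
          using e w j(1) t[OF x] by (simp add: smult_zero_left[OF W w])
        then have "trunc n x = \<zero>\<^bsub>\<Omega> F\<^esub>"
          using inj_onD[OF inj, of "trunc n x" "\<zero>\<^bsub>\<Omega> F\<^esub>"] jz t(1)[OF x] z0 by simp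
        then show ?thesis
          using trunc_decompose[OF x] \<open>x n = \<zero>\<close> by (auto simp: fun_eq_iff unit_def \<Omega>_simps)
      qed
      then show ?thesis
        using lin_maps_inj_onI[OF left_module_FinM W j'l] by simp
    qed
    then show False using max[of "Suc n"] j'l by auto
  qed
  then have im: "j ` Fin n = carrier W" using j(1) by auto
  then have b: "bij_betw j (carrier (FinM n)) (carrier W)" using inj by (simp add: bij_betw_def)
  note i = inverse_in_lin_maps[OF left_module_FinM W jl b]
  show ?thesis
  proof (intro exI conjI)
    let ?i = "\<lambda>y\<in>carrier W. inv_into (carrier (FinM n)) j y"
    have iF: "?i y \<in> Fin n" if "y \<in> carrier W" for y using lin_maps_closed[OF i that] by simp
    show "?i \<in> lin_maps F W (\<Omega> F)"
      by (rule lin_mapsI)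
        (use lin_maps_add[OF i] lin_maps_smult[OF i] iF[THEN Fin_\<Omega>] in simp_all)
    have bi: "bij_betw (inv_into (Fin n) j) (carrier W) (Fin n)" using bij_betw_inv_into[OF b] by simp
    show "inj_on ?i (carrier W)" "?i ` carrier W = Fin n"
      using bi by (simp_all add: bij_betw_def inj_on_def)
  qed
qed

text \<open>The image is some \<open>Fin n\<close>, not just a finite subspace: images then form a
  chain, and truncation projects \<Omega> onto each of them.\<close>

definition emb :: "('f, 'a) module \<Rightarrow> 'a \<Rightarrow> nat \<Rightarrow> 'f" where
  "emb W = (SOME i. i \<in> lin_maps F W (\<Omega> F) \<and> inj_on i (carrier W) \<and> (\<exists>n. i ` carrier W = Fin n))"

definition img :: "('f, 'a) module \<Rightarrow> (nat \<Rightarrow> 'f) set" where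
  "img W = emb W ` carrier W"

definition proj :: "('f, 'a) module \<Rightarrow> (nat \<Rightarrow> 'f) \<Rightarrow> 'a" where
  "proj W = inv_into (carrier W) (emb W)"

text \<open>The map \<open>f\<close> seen between the images in \<Omega>. Its values off
  \<open>img V\<close> are arbitrary, so it is always compared on \<open>img V\<close> only.\<close>

definition conj_map :: "('f, 'a) module \<Rightarrow> ('f, 'a) module \<Rightarrow> ('a \<Rightarrow> 'a) \<Rightarrow> (nat \<Rightarrow> 'f) \<Rightarrow> nat \<Rightarrow> 'f" where
  "conj_map V W f = (\<lambda>x. emb W (f (proj V x)))"

context
  fixes W :: "('f, 'a) module"
  assumes W: "W \<in> Ob (VA F)"
begin

lemma left_module_W: "left_module F W" using W by (simp add: Ob_VA)

lemma emb: "emb W \<in> lin_maps F W (\<Omega> F)" "inj_on (emb W) (carrier W)" "\<exists>n. img W = Fin n"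
proof -
  have "\<exists>i. i \<in> lin_maps F W (\<Omega> F) \<and> inj_on i (carrier W) \<and> (\<exists>n. i ` carrier W = Fin n)"
    using embedding_exists W by (fastforce simp: Ob_VA)
  from someI_ex[OF this, folded emb_def]
  show "emb W \<in> lin_maps F W (\<Omega> F)" "inj_on (emb W) (carrier W)" "\<exists>n. img W = Fin n"
    by (auto simp: img_def)
qed

lemma proj_emb: "x \<in> carrier W \<Longrightarrow> proj W (emb W x) = x"
  by (simp add: proj_def emb(2))

lemma emb_proj: "x \<in> img W \<Longrightarrow> emb W (proj W x) = x"
  by (simp add: proj_def img_def f_inv_into_f)

lemma proj_closed: "x \<in> img W \<Longrightarrow> proj W x \<in> carrier W"
  by (simp add: proj_def img_def inv_into_into)

lemma emb_img: "x \<in> carrier W \<Longrightarrow> emb W x \<in> img W"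
  by (simp add: img_def)

lemma img_\<Omega>: "img W \<subseteq> carrier (\<Omega> F)"
  using emb(3) Fin_\<Omega> by auto

lemma finite_img: "finite (img W)"
  using emb(3) finite_Fin by auto

lemma img_add: "\<lbrakk>x \<in> img W; y \<in> img W\<rbrakk> \<Longrightarrow> x \<oplus>\<^bsub>\<Omega> F\<^esub> y \<in> img W"
  using emb(3) abelian_groupE(1)[OF left_module.axioms(2)[OF left_module_FinM]] by auto

lemma img_smult: "\<lbrakk>c \<in> carrier F; x \<in> img W\<rbrakk> \<Longrightarrow> c \<odot>\<^bsub>\<Omega> F\<^esub> x \<in> img W"
  using emb(3) left_module.smult_closed[OF left_module_FinM] by auto

lemma proj_add: "\<lbrakk>x \<in> img W; y \<in> img W\<rbrakk> \<Longrightarrow> proj W (x \<oplus>\<^bsub>\<Omega> F\<^esub> y) = proj W x \<oplus>\<^bsub>W\<^esub> proj W y"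
proof -
  interpret W: left_module F W by (rule left_module_W)
  assume xy: "x \<in> img W" "y \<in> img W"
  then have "emb W (proj W x \<oplus>\<^bsub>W\<^esub> proj W y) = x \<oplus>\<^bsub>\<Omega> F\<^esub> y"
    using proj_closed emb_proj by (simp add: lin_maps_add[OF emb(1)])
  then show ?thesis using proj_emb[of "proj W x \<oplus>\<^bsub>W\<^esub> proj W y"] proj_closed xy by simp
qed

lemma proj_smult: "\<lbrakk>c \<in> carrier F; x \<in> img W\<rbrakk> \<Longrightarrow> proj W (c \<odot>\<^bsub>\<Omega> F\<^esub> x) = c \<odot>\<^bsub>W\<^esub> proj W x"
proof -
  interpret W: left_module F W by (rule left_module_W)
  assume cx: "c \<in> carrier F" "x \<in> img W"
  then have "emb W (c \<odot>\<^bsub>W\<^esub> proj W x) = c \<odot>\<^bsub>\<Omega> F\<^esub> x"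
    using proj_closed emb_proj by (simp add: lin_maps_smult[OF emb(1)])
  then show ?thesis using proj_emb[of "c \<odot>\<^bsub>W\<^esub> proj W x"] proj_closed cx by (simp add: W.smult_closed)
qed

end

text \<open>An infinite type contains a set with as many elements as \<open>Fin n\<close>, to which
  the module structure is transported. The chosen embedding of the result has some
  \<open>Fin m\<close> as image, and counting gives \<open>Fin m = Fin n\<close>.\<close>

lemma Fin_realised:
  assumes "infinite (UNIV :: 'a set)"
  shows "\<exists>W :: ('f, 'a) module. W \<in> Ob (VA F) \<and> img W = Fin n"
proof -
  obtain A :: "'a set" where A: "finite A" "card A = card (Fin n)"
    using infinite_arbitrarily_large[OF assms] by blast
  then obtain e where e: "bij_betw e (Fin n) A" using finite_same_card_bij[OF finite_Fin] by metis
  have inj: "inj_on e (carrier (FinM n))" using e by (simp add: bij_betw_def)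
  from left_module_transport[OF left_module_FinM inj] obtain W :: "('f, 'a) module"
    where W: "left_module F W" "carrier W = e ` Fin n" by auto
  then have WA: "carrier W = A" using e by (simp add: bij_betw_def)
  have ob: "W \<in> Ob (VA F)" using W(1) WA A by (simp add: Ob_VA)
  obtain m where m: "img W = Fin m" using emb(3)[OF ob] by blast
  then have "card (Fin m) = card (carrier W)"
    using card_image[OF emb(2)[OF ob]] by (simp add: img_def)
  then have "Fin m = Fin n" using A WA by (intro Fin_card_inject) simp
  with ob m show ?thesis by auto
qed

lemma conj_map_extends:
  assumes V: "V \<in> Ob (VA F)" and W: "W \<in> Ob (VA F)" and f: "f \<in> lin_maps F V W"
    and n: "img V = Fin n"
  shows "restrict (conj_map V W f) (Fin n) \<in> lin_maps F (FinM n) (\<Omega> F)"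
proof (rule lin_mapsI)
  note f' = lin_maps_closed[OF f] lin_maps_add[OF f] lin_maps_smult[OF f]
  note e = lin_maps_closed[OF emb(1)[OF W]] lin_maps_add[OF emb(1)[OF W]] lin_maps_smult[OF emb(1)[OF W]]
  note p = proj_closed[OF V, unfolded n] proj_add[OF V, unfolded n] proj_smult[OF V, unfolded n]
    img_add[OF V, unfolded n] img_smult[OF V, unfolded n]
  show "restrict (conj_map V W f) (Fin n) x \<in> carrier (\<Omega> F)" if "x \<in> carrier (FinM n)" for x
    using that by (simp add: conj_map_def e f' p)
  show "restrict (conj_map V W f) (Fin n) (x \<oplus>\<^bsub>FinM n\<^esub> y) =
      restrict (conj_map V W f) (Fin n) x \<oplus>\<^bsub>\<Omega> F\<^esub> restrict (conj_map V W f) (Fin n) y"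
    if "x \<in> carrier (FinM n)" "y \<in> carrier (FinM n)" for x y
    using that by (simp add: conj_map_def e f' p)
  show "restrict (conj_map V W f) (Fin n) (c \<odot>\<^bsub>FinM n\<^esub> x) = c \<odot>\<^bsub>\<Omega> F\<^esub> restrict (conj_map V W f) (Fin n) x"
    if "c \<in> carrier F" "x \<in> carrier (FinM n)" for c x
    using that by (simp add: conj_map_def e f' p)
qed simp

lemma conj_map_inj:
  assumes V: "V \<in> Ob (VA F)" and W: "W \<in> Ob (VA F)" and f: "f \<in> lin_maps F V W" "inj_on f (carrier V)"
  shows "inj_on (conj_map V W f) (img V)"
proof (rule inj_onI)
  fix x y assume xy: "x \<in> img V" "y \<in> img V" and eq: "conj_map V W f x = conj_map V W f y"
  note p = proj_closed[OF V xy(1)] proj_closed[OF V xy(2)]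
  have "f (proj V x) = f (proj V y)"
    using eq inj_onD[OF emb(2)[OF W]] p lin_maps_closed[OF f(1)] by (auto simp: conj_map_def)
  then have "proj V x = proj V y" using inj_onD[OF f(2)] p by blast
  then show "x = y" using emb_proj[OF V] xy by metis
qed

lemma conj_map_restrict:
  assumes V: "V \<in> Ob (VA F)" and W: "W \<in> Ob (VA F)" and h: "h \<in> lin_maps F (\<Omega> F) (\<Omega> F)"
    and im: "h ` img V \<subseteq> img W"
  defines "f \<equiv> \<lambda>v\<in>carrier V. proj W (h (emb V v))"
  shows "f \<in> lin_maps F V W" "\<And>x. x \<in> img V \<Longrightarrow> h x = conj_map V W f x"
    and "inj_on h (carrier (\<Omega> F)) \<Longrightarrow> inj_on f (carrier V)"
proof -
  interpret V: left_module F V by (rule left_module_W[OF V])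
  note e = lin_maps_closed[OF emb(1)[OF V]] lin_maps_add[OF emb(1)[OF V]] lin_maps_smult[OF emb(1)[OF V]]
  note h' = lin_maps_add[OF h] lin_maps_smult[OF h]
  have he: "h (emb V v) \<in> img W" if "v \<in> carrier V" for v using im emb_img[OF V that] by blast
  show "f \<in> lin_maps F V W"
    by (rule lin_mapsI)
      (simp_all add: f_def proj_closed[OF W] he e h' proj_add[OF W] proj_smult[OF W] V.smult_closed)
  show "h x = conj_map V W f x" if x: "x \<in> img V" for x
    using x im emb_proj[OF W] proj_closed[OF V x] emb_proj[OF V x] by (simp add: conj_map_def f_def image_subset_iff)
  assume inj: "inj_on h (carrier (\<Omega> F))"
  show "inj_on f (carrier V)"
  proof (rule inj_onI)
    fix v w assume vw: "v \<in> carrier V" "w \<in> carrier V" and "f v = f w"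
    then have "proj W (h (emb V v)) = proj W (h (emb V w))" by (simp add: f_def)
    then have "h (emb V v) = h (emb V w)" using emb_proj[OF W he] vw by metis
    then have "emb V v = emb V w" using inj_onD[OF inj] e(1) vw by blast
    then show "v = w" using inj_onD[OF emb(2)[OF V]] vw by blast
  qed
qed

lemma conj_map_simps:
  assumes U: "U \<in> Ob (VA F)" and V: "V \<in> Ob (VA F)" and W: "W \<in> Ob (VA F)"
    and f: "f \<in> lin_maps F U V" and x: "x \<in> img U"
  shows "conj_map U U (\<lambda>u\<in>carrier U. u) x = x"
    and "conj_map U W (compose (carrier U) g f) x = conj_map V W g (conj_map U V f x)"
    and "conj_map U V f x \<in> img V"
  using proj_closed[OF U x] emb_proj[OF U x] proj_emb[OF V] emb_img[OF V] lin_maps_closed[OF f]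
  by (simp_all add: conj_map_def compose_eq)

lemma conj_map_faithful:
  assumes V: "V \<in> Ob (VA F)" and W: "W \<in> Ob (VA F)" and f: "f \<in> lin_maps F V W" and g: "g \<in> lin_maps F V W"
    and eq: "\<And>x. x \<in> img V \<Longrightarrow> conj_map V W f x = conj_map V W g x"
  shows "f = g"
proof (rule lin_maps_eqI[OF f g])
  fix v assume v: "v \<in> carrier V"
  have "emb W (f v) = emb W (g v)" using eq[OF emb_img[OF V v]] by (simp add: conj_map_def proj_emb[OF V v])
  then show "f v = g v"
    using inj_onD[OF emb(2)[OF W]] lin_maps_closed[OF f v] lin_maps_closed[OF g v] by blast
qed

end

section \<open>The equivalences\<close>

context finite_scalars
begin

text \<open>One object for each \<open>Fin n\<close>; these form the exhausting sequence required of
  a \<open>finite_subset_category\<close>.\<close>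

definition std :: "nat \<Rightarrow> ('f, 'a) module" where
  "std n = (SOME W. W \<in> Ob (VA F) \<and> img W = Fin n)"

lemma std:
  assumes "infinite (UNIV :: 'a set)"
  shows "(std n :: ('f, 'a) module) \<in> Ob (VA F)" "img (std n :: ('f, 'a) module) = Fin n"
  using someI_ex[OF Fin_realised[OF assms, of n], folded std_def] by auto

lemma uc_settings:
  assumes "cring K"
  shows "uc_setting K (carrier (\<Omega> F)) (\<E> F)" "uc_setting K (carrier (\<Omega> F)) (\<E>\<^sub>s F)"
    "uc_setting K (carrier (\<Omega> F)) (\<E>\<^sub>i F)" "uc_setting K (carrier (\<Omega> F)) (GL F)"
  using assms self_map_monoids by (simp_all add: uc_setting_def uc_setting_axioms_def)

text \<open>Linear maps between finite spaces come from endomorphisms by \<open>extend_\<E>\<close>,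
  and endomorphisms go back to linear maps by \<open>conj_map_restrict\<close>.\<close>

lemma finite_subset_category_VA:
  assumes K: "cring K" and inf: "infinite (UNIV :: 'a set)"
  shows "finite_subset_category K (carrier (\<Omega> F)) (\<E> F) (VA F :: ('f, 'a) mod_category) img conj_map std"
proof (intro finite_subset_category.intro finite_subset_category_axioms.intro uc_settings[OF K] category_VA,
    unfold VA_simps)
  fix V W :: "('f, 'a) module" and f assume V: "V \<in> Ob (VA F)" and W: "W \<in> Ob (VA F)" and f: "f \<in> lin_maps F V W"
  obtain n where n: "img V = Fin n" using emb(3)[OF V] ..
  obtain h where "h \<in> \<E> F" "\<forall>x\<in>Fin n. h x = restrict (conj_map V W f) (Fin n) x"
    using extend_\<E>[OF conj_map_extends[OF V W f n]] ..
  then show "\<exists>h\<in>\<E> F. \<forall>x\<in>img V. h x = conj_map V W f x" unfolding n by (intro bexI[of _ h]) auto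
next
  fix V W :: "('f, 'a) module" and h assume V: "V \<in> Ob (VA F)" and W: "W \<in> Ob (VA F)"
    and h: "h \<in> \<E> F" and im: "h ` img V \<subseteq> img W"
  note c = conj_map_restrict[OF V W h[unfolded \<E>_iff] im]
  show "\<exists>f\<in>lin_maps F V W. \<forall>x\<in>img V. h x = conj_map V W f x"
    by (rule bexI[OF _ c(1)]) (use c(2) in blast)
next
  fix V W :: "('f, 'a) module" and f g :: "'a \<Rightarrow> 'a"
  assume "V \<in> Ob (VA F)" "W \<in> Ob (VA F)" "f \<in> lin_maps F V W" "g \<in> lin_maps F V W"
    "\<And>x. x \<in> img V \<Longrightarrow> conj_map V W f x = conj_map V W g x"
  then show "f = g" by (rule conj_map_faithful)
next
  fix x n
  show "img (std n :: ('f, 'a) module) \<subseteq> img (std (Suc n) :: ('f, 'a) module)"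
    using Fin_mono[of n "Suc n"] by (simp add: std[OF inf])
  show "x \<in> carrier (\<Omega> F) \<Longrightarrow> \<exists>n. x \<in> img (std n :: ('f, 'a) module)"
    using Fin_cover by (simp add: std[OF inf])
qed (auto simp: finite_img std[OF inf] dest: subsetD[OF img_\<Omega>] intro: conj_map_simps id_in_lin_maps left_module_W)

text \<open>Here \<open>extend_GL\<close> supplies the extensions, which is why the morphisms must
  be injective; conversely automorphisms restrict to injective maps.\<close>

lemma finite_subset_category_VI:
  assumes K: "cring K" and inf: "infinite (UNIV :: 'a set)"
  shows "finite_subset_category K (carrier (\<Omega> F)) (GL F) (VI F :: ('f, 'a) mod_category) img conj_map std"
proof (intro finite_subset_category.intro finite_subset_category_axioms.intro uc_settings[OF K] category_VI,
    unfold VI_simps)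
  fix V W :: "('f, 'a) module" and f assume V: "V \<in> Ob (VA F)" and W: "W \<in> Ob (VA F)"
    and "f \<in> {f \<in> lin_maps F V W. inj_on f (carrier V)}"
  then have f: "f \<in> lin_maps F V W" "inj_on f (carrier V)" by simp_all
  obtain n where n: "img V = Fin n" using emb(3)[OF V] ..
  have "inj_on (restrict (conj_map V W f) (Fin n)) (Fin n)"
    using conj_map_inj[OF V W f] unfolding n by (simp add: inj_on_def)
  from extend_GL[OF conj_map_extends[OF V W f(1) n] this]
  obtain h where "h \<in> GL F" "\<forall>x\<in>Fin n. h x = restrict (conj_map V W f) (Fin n) x" ..
  then show "\<exists>h\<in>GL F. \<forall>x\<in>img V. h x = conj_map V W f x" unfolding n by (intro bexI[of _ h]) auto
next
  fix V W :: "('f, 'a) module" and h assume V: "V \<in> Ob (VA F)" and W: "W \<in> Ob (VA F)"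
    and h: "h \<in> GL F" and im: "h ` img V \<subseteq> img W"
  have hl: "h \<in> lin_maps F (\<Omega> F) (\<Omega> F)" and hi: "inj_on h (carrier (\<Omega> F))"
    using h by (simp_all add: GL_iff bij_betw_def)
  note c = conj_map_restrict[OF V W hl im]
  show "\<exists>f\<in>{f \<in> lin_maps F V W. inj_on f (carrier V)}. \<forall>x\<in>img V. h x = conj_map V W f x"
    by (rule bexI[of _ "\<lambda>v\<in>carrier V. proj W (h (emb V v))"]) (use c(1,2) c(3)[OF hi] in blast)+
next
  fix V W :: "('f, 'a) module" and f g :: "'a \<Rightarrow> 'a"
  assume "V \<in> Ob (VA F)" "W \<in> Ob (VA F)" "f \<in> {f \<in> lin_maps F V W. inj_on f (carrier V)}"
    "g \<in> {f \<in> lin_maps F V W. inj_on f (carrier V)}"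
    "\<And>x. x \<in> img V \<Longrightarrow> conj_map V W f x = conj_map V W g x"
  then show "f = g" by (intro conj_map_faithful[of V W]) simp_all
next
  fix x n
  show "img (std n :: ('f, 'a) module) \<subseteq> img (std (Suc n) :: ('f, 'a) module)"
    using Fin_mono[of n "Suc n"] by (simp add: std[OF inf])
  show "x \<in> carrier (\<Omega> F) \<Longrightarrow> \<exists>n. x \<in> img (std n :: ('f, 'a) module)"
    using Fin_cover by (simp add: std[OF inf])
qed (auto simp: finite_img std[OF inf] dest: subsetD[OF img_\<Omega>] intro: conj_map_simps id_in_lin_maps left_module_W)

text \<open>All inclusions split, so every functor on \<open>VA F\<close> satisfies both conditions
  and \<open>Q\<close> can be constantly true.\<close>

theorem VA_modules_equivalent:
  assumes K: "cring K" and w: "infinite (UNIV :: 'w set)" and u: "infinite (UNIV :: 'u set)"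
  shows "(UCMod K (carrier (\<Omega> F)) (\<E> F) :: ('f self_map \<Rightarrow> 'k, 'u) mod_category) \<simeq>\<^sub>c\<^sub>a\<^sub>t
    functor_cat (VA F :: ('f, 'w) mod_category) (ModCat (K :: ('k, 'y) ring_scheme) :: ('k, 'u) mod_category)"
proof -
  interpret C: finite_subset_category K "carrier (\<Omega> F)" "\<E> F" "VA F :: ('f, 'w) mod_category" img conj_map std
    by (rule finite_subset_category_VA[OF K w])
  have split: "\<exists>r\<in>Hom (VA F) Y X. Cmp (VA F) X Y X r (C.incl X Y) = Idt (VA F) X"
    if X: "X \<in> Ob (VA F)" and Y: "Y \<in> Ob (VA F)" and sub: "img X \<subseteq> img Y" for X Y :: "('f, 'w) module"
  proof -
    obtain n where n: "img X = Fin n" using emb(3)[OF X] ..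
    \<comment> \<open>As \<open>img X\<close> is some \<open>Fin n\<close>, truncation projects
      \<Omega> onto it, and its restriction to \<open>img Y\<close> is a retraction of the
      inclusion.\<close>
    define p where "p = (\<lambda>x\<in>carrier (\<Omega> F). trunc n x)"
    have p: "p \<in> \<E> F"
      unfolding \<E>_iff p_def
      by (rule lin_mapsI) (simp_all add: trunc_Fin[THEN Fin_\<Omega>] trunc_add trunc_smult \<Omega>.smult_closed)
    have im: "p ` img Y \<subseteq> img X"
      using img_\<Omega>[OF Y] trunc_Fin unfolding n by (auto simp: p_def)
    let ?r = "C.restriction p Y X"
    note r = C.restriction_Hom[OF Y X p im] C.T_restriction[OF Y X p im]
    note i = C.incl_Hom[OF X Y sub]
    have "Cmp (VA F) X Y X ?r (C.incl X Y) = Idt (VA F) X"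
    proof (rule C.T_faithful[OF X X])
      fix x assume x: "x \<in> img X"
      then show "conj_map X X (Cmp (VA F) X Y X ?r (C.incl X Y)) x = conj_map X X (Idt (VA F) X) x"
        using sub C.T_Cmp[OF X Y X i r(1) x] C.T_incl[OF X Y sub x] C.T_Idt[OF X x] r(2)[of x] n
        by (auto simp: p_def trunc_eq Fin_\<Omega> simp del: VA_simps)
    qed (use Cmp_in_Hom[OF category_VA X Y X i r(1)] Idt_in_Hom[OF category_VA X] in auto)
    with r(1) show ?thesis by blast
  qed
  have "(UCMod K (carrier (\<Omega> F)) (\<E> F) :: ('f self_map \<Rightarrow> 'k, 'u) mod_category) \<simeq>\<^sub>c\<^sub>a\<^sub>t
    full_subcat (functor_cat (VA F :: ('f, 'w) mod_category) (ModCat K :: ('k, 'u) mod_category)) (\<lambda>_. True)"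
    by (rule C.UCMod_equivalent_functors[OF u TrueI]) (rule C.split_inclusions[OF _ split])
  then show ?thesis by simp
qed

text \<open>Here \<open>Q\<close> is the sheaf condition: the functors of fixed vectors satisfy it
  because \<open>GL F\<close> is a group, and it yields injectivity and descent.\<close>

theorem VI_sheaves_equivalent:
  assumes K: "cring K" and w: "infinite (UNIV :: 'w set)" and u: "infinite (UNIV :: 'u set)"
  shows "(UCMod K (carrier (\<Omega> F)) (GL F) :: ('f self_map \<Rightarrow> 'k, 'u) mod_category) \<simeq>\<^sub>c\<^sub>a\<^sub>t
    Sh (opposite (VI F :: ('f, 'w) mod_category)) (atomic_topology (opposite (VI F)))
      (ModCat (K :: ('k, 'y) ring_scheme) :: ('k, 'u) mod_category)"
proof -
  interpret C: finite_subset_category K "carrier (\<Omega> F)" "GL F" "VI F :: ('f, 'w) mod_category" img conj_map std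
    by (rule finite_subset_category_VI[OF K w])
  show ?thesis
    unfolding Sh_def opposite_opposite
    by (rule C.UCMod_equivalent_functors[OF u])
      (simp_all add: C.atomic_sheaf_fixed_functor[OF inverse_GL] C.atomic_sheaf_conditions)
qed

end

theorem corollary7p23:
  fixes F :: "'f ring" and K :: "'k ring" and q :: nat
  assumes "field F" and "finite (carrier F)" and "card (carrier F) = q"
    and "cring K"
    and "infinite (UNIV :: 'w set)"
    and "infinite (UNIV :: 'u set)"
  shows
    "functor_cat (VA F :: ('f, 'w) mod_category) (ModCat K :: ('k, 'u) mod_category)
       \<simeq>\<^sub>c\<^sub>a\<^sub>t (UCMod K (carrier (\<Omega> F)) (\<E> F) :: ('f self_map \<Rightarrow> 'k, 'u) mod_category) \<and>
     (UCMod K (carrier (\<Omega> F)) (\<E> F) :: ('f self_map \<Rightarrow> 'k, 'u) mod_category)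
       \<simeq>\<^sub>c\<^sub>a\<^sub>t (UCMod K (carrier (\<Omega> F)) (\<E>\<^sub>s F) :: ('f self_map \<Rightarrow> 'k, 'u) mod_category) \<and>
     (UCMod K (carrier (\<Omega> F)) (\<E>\<^sub>i F) :: ('f self_map \<Rightarrow> 'k, 'u) mod_category)
       \<simeq>\<^sub>c\<^sub>a\<^sub>t (UCMod K (carrier (\<Omega> F)) (GL F) :: ('f self_map \<Rightarrow> 'k, 'u) mod_category) \<and>
     (UCMod K (carrier (\<Omega> F)) (GL F) :: ('f self_map \<Rightarrow> 'k, 'u) mod_category)
       \<simeq>\<^sub>c\<^sub>a\<^sub>t Sh (opposite (VI F :: ('f, 'w) mod_category))
         (atomic_topology (opposite (VI F :: ('f, 'w) mod_category)))
         (ModCat K :: ('k, 'u) mod_category)"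
proof (intro conjI)
  interpret finite_scalars F
    using assms(1,2) by (simp add: finite_scalars_def finite_scalars_axioms_def)
  note uc = uc_settings[OF assms(4)]
  show "functor_cat (VA F :: ('f, 'w) mod_category) (ModCat K :: ('k, 'u) mod_category)
       \<simeq>\<^sub>c\<^sub>a\<^sub>t (UCMod K (carrier (\<Omega> F)) (\<E> F) :: ('f self_map \<Rightarrow> 'k, 'u) mod_category)"
    by (rule equivalent_cats_sym[OF VA_modules_equivalent[OF assms(4-6)]])
  show "(UCMod K (carrier (\<Omega> F)) (\<E> F) :: ('f self_map \<Rightarrow> 'k, 'u) mod_category)
       \<simeq>\<^sub>c\<^sub>a\<^sub>t (UCMod K (carrier (\<Omega> F)) (\<E>\<^sub>s F) :: ('f self_map \<Rightarrow> 'k, 'u) mod_category)"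
    by (rule UCMod_dense_submonoid[OF uc(2,1) _ dense_surj]) (auto simp: End_surj_def)
  show "(UCMod K (carrier (\<Omega> F)) (\<E>\<^sub>i F) :: ('f self_map \<Rightarrow> 'k, 'u) mod_category)
       \<simeq>\<^sub>c\<^sub>a\<^sub>t (UCMod K (carrier (\<Omega> F)) (GL F) :: ('f self_map \<Rightarrow> 'k, 'u) mod_category)"
    by (rule UCMod_dense_submonoid[OF uc(4,3) GL_subset_inj dense_GL])
  show "(UCMod K (carrier (\<Omega> F)) (GL F) :: ('f self_map \<Rightarrow> 'k, 'u) mod_category)
       \<simeq>\<^sub>c\<^sub>a\<^sub>t Sh (opposite (VI F :: ('f, 'w) mod_category))
         (atomic_topology (opposite (VI F :: ('f, 'w) mod_category)))
         (ModCat K :: ('k, 'u) mod_category)"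
    by (rule VI_sheaves_equivalent[OF assms(4-6)])
qed

end
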